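(* Let $(\tilde b,\tilde\Gamma)\in\mathscr P_0$ and let $\tilde u\in\mathscr E^m_0$ be a solution of \[ \frac{\partial\tilde\rho}{\partial t}=\frac12\nabla\cdot\big[D(\tilde\rho)\nabla\tilde\rho\big]-\nabla\cdot\Big[A(\tilde\rho)\Big(\tilde b-\frac1\lambda\tilde\Gamma\tilde\rho\Big)\Big]\qquad(\ast) \] (for this $(\tilde b,\tilde\Gamma)$) with initial condition $\gamma_0(x)$, where $\gamma_0=(\gamma_{0,1},\dots,\gamma_{0,m})^\dagger$ satisfies $\int_{\mathbb T}\gamma(x)\log\gamma(x)dx<\infty$ for $\gamma=\sum_c\gamma_{0,c}$. If $\tilde v\in\mathscr D^m_0$ is another weak solution of $(\ast)$ with the same initial condition, then $\tilde v=\tilde u$.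
   Context: Setting: $\mathbb T=\mathbb R/\mathbb Z$, $\lambda>0$, $T>0$, $m\ge1$, $\bar\rho_1,\dots,\bar\rho_m>0$. For $\tilde\rho=(\rho_1,\dots,\rho_m)^\dagger$, $\rho=\sum_c\rho_c$, $D(\tilde\rho)_{ij}=\frac{\delta_{ij}\lambda+\rho_i}{\lambda+\rho}$, $A(\tilde\rho)_{ij}=\frac{\delta_{ij}\lambda\rho_j+\rho_i\rho_j}{\lambda+\rho}$. $\mathscr P_0$: pairs $(\tilde b,\tilde\Gamma)$, $\tilde b=(b_1,\dots,b_m)^\dagger$, $\tilde\Gamma=(\gamma_{c_1,c_2})$ an $m\times m$ matrix, of smooth functions on $[0,T]\times\mathbb T$, with $\tilde b\equiv0$, $\tilde\Gamma\equiv0$ on $t\in[0,\eta]$ for some $\eta>0$, and $\tilde\Gamma$ skew-symmetric with zero diagonal. $\mathscr D^m_{color}$: the set of $\tilde\rho(t,x)dx\in C([0,T],\mathscr M(\mathbb T)^m)$ with $\rho_c(t,\cdot)\ge0$ of mass $\bar\rho_c$, each $\rho_c$ weakly differentiable in $x$, $\int_0^T\int_{\mathbb T}[\frac{(\nabla\rho)^2}{\lambda+\rho}+\sum_c\frac{(\nabla\rho_c)^2}{(\lambda+\rho)\rho_c}]dxdt<\infty$ and $\int\rho(0,x)\log\rho(0,x)dx<\infty$. On it, $I^m_{dyn}(\tilde\rho)=\sup_{\phi\in C^\infty([0,T]\times\mathbb T)^m}\{\int\phi^\dagger\tilde\rho(T)dx-\int\phi^\dagger\tilde\rho(0)dx+\int_0^T\int[-\partial_t\phi^\dagger\tilde\rho+\frac12\nabla\phi^\dagger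 D(\tilde\rho)\nabla\tilde\rho-\frac12\nabla\phi^\dagger A(\tilde\rho)\nabla\phi]dxdt\}$, and $I^m_{color}(\tilde\rho)=I^m_{init}(\tilde\rho(0,x)dx)+I^m_{dyn}(\tilde\rho)$ ($+\infty$ off $\mathscr D^m_{color}$), where $I^m_{init}$ is the given large deviation rate function of the initial empirical densities of colors (the initial positions being i.i.d. with a bounded density on $\mathbb T$). $\mathscr D^m_0=\{\tilde\rho: I^m_{color}(\tilde\rho)<\infty\}$. $\mathscr E^m_0$ is the set of $\tilde\rho\in\mathscr D^m_0$ which are smooth on $(0,T]\times\mathbb T$, solve $(\ast)$ for some $(\tilde b,\tilde\Gamma)\in\mathscr P_0$, and satisfy $\min_c\inf_{(t,x)\in[\eta,T]\times\mathbb T}\rho_c(t,x)>\epsilon$ for some $\epsilon>0$, where $\eta$ is such that $(\tilde b,\tilde\Gamma)$ vanishes on $[0,\eta]$. *)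

theory Defs
  imports "HOL-Analysis.Analysis"
begin

text \<open>Conventions. Colours are indexed by c < m. A space-time field is a function
  rho :: nat => real => real => real, rho c t x. The torus R/Z is represented by
  1-periodic functions on the real line, integrals over the torus are over {0..1}.\<close>

fun pdiff :: "bool list \<Rightarrow> (real \<Rightarrow> real \<Rightarrow> real) \<Rightarrow> real \<Rightarrow> real \<Rightarrow> real" where
  "pdiff [] f = f"
| "pdiff (d # ds) f =
     (if d then (\<lambda>t x. deriv (\<lambda>s. pdiff ds f s x) t)
           else (\<lambda>t x. deriv (\<lambda>y. pdiff ds f t y) x))"

definition smooth2 :: "(real \<Rightarrow> real \<Rightarrow> real) \<Rightarrow> bool" where
  "smooth2 f \<longleftrightarrow> (\<forall>ds. (\<lambda>p. pdiff ds f (fst p) (snd p)) differentiable_on UNIV)"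

definition periodic_x :: "(real \<Rightarrow> real \<Rightarrow> real) \<Rightarrow> bool" where
  "periodic_x f \<longleftrightarrow> (\<forall>t x. f t (x + 1) = f t x)"

text \<open>Smooth functions on [0,T] x torus (restrictions of smooth x-periodic functions on R^2).\<close>
definition smooth_test :: "(real \<Rightarrow> real \<Rightarrow> real) \<Rightarrow> bool" where
  "smooth_test f \<longleftrightarrow> smooth2 f \<and> periodic_x f"

definition dt :: "(real \<Rightarrow> real \<Rightarrow> real) \<Rightarrow> real \<Rightarrow> real \<Rightarrow> real" where
  "dt f t x = deriv (\<lambda>s. f s x) t"

definition dx :: "(real \<Rightarrow> real \<Rightarrow> real) \<Rightarrow> real \<Rightarrow> real \<Rightarrow> real" where
  "dx f t x = deriv (\<lambda>y. f t y) x"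

definition Dmat :: "real \<Rightarrow> nat \<Rightarrow> (nat \<Rightarrow> real) \<Rightarrow> nat \<Rightarrow> nat \<Rightarrow> real" where
  "Dmat lam m r i j = ((if i = j then lam else 0) + r i) / (lam + (\<Sum>c<m. r c))"

definition Amat :: "real \<Rightarrow> nat \<Rightarrow> (nat \<Rightarrow> real) \<Rightarrow> nat \<Rightarrow> nat \<Rightarrow> real" where
  "Amat lam m r i j = ((if i = j then lam * r j else 0) + r i * r j) / (lam + (\<Sum>c<m. r c))"

definition P0 :: "nat \<Rightarrow> (nat \<Rightarrow> real \<Rightarrow> real \<Rightarrow> real) \<Rightarrow> (nat \<Rightarrow> nat \<Rightarrow> real \<Rightarrow> real \<Rightarrow> real) \<Rightarrow> real \<Rightarrow> bool" where
  "P0 m b G eta \<longleftrightarrow> eta > 0 \<and>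
     (\<forall>c<m. smooth_test (b c)) \<and> (\<forall>i<m. \<forall>j<m. smooth_test (G i j)) \<and>
     (\<forall>c<m. \<forall>t\<in>{0..eta}. \<forall>x. b c t x = 0) \<and>
     (\<forall>i<m. \<forall>j<m. \<forall>t\<in>{0..eta}. \<forall>x. G i j t x = 0) \<and>
     (\<forall>i<m. \<forall>j<m. \<forall>t x. G i j t x = - G j i t x) \<and>
     (\<forall>i<m. \<forall>t x. G i i t x = 0)"

definition weak_dx :: "real \<Rightarrow> (real \<Rightarrow> real \<Rightarrow> real) \<Rightarrow> (real \<Rightarrow> real \<Rightarrow> real) \<Rightarrow> bool" where
  "weak_dx T r g \<longleftrightarrow>
     (\<lambda>p. g (fst p) (snd p)) \<in> borel_measurable lborel \<and>
     set_integrable lborel ({0..T} \<times> {0..1}) (\<lambda>p. g (fst p) (snd p)) \<and>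
     (\<forall>\<phi>. smooth_test \<phi> \<longrightarrow>
        (LINT p:{0..T} \<times> {0..1}|lborel. r (fst p) (snd p) * dx \<phi> (fst p) (snd p)) =
        - (LINT p:{0..T} \<times> {0..1}|lborel. g (fst p) (snd p) * \<phi> (fst p) (snd p)))"

definition Dcolor :: "nat \<Rightarrow> real \<Rightarrow> real \<Rightarrow> (nat \<Rightarrow> real) \<Rightarrow>
    (nat \<Rightarrow> real \<Rightarrow> real \<Rightarrow> real) \<Rightarrow> (nat \<Rightarrow> real \<Rightarrow> real \<Rightarrow> real) \<Rightarrow> bool" where
  "Dcolor m lam T rbar \<rho> g \<longleftrightarrow>
     (\<forall>c<m. (\<lambda>p. \<rho> c (fst p) (snd p)) \<in> borel_measurable lborel) \<and>
     (\<forall>c<m. \<forall>t\<in>{0..T}. \<forall>x\<in>{0..1}. \<rho> c t x \<ge> 0) \<and>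
     (\<forall>c<m. \<forall>t\<in>{0..T}. set_integrable lborel {0..1} (\<rho> c t) \<and>
              (LINT x:{0..1}|lborel. \<rho> c t x) = rbar c) \<and>
     (\<forall>c<m. \<forall>f. continuous_on UNIV f \<and> (\<forall>x. f (x + 1) = f x) \<longrightarrow>
              continuous_on {0..T} (\<lambda>t. LINT x:{0..1}|lborel. f x * \<rho> c t x)) \<and>
     (\<forall>c<m. weak_dx T (\<rho> c) (g c)) \<and>
     (\<integral>\<^sup>+ p\<in>{0..T} \<times> {0..1}.
         ennreal ((\<Sum>c<m. g c (fst p) (snd p))\<^sup>2 / (lam + (\<Sum>c<m. \<rho> c (fst p) (snd p)))
           + (\<Sum>c<m. (g c (fst p) (snd p))\<^sup>2 /
                ((lam + (\<Sum>c'<m. \<rho> c' (fst p) (snd p))) * \<rho> c (fst p) (snd p)))) \<partial>lborel) < \<infinity> \<and>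
     (\<integral>\<^sup>+ x\<in>{0..1}. ennreal ((\<Sum>c<m. \<rho> c 0 x) * ln (\<Sum>c<m. \<rho> c 0 x)) \<partial>lborel) < \<infinity>"

definition Idyn :: "nat \<Rightarrow> real \<Rightarrow> real \<Rightarrow>
    (nat \<Rightarrow> real \<Rightarrow> real \<Rightarrow> real) \<Rightarrow> (nat \<Rightarrow> real \<Rightarrow> real \<Rightarrow> real) \<Rightarrow> ereal" where
  "Idyn m lam T \<rho> g =
     (SUP \<phi>\<in>{\<phi>. \<forall>c<m. smooth_test (\<phi> c)}. ereal (
        (\<Sum>c<m. LINT x:{0..1}|lborel. \<phi> c T x * \<rho> c T x)
      - (\<Sum>c<m. LINT x:{0..1}|lborel. \<phi> c 0 x * \<rho> c 0 x)
      + (LINT p:{0..T} \<times> {0..1}|lborel.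
           (let t = fst p; x = snd p; r = (\<lambda>c. \<rho> c t x) in
             - (\<Sum>c<m. dt (\<phi> c) t x * \<rho> c t x)
             + 1/2 * (\<Sum>i<m. \<Sum>j<m. dx (\<phi> i) t x * Dmat lam m r i j * g j t x)
             - 1/2 * (\<Sum>i<m. \<Sum>j<m. dx (\<phi> i) t x * Amat lam m r i j * dx (\<phi> j) t x)))))"

definition init_measures :: "(nat \<Rightarrow> real \<Rightarrow> real \<Rightarrow> real) \<Rightarrow> nat \<Rightarrow> real measure" where
  "init_measures \<rho> c = density lborel (\<lambda>x. indicator {0..1} x * ennreal (\<rho> c 0 x))"

text \<open>Full rate function; Iinit is the (given) rate function of the initial data.\<close>
definition Icolor :: "((nat \<Rightarrow> real measure) \<Rightarrow> ennreal) \<Rightarrow> nat \<Rightarrow> real \<Rightarrow> real \<Rightarrow> (nat \<Rightarrow> real) \<Rightarrow>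
    (nat \<Rightarrow> real \<Rightarrow> real \<Rightarrow> real) \<Rightarrow> ereal" where
  "Icolor Iinit m lam T rbar \<rho> =
     (if (\<exists>g. Dcolor m lam T rbar \<rho> g)
      then enn2ereal (Iinit (init_measures \<rho>)) + Idyn m lam T \<rho> (SOME g. Dcolor m lam T rbar \<rho> g)
      else \<infinity>)"

definition in_D0 :: "((nat \<Rightarrow> real measure) \<Rightarrow> ennreal) \<Rightarrow> nat \<Rightarrow> real \<Rightarrow> real \<Rightarrow> (nat \<Rightarrow> real) \<Rightarrow>
    (nat \<Rightarrow> real \<Rightarrow> real \<Rightarrow> real) \<Rightarrow> bool" where
  "in_D0 Iinit m lam T rbar \<rho> \<longleftrightarrow> Icolor Iinit m lam T rbar \<rho> < \<infinity>"

definition weak_solution :: "nat \<Rightarrow> real \<Rightarrow> real \<Rightarrow>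
    (nat \<Rightarrow> real \<Rightarrow> real \<Rightarrow> real) \<Rightarrow> (nat \<Rightarrow> nat \<Rightarrow> real \<Rightarrow> real \<Rightarrow> real) \<Rightarrow>
    (nat \<Rightarrow> real \<Rightarrow> real) \<Rightarrow> (nat \<Rightarrow> real \<Rightarrow> real \<Rightarrow> real) \<Rightarrow> bool" where
  "weak_solution m lam T b G \<gamma>0 \<rho> \<longleftrightarrow>
     (\<exists>g. (\<forall>c<m. weak_dx T (\<rho> c) (g c)) \<and>
       (\<forall>\<phi>. (\<forall>c<m. smooth_test (\<phi> c)) \<longrightarrow> (\<forall>t\<in>{0..T}.
          (\<Sum>c<m. LINT x:{0..1}|lborel. \<phi> c t x * \<rho> c t x)
        - (\<Sum>c<m. LINT x:{0..1}|lborel. \<phi> c 0 x * \<gamma>0 c x)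
        - (LINT p:{0..t} \<times> {0..1}|lborel. \<Sum>c<m. dt (\<phi> c) (fst p) (snd p) * \<rho> c (fst p) (snd p))
        = (LINT p:{0..t} \<times> {0..1}|lborel.
             (let s = fst p; x = snd p; r = (\<lambda>c. \<rho> c s x) in
               - 1/2 * (\<Sum>i<m. \<Sum>j<m. dx (\<phi> i) s x * Dmat lam m r i j * g j s x)
               + (\<Sum>i<m. \<Sum>j<m. dx (\<phi> i) s x * Amat lam m r i j *
                    (b j s x - 1/lam * (\<Sum>k<m. G j k s x * \<rho> k s x))))))))"

definition in_E0 :: "((nat \<Rightarrow> real measure) \<Rightarrow> ennreal) \<Rightarrow> nat \<Rightarrow> real \<Rightarrow> real \<Rightarrow> (nat \<Rightarrow> real) \<Rightarrow>
    (nat \<Rightarrow> real \<Rightarrow> real \<Rightarrow> real) \<Rightarrow> bool" where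
  "in_E0 Iinit m lam T rbar \<rho> \<longleftrightarrow>
     in_D0 Iinit m lam T rbar \<rho> \<and>
     (\<forall>c<m. \<forall>t\<in>{0<..T}. \<forall>x. \<rho> c t (x + 1) = \<rho> c t x) \<and>
     (\<forall>c<m. \<forall>s\<in>{0<..T}. \<exists>f. smooth2 f \<and> (\<forall>t\<in>{s..T}. \<forall>x. \<rho> c t x = f t x)) \<and>
     (\<exists>b G eta. P0 m b G eta \<and> weak_solution m lam T b G (\<lambda>c x. \<rho> c 0 x) \<rho> \<and>
        (\<exists>\<epsilon>>0. \<forall>c<m. \<forall>t\<in>{eta..T}. \<forall>x. \<epsilon> < \<rho> c t x))"

end

(* Idea. Let w_c = v_c - u_c and let W_c be the primitive of w_c in space that is the time integral
   of the difference of the fluxes, so W_c vanishes at time 0. Testing with W_c and the weight lam + rho_v,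
   rho_v the total density of v, turns D(v) dx v - D(u) dx u into lam dx w_c plus terms in which dx v
   occurs only inside exact derivatives or cancels against the time derivative of the weight. What remains is
     d/dt int W_c^2 (lam + rho_v) <= - lam int w_c^2 + terms involving only u, dx u and w,
   and the terms with the total difference w = sum w_c are absorbed by kappa times the analogous estimate
   d/dt int W^2 = - int w^2 + ... for the total density. On [0, eta] the coefficients vanish, the total
   densities solve the heat equation and coincide, which removes the terms that need bounds on u; on [eta, T] the density u
   is smooth. The remaining factor sup_x rho_v(t, x) is square integrable in time by the finite energy,
   and Gronwall's inequality gives W_c = 0. *)

theory Submission
  imports Defs
begin

text \<open>The finite energy gives no pointwise control of the gradient of v, so the test function
  is a primitive: it is bounded, and its derivatives in time and space are the flux difference and
  w_c. The weight is the denominator of D(v), hence it clears the flux of v. It is itself driven by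
  the total flux of v, whose diffusive part is half of dx rho_v; this is exactly what removes W_c
  w_c dx rho_v. The flux of u meets the wrong denominator, which costs only the total difference w
  times a quantity of u. The second obstacle is regularity. The time derivative of the weight is the
  space derivative of a merely integrable flux, so the product rule is proved for averages of the
  weight over short space intervals; the passage to the limit uses continuous representatives at
  almost every time. Everything distributional is read off from Fourier modes: they determine
  integrable functions, and there are countably many of them, so a single null set of times serves
  for all. The constant kappa is m times R^2/lam + 1, the coefficient with which w^2 enters the
  estimate of one colour after Young's inequality.\<close>

section \<open>Lebesgue measure on an interval\<close>

text \<open>A density rather than \<^term>\<open>restrict_space\<close>, so that the measurable sets stay those of
  \<^term>\<open>borel\<close>. It is the zero measure if \<open>b \<le> a\<close>.\<close>

definition mu :: "real \<Rightarrow> real \<Rightarrow> real measure" where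
  "mu a b = density lborel (indicator {a..b})"

lemma sets_mu [measurable_cong, simp]: "sets (mu a b) = sets borel"
  by (simp add: mu_def)

lemma space_mu [simp]: "space (mu a b) = UNIV"
  by (simp add: mu_def)

lemma borel_measurable_mu [simp]: "borel_measurable (mu a b) = borel_measurable borel"
  by (rule measurable_cong_sets) simp_all

lemma emeasure_mu: "emeasure (mu a b) UNIV = ennreal (max 0 (b - a))"
proof -
  have "emeasure (mu a b) UNIV = emeasure lborel {a..b}"
    by (simp add: mu_def emeasure_density)
  then show ?thesis by (simp add: emeasure_lborel_Icc_eq max_def)
qed

interpretation mu: finite_measure "mu a b" for a b
  by standard (simp add: emeasure_mu)

interpretation mup: pair_sigma_finite "mu a b" "mu c d" for a b c d ..

lemma measure_mu: "a \<le> b \<Longrightarrow> measure (mu a b) UNIV = b - a"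
  by (simp add: measure_def emeasure_mu)

lemma AE_mu: "(AE x in mu a b. P x) \<longleftrightarrow> (AE x in lborel. x \<in> {a..b} \<longrightarrow> P x)"
  unfolding mu_def by (subst AE_density) (auto simp: indicator_def)

lemma AE_mu_in: "AE x in mu a b. x \<in> {a..b}"
  by (simp add: AE_mu)

lemma AE_mu_subset: "AE x in mu a b. P x \<Longrightarrow> a \<le> c \<Longrightarrow> d \<le> b \<Longrightarrow> AE x in mu c d. P x"
  unfolding AE_mu by (elim eventually_mono) auto

lemma AE_mu_lborel: "AE x in lborel. P x \<Longrightarrow> AE x in mu a b. P x"
  unfolding AE_mu by (elim eventually_mono) auto

lemma AE_mu_neq: "AE x in mu a b. x \<noteq> c"
  using AE_lborel_singleton[of c] by (intro AE_mu_lborel)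

lemma integral_mu:
  fixes f :: "real \<Rightarrow> real"
  assumes "f \<in> borel_measurable borel"
  shows "integral\<^sup>L (mu a b) f = (\<integral>x. indicator {a..b} x * f x \<partial>lborel)"
proof -
  have "mu a b = density lborel (\<lambda>x. ennreal (indicator {a..b} x))"
    by (simp add: mu_def ennreal_indicator)
  then show ?thesis using assms by (simp add: integral_density)
qed

lemma integrable_mu:
  fixes f :: "real \<Rightarrow> real"
  assumes "f \<in> borel_measurable borel"
  shows "integrable (mu a b) f \<longleftrightarrow> integrable lborel (\<lambda>x. indicator {a..b} x * f x)"
proof -
  have "mu a b = density lborel (\<lambda>x. ennreal (indicator {a..b} x))"
    by (simp add: mu_def ennreal_indicator)
  then show ?thesis using assms by (simp add: integrable_density)
qed

lemma integrable_mu_meas: "integrable (mu a b) f \<Longrightarrow> f \<in> borel_measurable borel"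
  using borel_measurable_integrable[of "mu a b" f] by simp

lemma integrable_mu_subset:
  fixes f :: "real \<Rightarrow> real"
  assumes f: "integrable (mu a b) f" and "a \<le> c" "d \<le> b"
  shows "integrable (mu c d) f"
proof -
  have [measurable]: "f \<in> borel_measurable borel" by (rule integrable_mu_meas[OF f])
  have "integrable lborel (\<lambda>x. indicator {a..b} x * f x)" using f by (simp add: integrable_mu)
  then have "integrable lborel (\<lambda>x. indicator {c..d} x *\<^sub>R (indicator {a..b} x * f x))"
    by (rule integrable_mult_indicator[rotated]) simp
  also have "(\<lambda>x. indicator {c..d} x *\<^sub>R (indicator {a..b} x * f x)) = (\<lambda>x. indicator {c..d} x * f x)"
    using assms by (auto simp: indicator_def fun_eq_iff)
  finally show ?thesis by (simp add: integrable_mu)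
qed

lemma integral_mu_indicator:
  fixes f :: "real \<Rightarrow> real"
  assumes [measurable]: "f \<in> borel_measurable borel" and "a \<le> c" "d \<le> b"
  shows "integral\<^sup>L (mu c d) f = (\<integral>x. indicator {c..d} x * f x \<partial>mu a b)"
proof -
  have *: "indicator {a..b} x * (indicator {c..d} x * f x) = indicator {c..d} x * f x" for x
    using assms by (auto simp: indicator_def)
  show ?thesis by (simp add: integral_mu *)
qed

lemma integrable_mu_bounded:
  fixes f :: "real \<Rightarrow> real"
  assumes "f \<in> borel_measurable borel" "AE x in mu a b. \<bar>f x\<bar> \<le> B"
  shows "integrable (mu a b) f"
  using assms by (intro mu.integrable_const_bound[where B=B]) auto

lemma integral_mu_combine:
  fixes f :: "real \<Rightarrow> real"
  assumes f: "integrable (mu a c) f" and "a \<le> b" "b \<le> c"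
  shows "integral\<^sup>L (mu a c) f = integral\<^sup>L (mu a b) f + integral\<^sup>L (mu b c) f"
proof -
  have [measurable]: "f \<in> borel_measurable borel" by (rule integrable_mu_meas[OF f])
  have i: "integrable lborel (\<lambda>x. indicator {a..b} x * f x)" "integrable lborel (\<lambda>x. indicator {b..c} x * f x)"
    using integrable_mu_subset[OF f, of a b] integrable_mu_subset[OF f, of b c] assms(2,3)
    by (auto simp: integrable_mu)
  have "(\<integral>x. indicator {a..c} x * f x \<partial>lborel)
      = (\<integral>x. indicator {a..b} x * f x + indicator {b..c} x * f x \<partial>lborel)"
  proof (rule integral_cong_AE)
    show "AE x in lborel. indicator {a..c} x * f x = indicator {a..b} x * f x + indicator {b..c} x * f x"
      using AE_lborel_singleton[of b] by eventually_elim (use assms in \<open>auto simp: indicator_def\<close>)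
  qed auto
  then show ?thesis using i by (simp add: integral_mu)
qed

lemma integral_mu_trivial [simp]: "integral\<^sup>L (mu a a) (f :: real \<Rightarrow> real) = 0"
proof -
  have "AE x in mu a a. False" unfolding AE_mu using AE_lborel_singleton[of a] by (auto elim!: eventually_mono)
  then show ?thesis using integral_eq_zero_AE[of f "mu a a"] by (metis (mono_tags, lifting) eventually_mono)
qed

lemma abs_integral_mu_le:
  fixes f :: "real \<Rightarrow> real"
  assumes "integrable (mu a b) f" "AE x in mu a b. \<bar>f x\<bar> \<le> B" "a \<le> b"
  shows "\<bar>integral\<^sup>L (mu a b) f\<bar> \<le> B * (b - a)"
proof -
  have "\<bar>integral\<^sup>L (mu a b) f\<bar> \<le> (\<integral>x. \<bar>f x\<bar> \<partial>mu a b)" by (rule integral_abs_bound)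
  also have "\<dots> \<le> (\<integral>x. B \<partial>mu a b)" using assms by (intro integral_mono_AE) auto
  finally show ?thesis using assms by (simp add: measure_mu mult.commute)
qed

text \<open>The passage to the gauge integral gives access to the continuity of indefinite integrals
  and to the fundamental theorem of calculus.\<close>

lemma mu_has_integral:
  fixes f :: "real \<Rightarrow> real"
  assumes f: "integrable (mu a b) f"
  shows "f integrable_on {a..b}" "integral\<^sup>L (mu a b) f = integral {a..b} f"
proof -
  have [measurable]: "f \<in> borel_measurable borel" by (rule integrable_mu_meas[OF f])
  have s: "set_integrable lborel {a..b} f" using f by (simp add: integrable_mu set_integrable_def)
  show "f integrable_on {a..b}" by (rule set_borel_integral_eq_integral(1)[OF s])
  show "integral\<^sup>L (mu a b) f = integral {a..b} f"
    using set_borel_integral_eq_integral(2)[OF s] by (simp add: integral_mu set_lebesgue_integral_def)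
qed

lemma continuous_indefinite_mu:
  fixes f :: "real \<Rightarrow> real"
  assumes f: "integrable (mu a b) f"
  shows "continuous_on {a..b} (\<lambda>x. integral\<^sup>L (mu a x) f)"
proof -
  have "continuous_on {a..b} (\<lambda>x. integral {a..x} f)"
    by (rule indefinite_integral_continuous_1) (rule mu_has_integral[OF f])
  then show ?thesis
    by (rule continuous_on_eq) (auto intro!: mu_has_integral(2)[symmetric] integrable_mu_subset[OF f])
qed

lemma borel_indefinite_mu [measurable]:
  fixes f :: "real \<Rightarrow> real"
  assumes [measurable]: "f \<in> borel_measurable borel"
  shows "(\<lambda>x. integral\<^sup>L (mu a x) f) \<in> borel_measurable borel"
proof -
  \<comment> \<open>The moving endpoint becomes a condition under an integral over a fixed measure,
    where joint measurability applies.\<close>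
  have "(\<lambda>x. \<integral>y. (if a \<le> y \<and> y \<le> x then f y else 0) \<partial>lborel) \<in> borel_measurable borel"
    by measurable
  also have "(\<lambda>x. \<integral>y. (if a \<le> y \<and> y \<le> x then f y else 0) \<partial>lborel) = (\<lambda>x. integral\<^sup>L (mu a x) f)"
    by (auto simp: integral_mu fun_eq_iff indicator_def intro!: Bochner_Integration.integral_cong)
  finally show ?thesis .
qed

lemma abs_indefinite_mu_le:
  fixes f :: "real \<Rightarrow> real"
  assumes f: "integrable (mu a b) f" and "x \<le> b"
  shows "\<bar>integral\<^sup>L (mu a x) f\<bar> \<le> (\<integral>y. \<bar>f y\<bar> \<partial>mu a b)"
proof -
  have [measurable]: "f \<in> borel_measurable borel" by (rule integrable_mu_meas[OF f])
  have "\<bar>integral\<^sup>L (mu a x) f\<bar> = \<bar>\<integral>y. indicator {a..x} y * f y \<partial>mu a b\<bar>"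
    using assms by (simp add: integral_mu_indicator[of f a a x b])
  also have "\<dots> \<le> (\<integral>y. \<bar>indicator {a..x} y * f y\<bar> \<partial>mu a b)" by (rule integral_abs_bound)
  also have "\<dots> \<le> (\<integral>y. \<bar>f y\<bar> \<partial>mu a b)"
    by (rule integral_mono_AE')
      (use f in \<open>auto simp: indicator_def\<close>)
  finally show ?thesis .
qed

text \<open>The product of the two integrals is an integral over the square. Cutting the square
  along the diagonal and applying Fubini to each triangle gives the two terms, so integrability of
  \<open>f\<close> and \<open>g\<close> suffices. The constants \<open>c\<close> and
  \<open>d\<close> are the initial values of the primitives.\<close>

lemma integral_by_parts_mu:
  fixes f g :: "real \<Rightarrow> real" and c d :: real
  assumes f: "integrable (mu a b) f" and g: "integrable (mu a b) g" and ab: "a \<le> b"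
  defines "F \<equiv> \<lambda>x. c + integral\<^sup>L (mu a x) f" and "G \<equiv> \<lambda>x. d + integral\<^sup>L (mu a x) g"
  shows "integrable (mu a b) (\<lambda>x. f x * G x + F x * g x)"
    and "F b * G b = c * d + (\<integral>x. f x * G x + F x * g x \<partial>mu a b)"
proof -
  have [measurable]: "f \<in> borel_measurable borel" "g \<in> borel_measurable borel"
    using f g by (auto intro: integrable_mu_meas)
  have fg: "integrable (mu a b \<Otimes>\<^sub>M mu a b) (\<lambda>(x, y). f x * g y)"
    by (intro mup.Fubini_integrable)
       (use f g in \<open>auto simp: abs_mult intro!: integrable_mult_left\<close>)
  have iF: "integrable (mu a b) (\<lambda>x. f x * integral\<^sup>L (mu a x) g)" if "integrable (mu a b) f" "integrable (mu a b) g" for f g :: "real \<Rightarrow> real"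
  proof (rule Bochner_Integration.integrable_bound)
    have [measurable]: "f \<in> borel_measurable borel" "g \<in> borel_measurable borel"
      using that by (auto intro: integrable_mu_meas)
    show "integrable (mu a b) (\<lambda>x. f x * (\<integral>y. \<bar>g y\<bar> \<partial>mu a b))" using that by simp
    show "(\<lambda>x. f x * integral\<^sup>L (mu a x) g) \<in> borel_measurable (mu a b)" by simp
    show "AE x in mu a b. norm (f x * integral\<^sup>L (mu a x) g) \<le> norm (f x * (\<integral>y. \<bar>g y\<bar> \<partial>mu a b))"
      using AE_mu_in by eventually_elim (auto simp: abs_mult intro!: mult_left_mono order_trans[OF abs_indefinite_mu_le[OF that(2)]])
  qed
  have i1: "integrable (mu a b) (\<lambda>x. f x * integral\<^sup>L (mu a x) g)"
    and i2: "integrable (mu a b) (\<lambda>x. g x * integral\<^sup>L (mu a x) f)" using iF f g by auto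
  let ?I = "\<lambda>x y. f x * g y * (if y \<le> x then 1 else 0)"
  \<comment> \<open>Strict here and weak in \<open>?I\<close>, so that the two triangles partition
    the square; the diagonal is discarded below with \<open>AE_mu_neq\<close>.\<close>
  let ?J = "\<lambda>x y. f x * g y * (if x < y then 1 else 0)"
  have I: "integrable (mu a b \<Otimes>\<^sub>M mu a b) (\<lambda>(x, y). ?I x y)"
    by (rule Bochner_Integration.integrable_bound[OF fg]) auto
  have J: "integrable (mu a b \<Otimes>\<^sub>M mu a b) (\<lambda>(x, y). ?J x y)"
    by (rule Bochner_Integration.integrable_bound[OF fg]) auto
  have "(\<integral>x. f x \<partial>mu a b) * (\<integral>y. g y \<partial>mu a b) = (\<integral>x. (\<integral>y. f x * g y \<partial>mu a b) \<partial>mu a b)" by simp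
  also have "\<dots> = integral\<^sup>L (mu a b \<Otimes>\<^sub>M mu a b) (\<lambda>(x, y). f x * g y)"
    by (rule mup.integral_fst[OF fg])
  also have "\<dots> = integral\<^sup>L (mu a b \<Otimes>\<^sub>M mu a b) (\<lambda>p. (case p of (x, y) \<Rightarrow> ?I x y) + (case p of (x,y) \<Rightarrow> ?J x y))"
    by (intro Bochner_Integration.integral_cong) auto
  also have "\<dots> = integral\<^sup>L (mu a b \<Otimes>\<^sub>M mu a b) (\<lambda>(x, y). ?I x y) + integral\<^sup>L (mu a b \<Otimes>\<^sub>M mu a b) (\<lambda>(x, y). ?J x y)"
    by (rule Bochner_Integration.integral_add[OF I J])
  also have "integral\<^sup>L (mu a b \<Otimes>\<^sub>M mu a b) (\<lambda>(x, y). ?I x y) = (\<integral>x. (\<integral>y. ?I x y \<partial>mu a b) \<partial>mu a b)"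
    by (rule mup.integral_fst[OF I, symmetric])
  also have "\<dots> = (\<integral>x. f x * integral\<^sup>L (mu a x) g \<partial>mu a b)"
  proof (rule integral_cong_AE)
    show "AE x in mu a b. (\<integral>y. ?I x y \<partial>mu a b) = f x * integral\<^sup>L (mu a x) g"
      using AE_mu_in
    proof eventually_elim
      case (elim x)
      have "(\<integral>y. ?I x y \<partial>mu a b) = (\<integral>y. f x * (indicator {a..x} y * g y) \<partial>mu a b)"
      proof (rule integral_cong_AE)
        show "AE y in mu a b. ?I x y = f x * (indicator {a..x} y * g y)"
          using AE_mu_in by eventually_elim (auto simp: indicator_def)
      qed auto
      then show ?case using elim by (simp add: integral_mu_indicator[of g a a x b])
    qed
  qed auto
  also have "integral\<^sup>L (mu a b \<Otimes>\<^sub>M mu a b) (\<lambda>(x, y). ?J x y) = (\<integral>y. (\<integral>x. ?J x y \<partial>mu a b) \<partial>mu a b)"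
    by (rule mup.integral_snd[OF J, symmetric])
  also have "\<dots> = (\<integral>y. g y * integral\<^sup>L (mu a y) f \<partial>mu a b)"
  proof (rule integral_cong_AE)
    show "AE y in mu a b. (\<integral>x. ?J x y \<partial>mu a b) = g y * integral\<^sup>L (mu a y) f"
      using AE_mu_in
    proof eventually_elim
      case (elim y)
      have "(\<integral>x. ?J x y \<partial>mu a b) = (\<integral>x. g y * (indicator {a..y} x * f x) \<partial>mu a b)"
      proof (rule integral_cong_AE)
        show "AE x in mu a b. ?J x y = g y * (indicator {a..y} x * f x)"
          using AE_mu_in AE_mu_neq[of y a b] by eventually_elim (auto simp: indicator_def)
      qed auto
      then show ?case using elim by (simp add: integral_mu_indicator[of f a a y b])
    qed
  qed auto
  finally have main: "(\<integral>x. f x \<partial>mu a b) * (\<integral>y. g y \<partial>mu a b)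
    = (\<integral>x. f x * integral\<^sup>L (mu a x) g \<partial>mu a b) + (\<integral>x. g x * integral\<^sup>L (mu a x) f \<partial>mu a b)" .
  have eq: "(\<lambda>x. f x * G x + F x * g x)
    = (\<lambda>x. (d * f x + f x * integral\<^sup>L (mu a x) g) + (c * g x + g x * integral\<^sup>L (mu a x) f))"
    by (simp add: F_def G_def algebra_simps)
  show "integrable (mu a b) (\<lambda>x. f x * G x + F x * g x)"
    unfolding eq using f g i1 i2 by simp
  show "F b * G b = c * d + (\<integral>x. f x * G x + F x * g x \<partial>mu a b)"
    unfolding eq using f g i1 i2 main by (simp add: F_def G_def algebra_simps)
qed

text \<open>Half-lines generate the Borel sets and are stable under intersection, and the sets over
  which \<open>h\<close> integrates to zero are closed under complements and disjoint unions. So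
  \<open>h\<close> has zero integral over every Borel set, and no differentiation theorem is
  involved.\<close>

lemma AE_zero_of_indefinite:
  fixes h :: "real \<Rightarrow> real"
  assumes h: "integrable (mu a b) h" and z: "\<And>x. x \<in> {a..b} \<Longrightarrow> integral\<^sup>L (mu a x) h = 0"
  shows "AE x in mu a b. h x = 0"
proof -
  have [measurable]: "h \<in> borel_measurable borel" by (rule integrable_mu_meas[OF h])
  have z': "(\<integral>y. indicator {..x} y * h y \<partial>mu a b) = 0" for x
  proof (cases "a \<le> x \<and> a \<le> b")
    case False
    have "AE y in mu a b. indicator {..x} y * h y = 0"
      using AE_mu_in by eventually_elim (use False in auto)
    then show ?thesis by (rule integral_eq_zero_AE)
  next
    case True
    have "(\<integral>y. indicator {..x} y * h y \<partial>mu a b) = (\<integral>y. indicator {a..min x b} y * h y \<partial>mu a b)"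
    proof (rule integral_cong_AE)
      show "AE y in mu a b. indicator {..x} y * h y = indicator {a..min x b} y * h y"
        using AE_mu_in by eventually_elim (auto simp: indicator_def)
    qed auto
    also have "\<dots> = integral\<^sup>L (mu a (min x b)) h"
      by (rule integral_mu_indicator[symmetric]) (use True in auto)
    finally show ?thesis using z True by auto
  qed
  have tot: "(\<integral>y. h y \<partial>mu a b) = 0"
  proof (cases "a \<le> b")
    case False
    have "AE y in mu a b. h y = 0" using AE_mu_in by eventually_elim (use False in auto)
    then show ?thesis by (rule integral_eq_zero_AE)
  qed (use z in auto)
  have A0: "(\<integral>y. indicator A y * h y \<partial>mu a b) = 0" if "A \<in> sets borel" for A
  proof -
    have gen: "sets borel = sigma_sets UNIV (range (\<lambda>a::real. {..a}))"
      by (subst borel_eq_atMost) (simp add: sets_measure_of)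
    have "Int_stable (range (\<lambda>a::real. {..a}))"
      by (auto simp: Int_stable_def)
    moreover have "range (\<lambda>a::real. {..a}) \<subseteq> Pow UNIV" by auto
    moreover have "A \<in> sigma_sets UNIV (range (\<lambda>a::real. {..a}))" using that gen by simp
    ultimately show ?thesis
    proof (induction rule: sigma_sets_induct_disjoint)
      case (basic A) then show ?case using z' by auto
    next
      case empty then show ?case by simp
    next
      case (compl A)
      have [measurable]: "A \<in> sets borel" using compl gen by simp
      have "(\<integral>y. indicator (UNIV - A) y * h y \<partial>mu a b) = (\<integral>y. h y - indicator A y * h y \<partial>mu a b)"
        by (intro Bochner_Integration.integral_cong) (auto simp: indicator_def)
      also have "\<dots> = 0"
        by (subst Bochner_Integration.integral_diff)
           (use h compl tot integrable_mult_indicator[OF _ h, of A] in auto)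
      finally show ?case .
    next
      case (union A)
      have [measurable]: "A i \<in> sets borel" for i using union(2) gen by auto
      have Am: "A i \<in> sets borel" for i using union(2) gen by auto
      then have "(\<Union>i. A i) \<in> sets borel" by auto
      then have iU: "integrable (mu a b) (\<lambda>x. indicator (\<Union>i. A i) x *\<^sub>R h x)"
        by (intro integrable_mult_indicator h) simp
      have "(LINT x:(\<Union>i. A i)|mu a b. h x) = (\<Sum>i. LINT x:(A i)|mu a b. h x)"
        by (rule lebesgue_integral_countable_add)
           (use union h Am iU in \<open>auto simp: disjoint_family_on_def set_integrable_def intro!: integrable_mult_indicator\<close>)
      then show ?case using union by (simp add: set_lebesgue_integral_def)
    qed
  qed
  show ?thesis
  proof (rule density_unique_real[OF h])
    show "integrable (mu a b) (\<lambda>_. 0::real)" by simp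
    fix A assume "A \<in> sets (mu a b)"
    then show "(LINT x:A|mu a b. h x) = (LINT x:A|mu a b. (0::real))"
      using A0[of A] by (simp add: set_lebesgue_integral_def)
  qed
qed

text \<open>The rate is only integrable and the inequality holds only almost everywhere, so the
  exponential is replaced by a continuity argument. The primitive \<open>Y\<close> of the right-hand
  side is monotone and continuous; over a stretch on which the primitive of \<open>\<theta>\<close>
  grows by at most 1/2, starting from a zero of \<open>Y\<close>, it satisfies
  \<open>Y t \<le> 1/2 * Y t\<close>.\<close>

lemma gronwall_zero:
  fixes y \<theta> :: "real \<Rightarrow> real"
  assumes th: "integrable (mu a b) \<theta>" and th0: "AE t in mu a b. 0 \<le> \<theta> t"
    and [measurable]: "y \<in> borel_measurable borel"
    and y0: "AE t in mu a b. 0 \<le> y t" and yB: "AE t in mu a b. y t \<le> B"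
    and le: "AE t in mu a b. y t \<le> integral\<^sup>L (mu a t) (\<lambda>s. \<theta> s * y s)"
  shows "AE t in mu a b. y t = 0"
proof (cases "a \<le> b")
  case False
  show ?thesis using AE_mu_in by eventually_elim (use False in auto)
next
  case True
  have [measurable]: "\<theta> \<in> borel_measurable borel" by (rule integrable_mu_meas[OF th])
  have i: "integrable (mu a b) (\<lambda>s. \<theta> s * y s)"
  proof (rule Bochner_Integration.integrable_bound)
    show "integrable (mu a b) (\<lambda>s. \<theta> s * B)" using th by simp
    show "AE x in mu a b. norm (\<theta> x * y x) \<le> norm (\<theta> x * B)"
      using th0 y0 yB by eventually_elim (auto simp: abs_mult intro!: mult_left_mono)
  qed auto
  define Y where "Y t = integral\<^sup>L (mu a t) (\<lambda>s. \<theta> s * y s)" for t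
  define \<Theta> where "\<Theta> t = integral\<^sup>L (mu a t) \<theta>" for t
  have contY: "continuous_on {a..b} Y" unfolding Y_def by (rule continuous_indefinite_mu[OF i])
  have contT: "continuous_on {a..b} \<Theta>" unfolding \<Theta>_def by (rule continuous_indefinite_mu[OF th])
  have Ydiff: "Y t - Y s = integral\<^sup>L (mu s t) (\<lambda>s. \<theta> s * y s)" if "a \<le> s" "s \<le> t" "t \<le> b" for s t
    using integral_mu_combine[OF integrable_mu_subset[OF i], of a t s] that by (simp add: Y_def)
  have Tdiff: "\<Theta> t - \<Theta> s = integral\<^sup>L (mu s t) \<theta>" if "a \<le> s" "s \<le> t" "t \<le> b" for s t
    using integral_mu_combine[OF integrable_mu_subset[OF th], of a t s] that by (simp add: \<Theta>_def)
  have Ymono: "Y s \<le> Y t" if "a \<le> s" "s \<le> t" "t \<le> b" for s t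
  proof -
    have "0 \<le> integral\<^sup>L (mu s t) (\<lambda>s. \<theta> s * y s)"
      using AE_mu_subset[OF th0, of s t] AE_mu_subset[OF y0, of s t] that
      by (intro integral_nonneg_AE) (auto elim!: eventually_elim2)
    then show ?thesis using Ydiff[OF that] by simp
  qed
  have step: "Y t - Y s \<le> (\<Theta> t - \<Theta> s) * Y t" if "a \<le> s" "s \<le> t" "t \<le> b" for s t
  proof -
    have "integral\<^sup>L (mu s t) (\<lambda>s. \<theta> s * y s) \<le> integral\<^sup>L (mu s t) (\<lambda>s. \<theta> s * Y t)"
    proof (rule integral_mono_AE)
      show "AE r in mu s t. \<theta> r * y r \<le> \<theta> r * Y t"
        using AE_mu_subset[OF th0 that(1,3)] AE_mu_subset[OF le that(1,3), folded Y_def] AE_mu_in[of s t]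
      proof eventually_elim
        case (elim r)
        then show ?case using Ymono[of r t] that by (intro mult_left_mono) auto
      qed
    qed (use that integrable_mu_subset[OF i] integrable_mu_subset[OF th] in auto)
    then show ?thesis using Ydiff[OF that] Tdiff[OF that] by simp
  qed
  \<comment> \<open>The last zero of \<open>Y\<close>. If it lies below \<open>b\<close>, the
    half-step argument produces a later one.\<close>
  define \<tau> where "\<tau> = Sup {t \<in> {a..b}. Y t = 0}"
  have Ya: "Y a = 0" by (simp add: Y_def)
  have ne: "{t \<in> {a..b}. Y t = 0} \<noteq> {}" using Ya True by auto
  have bd: "bdd_above {t \<in> {a..b}. Y t = 0}" by (rule bdd_aboveI[of _ b]) auto
  have "closed {t \<in> {a..b}. Y t = 0}"
    using continuous_closed_preimage_constant[OF contY, of 0] by simp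
  then have tin: "\<tau> \<in> {t \<in> {a..b}. Y t = 0}"
    unfolding \<tau>_def by (rule closed_contains_Sup[OF ne bd])
  have "\<tau> = b"
  proof (rule ccontr)
    assume "\<tau> \<noteq> b"
    then have tb: "\<tau> < b" "a \<le> \<tau>" using tin by auto
    from contT tb have "\<forall>e>0. \<exists>d>0. \<forall>x'\<in>{a..b}. dist x' \<tau> < d \<longrightarrow> dist (\<Theta> x') (\<Theta> \<tau>) < e"
      unfolding continuous_on_iff by auto
    then obtain d where d: "d > 0" "\<And>x'. x'\<in>{a..b} \<Longrightarrow> dist x' \<tau> < d \<Longrightarrow> dist (\<Theta> x') (\<Theta> \<tau>) < 1/2"
      by (metis half_gt_zero_iff zero_less_one)
    define t where "t = min b (\<tau> + d/2)"
    have t: "\<tau> < t" "t \<in> {a..b}" "dist t \<tau> < d" using d tb by (auto simp: t_def dist_real_def)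
    have half: "\<Theta> t - \<Theta> \<tau> \<le> 1/2" using d(2)[OF t(2,3)] unfolding dist_real_def by linarith
    have "0 \<le> Y t" using Ymono[of a t] Ya t by auto
    have "Y t \<le> (\<Theta> t - \<Theta> \<tau>) * Y t" using step[of \<tau> t] t tb tin by simp
    also have "\<dots> \<le> 1/2 * Y t" by (rule mult_right_mono[OF half \<open>0 \<le> Y t\<close>])
    finally have "Y t \<le> 1/2 * Y t" .
    then have "Y t = 0" using \<open>0 \<le> Y t\<close> by simp
    then have "t \<le> \<tau>" unfolding \<tau>_def using t bd by (intro cSup_upper) auto
    then show False using t by simp
  qed
  then have "Y b = 0" using tin by simp
  show ?thesis using le y0 AE_mu_in
  proof eventually_elim
    case (elim t)
    then show ?case using Ymono[of t b] \<open>Y b = 0\<close> by (simp add: Y_def[symmetric])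
  qed
qed

section \<open>Fourier modes and weak derivatives\<close>

text \<open>Equal end values make \<open>f\<close> a continuous function on the circle, and
  Stone-Weierstrass applies there.\<close>

lemma periodic_polynomial_approx:
  fixes f :: "real \<Rightarrow> real"
  assumes f: "continuous_on {0..1} f" "f 0 = f 1" and e: "e > 0"
  obtains p where "real_polynomial_function (p :: complex \<Rightarrow> real)"
    "\<And>x. x \<in> {0..1} \<Longrightarrow> \<bar>f x - p (cis (2 * pi * x))\<bar> < e"
proof -
  \<comment> \<open>The trivial homotopy is used only to obtain continuity of the induced map on the
    circle, in spite of the jump of \<open>Arg2pi\<close> at 1.\<close>
  have "homotopic_loops UNIV f f"
    using f by (simp add: homotopic_loops_refl path_def pathstart_def pathfinish_def)
  then have "homotopic_with_canon (\<lambda>h. True) (sphere 0 1) UNIV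
       (f \<circ> (\<lambda>z. Arg2pi z / (2 * pi))) (f \<circ> (\<lambda>z. Arg2pi z / (2 * pi)))"
    by (rule homotopic_loops_imp_homotopic_circlemaps)
  then have cont: "continuous_on (sphere 0 1) (f \<circ> (\<lambda>z. Arg2pi z / (2 * pi)))"
    using homotopic_with_imp_continuous by blast
  obtain p where p: "real_polynomial_function p"
    "\<And>z. z \<in> sphere 0 1 \<Longrightarrow> \<bar>(f \<circ> (\<lambda>z. Arg2pi z / (2 * pi))) z - p z\<bar> < e"
    using Stone_Weierstrass_real_polynomial_function[OF compact_sphere cont e] by blast
  show ?thesis
  proof
    show "real_polynomial_function p" by fact
    fix x :: real assume x: "x \<in> {0..1}"
    have "f (Arg2pi (cis (2 * pi * x)) / (2 * pi)) = f x"
    proof (cases "x = 1")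
      case True
      have "Arg2pi 1 = 0" by (rule Arg2pi_unique[of 1]) auto
      then show ?thesis using f True by (simp add: cis_2pi)
    next
      case False
      have "Arg2pi (cis (2 * pi * x)) = 2 * pi * x"
        by (rule Arg2pi_unique[of 1]) (use x False in \<open>auto simp: cis_conv_exp\<close>)
      then show ?thesis by simp
    qed
    then show "\<bar>f x - p (cis (2 * pi * x))\<bar> < e"
      using p(2)[of "cis (2 * pi * x)"] by simp
  qed
qed

text \<open>Cosine modes for \<^term>\<open>b = True\<close>, sine modes otherwise; negative frequencies make
  the span obviously closed under products.\<close>

definition tmode :: "real \<Rightarrow> bool \<Rightarrow> int \<Rightarrow> real \<Rightarrow> real" where
  "tmode P b k x = (if b then cos else sin) (2 * pi * of_int k * x / P)"

lemma tmode_measurable [measurable]: "tmode P b k \<in> borel_measurable borel"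
  unfolding tmode_def by (cases b) auto

lemma abs_tmode_le: "\<bar>tmode P b k x\<bar> \<le> 1"
  by (simp add: tmode_def)

lemma tmode_0 [simp]: "tmode P True 0 x = 1" "tmode P False 0 x = 0"
  by (simp_all add: tmode_def)

text \<open>The factor produced by differentiating a mode, which turns it into the mode of the other
  kind; the sign is that of the derivative of the cosine.\<close>

definition dcoef :: "real \<Rightarrow> bool \<Rightarrow> int \<Rightarrow> real" where
  "dcoef P b k = (if b then -1 else 1) * (2 * pi * of_int k / P)"

lemma tmode_has_derivative:
  "(tmode P b k has_real_derivative dcoef P b k * tmode P (\<not> b) k x) (at x)"
  unfolding tmode_def dcoef_def
  by (cases "P = 0"; cases b) (auto intro!: derivative_eq_intros simp: field_simps)

lemma tmode_periodic: "P > 0 \<Longrightarrow> tmode P b k (x + P) = tmode P b k x"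
proof -
  assume "P > 0"
  then have eq: "2 * pi * of_int k * (x + P) / P = 2 * pi * of_int k * x / P + 2 * pi * of_int k"
    by (simp add: field_simps)
  show ?thesis unfolding tmode_def eq
    by (auto simp: cos_add sin_add cos_int_2pin sin_int_2pin)
qed

inductive trig_poly :: "real \<Rightarrow> (real \<Rightarrow> real) \<Rightarrow> bool" for P where
  mode: "trig_poly P (\<lambda>x. c * tmode P b k x)"
| add: "trig_poly P f \<Longrightarrow> trig_poly P g \<Longrightarrow> trig_poly P (\<lambda>x. f x + g x)"

lemma tmode_mult: "trig_poly P (\<lambda>x. c * tmode P b k x * (d * tmode P b' l x))"
proof -
  have *: "2 * pi * of_int (k - l) * x / P = 2 * pi * of_int k * x / P - 2 * pi * of_int l * x / P"
    "2 * pi * of_int (k + l) * x / P = 2 * pi * of_int k * x / P + 2 * pi * of_int l * x / P" for x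
    by (simp_all add: field_simps diff_divide_distrib add_divide_distrib)
  \<comment> \<open>Signs and common kind of the two modes in the product-to-sum formulas, for all
    four combinations at once.\<close>
  define s1 s2 b'' where "s1 = (if b \<longleftrightarrow> b' then 1 else if b then -1 else 1 :: real)"
    and "s2 = (if b \<noteq> b' then 1 else if b then 1 else -1 :: real)" and "b'' = (b = b')"
  have "trig_poly P (\<lambda>x. (c * d / 2 * s1) * tmode P b'' (k - l) x + (c * d / 2 * s2) * tmode P b'' (k + l) x)"
    by (intro trig_poly.intros)
  also have "(\<lambda>x. (c * d / 2 * s1) * tmode P b'' (k - l) x + (c * d / 2 * s2) * tmode P b'' (k + l) x)
     = (\<lambda>x. c * tmode P b k x * (d * tmode P b' l x))"
    unfolding tmode_def * s1_def s2_def b''_def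
    by (cases b; cases b') (auto simp: fun_eq_iff cos_add cos_diff sin_add sin_diff algebra_simps)
  finally show ?thesis .
qed

lemma trig_poly_mult:
  assumes "trig_poly P f" "trig_poly P g"
  shows "trig_poly P (\<lambda>x. f x * g x)"
  using assms(1)
proof induction
  case (mode c b k)
  show ?case using assms(2)
  proof induction
    case (add f g)
    then show ?case using trig_poly.add[OF add(3,4)] by (simp add: algebra_simps)
  qed (rule tmode_mult)
next
  case (add f h)
  then show ?case using trig_poly.add[OF add(3,4)] by (simp add: algebra_simps)
qed

lemma trig_poly_of_polynomial:
  assumes "real_polynomial_function (p :: complex \<Rightarrow> real)"
  shows "trig_poly P (\<lambda>x. p (cis (2 * pi * x / P)))"
  using assms
proof induction
  case (linear f)
  interpret f: bounded_linear f by fact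
  have "f (cis \<theta>) = f 1 * cos \<theta> + f \<i> * sin \<theta>" for \<theta>
  proof -
    have "cis \<theta> = cos \<theta> *\<^sub>R 1 + sin \<theta> *\<^sub>R \<i>" by (simp add: complex_eq_iff)
    then have "f (cis \<theta>) = cos \<theta> *\<^sub>R f 1 + sin \<theta> *\<^sub>R f \<i>" by (simp only: f.add f.scaleR)
    then show ?thesis by simp
  qed
  then have "(\<lambda>x. f (cis (2 * pi * x / P))) = (\<lambda>x. f 1 * tmode P True 1 x + f \<i> * tmode P False 1 x)"
    by (simp add: tmode_def)
  then show ?case by (simp add: trig_poly.intros)
next
  case (const c)
  show ?case using trig_poly.mode[of P c True 0] by simp
qed (auto intro: trig_poly.add trig_poly_mult)

text \<open>Orthogonality to the modes extends to trigonometric polynomials by linearity, to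
  continuous functions with equal end values by uniform approximation, and to indicators of initial
  intervals by dominated convergence. Integrability of \<open>h\<close> is enough, which is the
  regularity at hand for gradients and fluxes.\<close>

lemma fourier_unique:
  assumes P: "P > 0" and h: "integrable (mu 0 P) h"
    and modes: "\<And>b k. (\<integral>x. h x * tmode P b k x \<partial>mu 0 P) = 0"
  shows "AE x in mu 0 P. h x = 0"
proof (rule AE_zero_of_indefinite[OF h])
  have [measurable]: "h \<in> borel_measurable borel" by (rule integrable_mu_meas[OF h])
  have tp: "integrable (mu 0 P) (\<lambda>x. h x * f x) \<and> (\<integral>x. h x * f x \<partial>mu 0 P) = 0" if "trig_poly P f" for f
    using that
  proof induction
    case (mode c b k)
    have "integrable (mu 0 P) (\<lambda>x. h x * tmode P b k x)"
      by (rule Bochner_Integration.integrable_bound[OF h])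
         (use abs_tmode_le[of P b k] in \<open>auto simp: abs_mult mult_left_le\<close>)
    then have "integrable (mu 0 P) (\<lambda>x. c * (h x * tmode P b k x))
      \<and> (\<integral>x. c * (h x * tmode P b k x) \<partial>mu 0 P) = 0" using modes[of b k] by simp
    then show ?case by (simp add: algebra_simps)
  next
    case (add f g)
    then show ?case by (simp add: distrib_left)
  qed
  have cp: "(\<integral>x. h x * f x \<partial>mu 0 P) = 0"
    if f: "continuous_on {0..P} f" "f 0 = f P" and fm[measurable]: "f \<in> borel_measurable borel" for f
  proof (rule ccontr)
    assume ne: "(\<integral>x. h x * f x \<partial>mu 0 P) \<noteq> 0"
    define I where "I = (\<integral>x. \<bar>h x\<bar> \<partial>mu 0 P)"
    \<comment> \<open>Chosen so that \<open>(I + 1) * e\<close> is the modulus of the integral; the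
      extra 1 covers the case \<open>I = 0\<close>.\<close>
    define e where "e = \<bar>\<integral>x. h x * f x \<partial>mu 0 P\<bar> / (I + 1)"
    have I: "I \<ge> 0" unfolding I_def by simp
    then have e: "e > 0" using ne by (simp add: e_def)
    have c: "continuous_on {0..1} (\<lambda>y. f (P * y))"
      using P by (intro continuous_on_compose2[OF f(1)] continuous_intros) (auto simp: mult_left_le)
    obtain p where p: "real_polynomial_function (p :: complex \<Rightarrow> real)"
      "\<And>x. x \<in> {0..1} \<Longrightarrow> \<bar>f (P * x) - p (cis (2 * pi * x))\<bar> < e"
      using periodic_polynomial_approx[OF c _ e] f(2) by auto
    define q where "q x = p (cis (2 * pi * x / P))" for x
    have q: "integrable (mu 0 P) (\<lambda>x. h x * q x)" "(\<integral>x. h x * q x \<partial>mu 0 P) = 0"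
      using tp[OF trig_poly_of_polynomial[OF p(1)]] by (auto simp: q_def)
    have fq: "\<bar>f x - q x\<bar> \<le> e" if "x \<in> {0..P}" for x
      using p(2)[of "x / P"] that P by (simp add: q_def)
    have "bounded (f ` {0..P})" by (intro compact_imp_bounded compact_continuous_image f) auto
    then obtain B where B: "\<And>x. x \<in> {0..P} \<Longrightarrow> \<bar>f x\<bar> \<le> B" unfolding bounded_iff by force
    have hf: "integrable (mu 0 P) (\<lambda>x. h x * f x)"
    proof (rule Bochner_Integration.integrable_bound)
      show "integrable (mu 0 P) (\<lambda>x. h x * B)" using h by simp
      show "AE x in mu 0 P. norm (h x * f x) \<le> norm (h x * B)"
        using AE_mu_in by eventually_elim (use B in \<open>force simp: abs_mult intro!: mult_left_mono\<close>)
    qed auto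
    have "\<bar>\<integral>x. h x * f x \<partial>mu 0 P\<bar> = \<bar>\<integral>x. h x * f x - h x * q x \<partial>mu 0 P\<bar>"
      using q hf by simp
    also have "\<dots> \<le> (\<integral>x. \<bar>h x * f x - h x * q x\<bar> \<partial>mu 0 P)" by (rule integral_abs_bound)
    also have "\<dots> \<le> (\<integral>x. \<bar>h x\<bar> * e \<partial>mu 0 P)"
    proof (rule integral_mono_AE)
      show "AE x in mu 0 P. \<bar>h x * f x - h x * q x\<bar> \<le> \<bar>h x\<bar> * e"
        using AE_mu_in by eventually_elim
          (use fq in \<open>auto simp: right_diff_distrib[symmetric] abs_mult intro!: mult_left_mono\<close>)
    qed (use h hf q in auto)
    also have "\<dots> = I * e" by (simp add: I_def)
    also have "\<dots> < (I + 1) * e" using e by simp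
    also have "\<dots> = \<bar>\<integral>x. h x * f x \<partial>mu 0 P\<bar>" using I by (simp add: e_def)
    finally show False by simp
  qed
  fix a assume a: "a \<in> {0..P}"
  show "integral\<^sup>L (mu 0 a) h = 0"
  proof (cases "a = P")
    case True
    then show ?thesis using modes[of True 0] by simp
  next
    case False
    \<comment> \<open>Trapezoids with ramps of width 1/n. They vanish at 0, and also at
      \<open>P\<close> once n (P - a) exceeds 1, so \<open>cp\<close> applies to them; their
      pointwise limit is the indicator except at the point 0.\<close>
    define f where "f n x = min 1 (real n * x) * max 0 (1 - real n * max 0 (x - a))" for n x
    have "(\<lambda>n. \<integral>x. h x * f n x \<partial>mu 0 P) \<longlonglongrightarrow> (\<integral>x. h x * indicator {0..a} x \<partial>mu 0 P)"
    proof (rule integral_dominated_convergence[where w = "\<lambda>x. \<bar>h x\<bar>"])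
      show "AE x in mu 0 P. (\<lambda>n. h x * f n x) \<longlonglongrightarrow> h x * indicator {0..a} x"
        using AE_mu_in AE_mu_neq[of 0 0 P]
      proof eventually_elim
        case (elim x)
        then have x: "0 < x" "x \<le> P" by auto
        have "(\<lambda>n. min 1 (real n * x)) \<longlonglongrightarrow> 1"
        proof (rule tendsto_eventually)
          obtain N where N: "1 < real N * x" using reals_Archimedean3[OF x(1)] by blast
          show "\<forall>\<^sub>F n in sequentially. min 1 (real n * x) = 1"
          proof (rule eventually_sequentiallyI[of N])
            fix n assume "N \<le> n"
            then have "real N * x \<le> real n * x" using x by (intro mult_right_mono) auto
            then show "min 1 (real n * x) = 1" using N by simp
          qed
        qed
        moreover have "(\<lambda>n. max 0 (1 - real n * max 0 (x - a))) \<longlonglongrightarrow> indicator {0..a} x"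
        proof (cases "x \<le> a")
          case True
          then show ?thesis using x by (simp add: max_absorb1)
        next
          case F: False
          then have xa: "x - a > 0" by simp
          show ?thesis
          proof (rule tendsto_eventually)
            obtain N where N: "1 < real N * (x - a)" using reals_Archimedean3[OF xa] by blast
            show "\<forall>\<^sub>F n in sequentially. max 0 (1 - real n * max 0 (x - a)) = indicator {0..a} x"
            proof (rule eventually_sequentiallyI[of N])
              fix n assume "N \<le> n"
              then have "real N * (x - a) \<le> real n * (x - a)" using xa by (intro mult_right_mono) auto
              then have "1 < real n * (x - a)" using N by linarith
              then show "max 0 (1 - real n * max 0 (x - a)) = indicator {0..a} x" using xa F by simp
            qed
          qed
        qed
        ultimately have "(\<lambda>n. f n x) \<longlonglongrightarrow> 1 * indicator {0..a} x" unfolding f_def by (rule tendsto_mult)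
        then show ?case using tendsto_mult[OF tendsto_const, of "\<lambda>n. f n x" _ _ "h x"] by simp
      qed
      fix n show "AE x in mu 0 P. norm (h x * f n x) \<le> \<bar>h x\<bar>"
        using AE_mu_in
      proof eventually_elim
        case (elim x)
        have A: "0 \<le> min 1 (real n * x)" "min 1 (real n * x) \<le> 1"
          and B: "0 \<le> max 0 (1 - real n * max 0 (x - a))" "max 0 (1 - real n * max 0 (x - a)) \<le> 1"
          using elim by auto
        have "\<bar>f n x\<bar> \<le> 1" unfolding f_def using mult_mono[OF A(2) B(2)] A B by (simp add: abs_mult)
        then show ?case by (simp add: abs_mult mult_left_le)
      qed
    qed (use h in \<open>auto simp: f_def\<close>)
    moreover have "\<forall>\<^sub>F n in sequentially. (\<integral>x. h x * f n x \<partial>mu 0 P) = 0"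
    proof -
      have xa: "P - a > 0" using a False by simp
      obtain N where N: "1 < real N * (P - a)" using reals_Archimedean3[OF xa] by blast
      show ?thesis
      proof (rule eventually_sequentiallyI[of N])
        fix n assume "N \<le> n"
        then have "real N * (P - a) \<le> real n * (P - a)" using xa by (intro mult_right_mono) auto
        then have "1 < real n * (P - a)" using N by linarith
        then have "f n P = 0" using xa by (simp add: f_def)
        then show "(\<integral>x. h x * f n x \<partial>mu 0 P) = 0"
          by (intro cp) (auto simp: f_def intro!: continuous_intros)
      qed
    qed
    ultimately have "(\<integral>x. h x * indicator {0..a} x \<partial>mu 0 P) = 0"
      by (metis LIMSEQ_unique tendsto_eventually)
    then show ?thesis using a by (simp add: integral_mu_indicator[of h 0 0 a P] mult.commute)
  qed
qed

lemma tmode_indefinite: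
  assumes "x \<ge> 0"
  shows "integral\<^sup>L (mu 0 x) (\<lambda>y. dcoef P b k * tmode P (\<not> b) k y) = tmode P b k x - tmode P b k 0"
proof -
  have i: "integrable (mu 0 x) (\<lambda>y. dcoef P b k * tmode P (\<not> b) k y)"
    by (rule integrable_mu_bounded[where B="\<bar>dcoef P b k\<bar>"])
       (auto simp: abs_mult abs_tmode_le mult_left_le)
  have "((\<lambda>y. dcoef P b k * tmode P (\<not> b) k y) has_integral (tmode P b k x - tmode P b k 0)) {0..x}"
    by (rule fundamental_theorem_of_calculus[OF assms])
       (auto simp: has_real_derivative_iff_has_vector_derivative[symmetric]
         intro!: has_field_derivative_at_within tmode_has_derivative)
  then show ?thesis unfolding mu_has_integral(2)[OF i] by (rule integral_unique)
qed

lemma integrable_tmode: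
  assumes "integrable (mu 0 P) h"
  shows "integrable (mu 0 P) (\<lambda>x. h x * tmode Q b k x)"
  by (rule Bochner_Integration.integrable_bound[OF assms])
     (use abs_tmode_le[of Q b k] integrable_mu_meas[OF assms] in \<open>auto simp: abs_mult mult_left_le\<close>)

text \<open>The primitive \<open>F\<close> of \<open>g\<close> satisfies the same mode relations as
  \<open>r\<close>, since the zero mean of \<open>g\<close> makes its boundary values agree. So
  \<open>r\<close> and \<open>F\<close> share all nonconstant modes, and \<open>C\<close> accounts
  for the constant one.\<close>

lemma weak_derivative_1d:
  assumes r: "integrable (mu 0 1) r" and g: "integrable (mu 0 1) g"
    and weak: "\<And>b k. dcoef 1 b k * (\<integral>x. r x * tmode 1 (\<not> b) k x \<partial>mu 0 1) = - (\<integral>x. g x * tmode 1 b k x \<partial>mu 0 1)"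
  shows "(\<integral>x. g x \<partial>mu 0 1) = 0"
    and "\<exists>C. AE x in mu 0 1. r x = C + integral\<^sup>L (mu 0 x) g"
proof -
  have [measurable]: "r \<in> borel_measurable borel" "g \<in> borel_measurable borel"
    using r g by (auto intro: integrable_mu_meas)
  show g0: "(\<integral>x. g x \<partial>mu 0 1) = 0" using weak[of True 0] by (simp add: dcoef_def)
  define F where "F x = integral\<^sup>L (mu 0 x) g" for x
  have [measurable]: "F \<in> borel_measurable borel" unfolding F_def by measurable
  have F: "integrable (mu 0 1) F"
  proof (rule integrable_mu_bounded[where B="\<integral>y. \<bar>g y\<bar> \<partial>mu 0 1"])
    show "AE x in mu 0 1. \<bar>F x\<bar> \<le> (\<integral>y. \<bar>g y\<bar> \<partial>mu 0 1)"
      using AE_mu_in by eventually_elim (simp add: F_def abs_indefinite_mu_le[OF g])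
  qed simp
  define C where "C = (\<integral>x. r x - F x \<partial>mu 0 1)"
  have ibp: "dcoef 1 b k * (\<integral>x. F x * tmode 1 (\<not> b) k x \<partial>mu 0 1) = - (\<integral>x. g x * tmode 1 b k x \<partial>mu 0 1)" for b k
  proof -
    let ?d = "\<lambda>y. dcoef 1 b k * tmode 1 (\<not> b) k y"
    have i: "integrable (mu 0 1) ?d"
      by (rule integrable_mu_bounded[where B="\<bar>dcoef 1 b k\<bar>"])
         (auto simp: abs_mult abs_tmode_le mult_left_le)
    have "0 = tmode 1 b k 0 * 0 + (\<integral>x. ?d x * F x + tmode 1 b k x * g x \<partial>mu 0 1)"
    proof -
      have e: "(\<integral>x. ?d x * (0 + integral\<^sup>L (mu 0 x) g) + (tmode 1 b k 0 + integral\<^sup>L (mu 0 x) ?d) * g x \<partial>mu 0 1)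
        = (\<integral>x. ?d x * F x + tmode 1 b k x * g x \<partial>mu 0 1)"
      proof (rule integral_cong_AE)
        show "AE x in mu 0 1. ?d x * (0 + integral\<^sup>L (mu 0 x) g) + (tmode 1 b k 0 + integral\<^sup>L (mu 0 x) ?d) * g x
          = ?d x * F x + tmode 1 b k x * g x"
          using AE_mu_in by eventually_elim (simp add: F_def tmode_indefinite del: integral_mult_right_zero)
      qed auto
      show ?thesis using integral_by_parts_mu(2)[OF i g, of "tmode 1 b k 0" 0] g0 unfolding e by simp
    qed
    also have "\<dots> = 0 + (\<integral>x. dcoef 1 b k * (F x * tmode 1 (\<not> b) k x) + g x * tmode 1 b k x \<partial>mu 0 1)"
      by (simp add: mult_ac)
    also have "\<dots> = dcoef 1 b k * (\<integral>x. F x * tmode 1 (\<not> b) k x \<partial>mu 0 1) + (\<integral>x. g x * tmode 1 b k x \<partial>mu 0 1)"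
      using integrable_tmode[OF F, of 1 "\<not> b" k] integrable_tmode[OF g, of 1 b k]
      by (subst Bochner_Integration.integral_add) auto
    finally show ?thesis by simp
  qed
  have "AE x in mu 0 1. r x - F x - C = 0"
  proof (rule fourier_unique)
    show "integrable (mu 0 1) (\<lambda>x. r x - F x - C)" using r F by simp
    fix b k
    show "(\<integral>x. (r x - F x - C) * tmode 1 b k x \<partial>mu 0 1) = 0"
    proof (cases "k = 0")
      case True
      then show ?thesis using r F by (cases b) (auto simp: C_def measure_mu)
    next
      case False
      then have d: "dcoef 1 (\<not> b) k \<noteq> 0" by (simp add: dcoef_def)
      have "dcoef 1 (\<not> b) k * (\<integral>x. r x * tmode 1 b k x \<partial>mu 0 1)
          = dcoef 1 (\<not> b) k * (\<integral>x. F x * tmode 1 b k x \<partial>mu 0 1)"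
        using weak[of "\<not> b" k] ibp[of "\<not> b" k] by simp
      then have e1: "(\<integral>x. r x * tmode 1 b k x \<partial>mu 0 1) = (\<integral>x. F x * tmode 1 b k x \<partial>mu 0 1)" using d by simp
      have "dcoef 1 (\<not> b) k * (\<integral>x. tmode 1 b k x \<partial>mu 0 1) = 0"
        using tmode_indefinite[of 1 1 "\<not> b" k] tmode_periodic[of 1 "\<not> b" k 0] by simp
      then have e2: "(\<integral>x. tmode 1 b k x \<partial>mu 0 1) = 0" using d by simp
      have "(\<integral>x. (r x - F x - C) * tmode 1 b k x \<partial>mu 0 1)
        = (\<integral>x. r x * tmode 1 b k x - F x * tmode 1 b k x - C * tmode 1 b k x \<partial>mu 0 1)"
        by (simp add: left_diff_distrib)
      also have "\<dots> = 0"
        using integrable_tmode[OF r, of 1 b k] integrable_tmode[OF F, of 1 b k] e1 e2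
          integrable_tmode[of 1 "\<lambda>_. 1" 1 b k]
        by (simp)
      finally show ?thesis .
    qed
  qed simp
  then show "\<exists>C. AE x in mu 0 1. r x = C + integral\<^sup>L (mu 0 x) g"
    by (intro exI[of _ C]) (auto simp: F_def elim!: eventually_mono)
qed

section \<open>Periodic antiderivatives\<close>

text \<open>Both endpoints may depend on the parameter, as in space averages and in time primitives;
  as a raw rule it also settles nested integrals.\<close>

lemma borel_measurable_integral_mu [measurable (raw)]:
  fixes f :: "'a \<Rightarrow> real \<Rightarrow> real"
  assumes [measurable]: "case_prod f \<in> borel_measurable (M \<Otimes>\<^sub>M borel)"
    and [measurable]: "a \<in> borel_measurable M" "b \<in> borel_measurable M"
  shows "(\<lambda>z. integral\<^sup>L (mu (a z) (b z)) (f z)) \<in> borel_measurable M"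
proof -
  have m: "f z \<in> borel_measurable borel" if "z \<in> space M" for z
    using measurable_Pair2[OF assms(1) that] by simp
  have "(\<lambda>z. \<integral>y. (if a z \<le> y \<and> y \<le> b z then f z y else 0) \<partial>lborel) \<in> borel_measurable M"
    by measurable
  also have "?this \<longleftrightarrow> ?thesis"
    using m by (intro measurable_cong)
      (auto simp: integral_mu indicator_def intro!: Bochner_Integration.integral_cong)
  finally show ?thesis .
qed

lemma sets_mu_pair [measurable_cong, simp]: "sets (mu a b \<Otimes>\<^sub>M mu c d) = sets (borel \<Otimes>\<^sub>M borel)"
  by (intro sets_pair_measure_cong) simp_all

lemma borel_measurable_mu_pair [simp]:
  "borel_measurable (mu a b \<Otimes>\<^sub>M mu c d) = borel_measurable (borel \<Otimes>\<^sub>M borel)"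
  by (rule measurable_cong_sets) simp_all

lemma space_mu_pair [simp]: "space (mu a b \<Otimes>\<^sub>M mu c d) = UNIV"
  by (simp add: space_pair_measure)

lemma AE_mu_pairI:
  assumes "Measurable.pred (borel \<Otimes>\<^sub>M borel) (\<lambda>p. P (fst p) (snd p))"
    and "AE t in mu a b. AE x in mu c d. P t x"
  shows "AE p in mu a b \<Otimes>\<^sub>M mu c d. P (fst p) (snd p)"
proof (rule mup.AE_pair_measure)
  show "{p \<in> space (mu a b \<Otimes>\<^sub>M mu c d). P (fst p) (snd p)} \<in> sets (mu a b \<Otimes>\<^sub>M mu c d)"
    using assms(1) by (simp add: pred_def space_pair_measure)
qed (use assms(2) in simp)

section \<open>Translation invariance and periodic functions on the line\<close>

lemma integral_mu_translate:
  fixes f :: "real \<Rightarrow> real"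
  assumes [measurable]: "f \<in> borel_measurable borel"
  shows "integral\<^sup>L (mu (a + c) (b + c)) f = integral\<^sup>L (mu a b) (\<lambda>x. f (x + c))"
proof -
  have "(\<integral>x. indicator {a + c..b + c} x * f x \<partial>lborel) = (\<integral>x. indicator {a + c..b + c} (c + 1 * x) * f (c + 1 * x) \<partial>lborel)"
    by (subst lborel_integral_real_affine[where t=c and c=1]) auto
  also have "\<dots> = (\<integral>x. indicator {a..b} x * f (x + c) \<partial>lborel)"
    by (intro Bochner_Integration.integral_cong) (auto simp: indicator_def add.commute)
  finally show ?thesis by (simp add: integral_mu)
qed

lemma integrable_mu_translate:
  fixes f :: "real \<Rightarrow> real"
  assumes "integrable (mu (a + c) (b + c)) f"
  shows "integrable (mu a b) (\<lambda>x. f (x + c))"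
proof -
  have [measurable]: "f \<in> borel_measurable borel" by (rule integrable_mu_meas[OF assms])
  have "integrable lborel (\<lambda>x. indicator {a + c..b + c} x * f x)"
    using assms by (simp add: integrable_mu)
  then have "integrable lborel (\<lambda>x. indicator {a + c..b + c} (c + 1 * x) * f (c + 1 * x))"
    by (rule lborel_integrable_real_affine) simp
  also have "(\<lambda>x. indicator {a + c..b + c} (c + 1 * x) * f (c + 1 * x)) = (\<lambda>x. indicator {a..b} x * f (x + c))"
    by (auto simp: indicator_def add.commute)
  finally show ?thesis by (simp add: integrable_mu)
qed

lemma integrable_mu_join:
  fixes f :: "real \<Rightarrow> real"
  assumes 1: "integrable (mu a b) f" and 2: "integrable (mu b c) f"
  shows "integrable (mu a c) f"
proof -
  have [measurable]: "f \<in> borel_measurable borel" by (rule integrable_mu_meas[OF 1])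
  have "integrable lborel (\<lambda>x. \<bar>indicator {a..b} x * f x\<bar> + \<bar>indicator {b..c} x * f x\<bar>)"
    using 1 2 by (simp add: integrable_mu)
  then have "integrable lborel (\<lambda>x. indicator {a..c} x * f x)"
    by (rule Bochner_Integration.integrable_bound) (auto simp: indicator_def)
  then show ?thesis by (simp add: integrable_mu)
qed

lemma periodic_of_int:
  assumes "\<And>x::real. f (x + 1) = f x"
  shows "f (x + of_int n) = f x"
proof (induction n rule: int_induct[where k=0])
  case (step1 i)
  then show ?case using assms[of "x + of_int i"] by (simp add: add.assoc)
next
  case (step2 i)
  then show ?case using assms[of "x + of_int (i - 1)"] by (simp add: algebra_simps)
qed simp

lemma periodic_integrable:
  fixes h :: "real \<Rightarrow> real"
  assumes per: "\<And>x. h (x + 1) = h x" and h: "integrable (mu 0 1) h"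
  shows "integrable (mu x y) h"
proof -
  have [measurable]: "h \<in> borel_measurable borel" by (rule integrable_mu_meas[OF h])
  have unit: "integrable (mu (of_int n) (of_int n + 1)) h" for n
  proof -
    have "integrable (mu (of_int n) (of_int n + 1)) (\<lambda>x. h (x + of_int (- n)))"
      by (rule integrable_mu_translate) (simp add: h)
    moreover have "(\<lambda>x. h (x + of_int (- n))) = h"
      by (rule ext) (rule periodic_of_int[of h, OF per])
    ultimately show ?thesis by simp
  qed
  have "integrable (mu (- real n) (real n)) h" for n
  proof (induction n)
    case 0
    then show ?case using integrable_mu_subset[OF h, of 0 0] by simp
  next
    case (Suc n)
    have "integrable (mu (- real (Suc n)) (- real n)) h" using unit[of "- int (Suc n)"] by simp
    moreover have "integrable (mu (real n) (real (Suc n))) h" using unit[of "int n"] by (simp add: add.commute)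
    ultimately show ?case using Suc by (meson integrable_mu_join)
  qed
  moreover obtain n where "max \<bar>x\<bar> \<bar>y\<bar> \<le> real n" using real_arch_simple by blast
  ultimately show ?thesis using integrable_mu_subset[of "- real n" "real n" h x y] by auto
qed

lemma periodic_integral:
  fixes h :: "real \<Rightarrow> real"
  assumes per: "\<And>x. h (x + 1) = h x" and h: "integrable (mu 0 1) h"
  shows "integral\<^sup>L (mu x (x + 1)) h = integral\<^sup>L (mu 0 1) h"
proof -
  have [measurable]: "h \<in> borel_measurable borel" by (rule integrable_mu_meas[OF h])
  note i = periodic_integrable[OF assms]
  obtain s n where s: "0 \<le> s" "s < 1" "x = s + of_int n"
  proof
    show "0 \<le> frac x" "frac x < 1" by (simp_all add: frac_lt_1)
    show "x = frac x + of_int \<lfloor>x\<rfloor>" by (simp add: frac_def)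
  qed
  have "integral\<^sup>L (mu x (x + 1)) h = integral\<^sup>L (mu (s + of_int n) (s + 1 + of_int n)) h"
    unfolding s(3) by (simp add: add_ac)
  also have "\<dots> = integral\<^sup>L (mu s (s + 1)) h"
    by (subst integral_mu_translate) (simp_all only: periodic_of_int[of h, OF per], simp)
  also have "\<dots> = integral\<^sup>L (mu s 1) h + integral\<^sup>L (mu (0 + 1) (s + 1)) h"
    using integral_mu_combine[OF i, of s 1 "s + 1"] s by simp
  also have "integral\<^sup>L (mu (0 + 1) (s + 1)) h = integral\<^sup>L (mu 0 s) h"
    by (subst integral_mu_translate) (simp_all add: per)
  also have "integral\<^sup>L (mu s 1) h + integral\<^sup>L (mu 0 s) h = integral\<^sup>L (mu 0 1) h"
    using integral_mu_combine[OF i, of 0 s 1] s by simp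
  finally show ?thesis .
qed

lemma periodic_shift:
  fixes h :: "real \<Rightarrow> real"
  assumes per: "\<And>x. h (x + 1) = h x" and h: "integrable (mu 0 1) h"
  shows "integrable (mu 0 1) (\<lambda>x. h (x + c))" "(\<integral>x. h (x + c) \<partial>mu 0 1) = (\<integral>x. h x \<partial>mu 0 1)"
proof -
  have [measurable]: "h \<in> borel_measurable borel" by (rule integrable_mu_meas[OF h])
  show "integrable (mu 0 1) (\<lambda>x. h (x + c))"
    by (rule integrable_mu_translate) (rule periodic_integrable[OF assms])
  show "(\<integral>x. h (x + c) \<partial>mu 0 1) = (\<integral>x. h x \<partial>mu 0 1)"
    using integral_mu_translate[of h 0 c 1] periodic_integral[OF assms, of c] by (simp add: add.commute)
qed

lemma AE_lborel_translate:
  fixes c :: real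
  assumes "AE x in lborel. P x"
  shows "AE x in lborel. P (x + c)"
proof -
  obtain N where N: "N \<in> null_sets lborel" "{x. \<not> P x} \<subseteq> N"
    using assms by (auto simp: eventually_ae_filter)
  have "{x. x - (- c) \<in> N} \<in> null_sets lborel" by (rule null_sets_translation[OF N(1)])
  then show ?thesis by (rule AE_I') (use N in auto)
qed

text \<open>The exceptional set on the line is covered by countably many integer translates of a
  null set in the unit interval.\<close>

lemma AE_periodic:
  assumes per: "\<And>x. P (x + 1) = P x" and ae: "AE x in mu 0 1. P (x::real)"
  shows "AE x in lborel. P x"
proof -
  have "AE x in lborel. \<forall>n::int. x + of_int n \<in> {0..1} \<longrightarrow> P (x + of_int n)"
    unfolding AE_all_countable
  proof
    fix n :: int
    show "AE x in lborel. x + of_int n \<in> {0..1} \<longrightarrow> P (x + of_int n)"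
      by (rule AE_lborel_translate[of "\<lambda>x. x \<in> {0..1} \<longrightarrow> P x"]) (use ae in \<open>simp add: AE_mu\<close>)
  qed
  then show ?thesis
  proof eventually_elim
    case (elim x)
    have "x + of_int (- \<lfloor>x\<rfloor>) \<in> {0..1}" using frac_lt_1[of x] frac_ge_0[of x] by (simp add: frac_def less_imp_le)
    then have "P (x + of_int (- \<lfloor>x\<rfloor>))" using elim by blast
    then show ?case using periodic_of_int[of P, OF per, of x "- \<lfloor>x\<rfloor>"] by simp
  qed
qed

text \<open>\<open>A\<close> is a periodic absolutely continuous function and \<open>a\<close> its
  derivative, in integrated form. Thus \<open>A\<close> is an honest continuous function, while
  \<open>a\<close> matters only up to null sets.\<close>

definition prim :: "(real \<Rightarrow> real) \<Rightarrow> (real \<Rightarrow> real) \<Rightarrow> bool" where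
  "prim A a \<longleftrightarrow> (\<forall>x. A (x + 1) = A x) \<and>
     (\<forall>x y. x \<le> y \<longrightarrow> integrable (mu x y) a \<and> A y = A x + integral\<^sup>L (mu x y) a)"

lemma primD:
  assumes "prim A a"
  shows "A (x + 1) = A x" "integrable (mu x y) a" "x \<le> y \<Longrightarrow> A y = A x + integral\<^sup>L (mu x y) a"
proof -
  show "A (x + 1) = A x" "x \<le> y \<Longrightarrow> A y = A x + integral\<^sup>L (mu x y) a" using assms by (auto simp: prim_def)
  have "integrable (mu (min x y) (max x y)) a" using assms by (auto simp: prim_def)
  then show "integrable (mu x y) a" by (rule integrable_mu_subset) auto
qed

text \<open>The zero mean of \<open>h\<close> is what makes the antiderivative periodic; to the left
  of 0 the integral is taken with the sign of an oriented integral.\<close>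

lemma prim_exists:
  assumes per: "\<And>x. h (x + 1) = h x" "\<And>x. W (x + 1) = W x"
    and h: "integrable (mu 0 1) h" "(\<integral>x. h x \<partial>mu 0 1) = 0"
    and W: "AE x in mu 0 1. W x = C + integral\<^sup>L (mu 0 x) h"
  obtains A where "prim A h" "AE x in lborel. W x = A x"
proof -
  note i = periodic_integrable[OF per(1) h(1)]
  define A where "A x = C + (if x \<ge> 0 then integral\<^sup>L (mu 0 x) h else - integral\<^sup>L (mu x 0) h)" for x
  have A: "A y = A x + integral\<^sup>L (mu x y) h" if "x \<le> y" for x y
    unfolding A_def using that integral_mu_combine[OF i, of 0 x y] integral_mu_combine[OF i, of x 0 y]
      integral_mu_combine[OF i, of x y 0] by auto
  have Ap: "A (x + 1) = A x" for x
    using A[of x "x + 1"] periodic_integral[OF per(1) h(1), of x] h(2) by simp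
  have "prim A h" unfolding prim_def by (intro allI conjI impI A Ap i)
  moreover have "AE x in lborel. W x = A x"
  proof (rule AE_periodic)
    show "AE x in mu 0 1. W x = A x" using W AE_mu_in by eventually_elim (simp add: A_def)
  qed (simp add: per Ap)
  ultimately show thesis by (rule that)
qed

lemma prim_continuous:
  assumes "prim A a"
  shows "continuous_on S A"
proof -
  have "isCont A x" for x
  proof -
    have "continuous_on {x - 1..x + 1} (\<lambda>y. A (x - 1) + integral\<^sup>L (mu (x - 1) y) a)"
      by (intro continuous_intros continuous_indefinite_mu primD(2)[OF assms])
    then have "continuous_on {x - 1..x + 1} A"
    proof (rule continuous_on_eq)
      fix y assume "y \<in> {x - 1..x + 1}"
      then show "A (x - 1) + integral\<^sup>L (mu (x - 1) y) a = A y"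
        using primD(3)[OF assms, of "x - 1" y] by simp
    qed
    then show ?thesis by (rule continuous_on_interior) auto
  qed
  then show ?thesis by (auto intro: continuous_at_imp_continuous_on)
qed

lemma prim_measurable: "prim A a \<Longrightarrow> A \<in> borel_measurable borel"
  by (rule borel_measurable_continuous_onI) (rule prim_continuous)

lemma prim_cong:
  assumes A: "prim A a" and ae: "AE x in lborel. a x = b x" and b: "b \<in> borel_measurable borel"
  shows "prim A b"
proof -
  have "integrable (mu x y) b \<and> integral\<^sup>L (mu x y) a = integral\<^sup>L (mu x y) b" for x y
  proof -
    note i = primD(2)[OF A, of x y]
    have ae': "AE x in mu x y. a x = b x" by (rule AE_mu_lborel[OF ae])
    have "integrable (mu x y) b" using i ae' b integrable_cong_AE[of a "mu x y" b] integrable_mu_meas[OF i] by auto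
    moreover have "integral\<^sup>L (mu x y) a = integral\<^sup>L (mu x y) b"
      using ae' b integrable_mu_meas[OF i] by (intro integral_cong_AE) auto
    ultimately show ?thesis by simp
  qed
  then show ?thesis using A unfolding prim_def by auto
qed

lemma prim_add: "prim A a \<Longrightarrow> prim B b \<Longrightarrow> prim (\<lambda>x. A x + B x) (\<lambda>x. a x + b x)"
  unfolding prim_def by auto

lemma prim_diff: "prim A a \<Longrightarrow> prim B b \<Longrightarrow> prim (\<lambda>x. A x - B x) (\<lambda>x. a x - b x)"
  unfolding prim_def by auto

lemma prim_const: "prim (\<lambda>x. c) (\<lambda>x. 0)"
  unfolding prim_def by auto

lemma prim_sum: "finite I \<Longrightarrow> (\<And>i. i \<in> I \<Longrightarrow> prim (A i) (a i)) \<Longrightarrow> prim (\<lambda>x. \<Sum>i\<in>I. A i x) (\<lambda>x. \<Sum>i\<in>I. a i x)"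
  by (induction I rule: finite_induct) (auto intro: prim_add prim_const)

text \<open>No boundary term appears because both factors are periodic. This is how exact
  derivatives are discarded in the energy estimate.\<close>

lemma prim_by_parts:
  assumes A: "prim A a" and B: "prim B b"
  shows "integrable (mu 0 1) (\<lambda>x. a x * B x + A x * b x)" "(\<integral>x. a x * B x + A x * b x \<partial>mu 0 1) = 0"
proof -
  note p = integral_by_parts_mu[OF primD(2)[OF A, of 0 1] primD(2)[OF B, of 0 1], where c = "A 0" and d = "B 0"]
  have [measurable]: "a \<in> borel_measurable borel" "b \<in> borel_measurable borel"
    using primD(2)[OF A, of 0 1] primD(2)[OF B, of 0 1] by (auto intro: integrable_mu_meas)
  have [measurable]: "A \<in> borel_measurable borel" "B \<in> borel_measurable borel"
    using A B by (auto intro: prim_measurable)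
  have ae: "AE x in mu 0 1. a x * (B 0 + integral\<^sup>L (mu 0 x) b) + (A 0 + integral\<^sup>L (mu 0 x) a) * b x
      = a x * B x + A x * b x"
    using AE_mu_in
  proof eventually_elim
    case (elim x)
    then show ?case using primD(3)[OF A, of 0 x] primD(3)[OF B, of 0 x] by simp
  qed
  show "integrable (mu 0 1) (\<lambda>x. a x * B x + A x * b x)"
    using p(1) integrable_cong_AE[OF _ _ ae] by simp
  have "integral\<^sup>L (mu 0 1) (\<lambda>x. a x * (B 0 + integral\<^sup>L (mu 0 x) b) + (A 0 + integral\<^sup>L (mu 0 x) a) * b x)
    = (\<integral>x. a x * B x + A x * b x \<partial>mu 0 1)"
    by (rule integral_cong_AE[OF _ _ ae]) auto
  then show "(\<integral>x. a x * B x + A x * b x \<partial>mu 0 1) = 0"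
    using p(2) primD(3)[OF A, of 0 1] primD(3)[OF B, of 0 1] primD(1)[OF A, of 0] primD(1)[OF B, of 0] by simp
qed

lemma prim_lipschitz:
  assumes A: "prim A a" and N: "AE x in lborel. \<bar>a x\<bar> \<le> N" and "x \<le> y"
  shows "\<bar>A y - A x\<bar> \<le> N * (y - x)"
  using abs_integral_mu_le[OF primD(2)[OF A] AE_mu_lborel[OF N] assms(3)] primD(3)[OF A assms(3)] by simp

lemma prim_oscillation:
  assumes A: "prim A a" and xy: "x \<in> {0..1}" "y \<in> {0..1}"
  shows "\<bar>A y - A x\<bar> \<le> (\<integral>z. \<bar>a z\<bar> \<partial>mu 0 1)"
proof -
  have le: "\<bar>A y - A x\<bar> \<le> (\<integral>z. \<bar>a z\<bar> \<partial>mu 0 1)" if "x \<in> {0..1}" "y \<in> {0..1}" "x \<le> y" for x y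
  proof -
    have i: "integrable (mu 0 1) (\<lambda>z. \<bar>a z\<bar>)" using primD(2)[OF A, of 0 1] by simp
    have "\<bar>A y - A x\<bar> \<le> (\<integral>z. \<bar>a z\<bar> \<partial>mu x y)" using primD(3)[OF A that(3)] by (simp add: integral_abs_bound)
    also have "\<dots> \<le> (\<integral>z. \<bar>a z\<bar> \<partial>mu x 1)" using abs_indefinite_mu_le[OF integrable_mu_subset[OF i, of x 1], of y] that by auto
    also have "\<dots> \<le> (\<integral>z. \<bar>a z\<bar> \<partial>mu 0 1)"
    proof -
      have "0 \<le> (\<integral>z. \<bar>a z\<bar> \<partial>mu 0 x)" by simp
      then show ?thesis using integral_mu_combine[OF i, of x] that by simp
    qed
    finally show ?thesis .
  qed
  show ?thesis using le[of x y] le[of y x] xy by (cases "x \<le> y") (auto simp: abs_minus_commute)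
qed

text \<open>The point may be an endpoint of the intervals, so forward averages (of the weight) and
  backward averages (of \<open>w\<close>) are both covered.\<close>

lemma averages_tendsto:
  fixes f :: "real \<Rightarrow> real"
  assumes f: "continuous_on UNIV f"
    and ab: "\<And>n. a n < b n" "\<And>n. a n \<le> x" "\<And>n. x \<le> b n" and lim: "(\<lambda>n. b n - a n) \<longlonglongrightarrow> 0"
  shows "(\<lambda>n. integral\<^sup>L (mu (a n) (b n)) f / (b n - a n)) \<longlonglongrightarrow> f x"
proof (rule LIMSEQ_I)
  fix r :: real assume r: "r > 0"
  have [measurable]: "f \<in> borel_measurable borel" by (rule borel_measurable_continuous_onI[OF f])
  have "isCont f x" using f by (simp add: continuous_on_eq_continuous_at)
  then obtain d where d: "d > 0" "\<And>y. dist y x < d \<Longrightarrow> dist (f y) (f x) < r / 2"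
    using r unfolding continuous_at_eps_delta by (metis half_gt_zero)
  obtain n0 where n0: "\<And>n. n \<ge> n0 \<Longrightarrow> \<bar>b n - a n\<bar> < d" using LIMSEQ_D[OF lim d(1)] by auto
  show "\<exists>no. \<forall>n\<ge>no. norm (integral\<^sup>L (mu (a n) (b n)) f / (b n - a n) - f x) < r"
  proof (intro exI allI impI)
    fix n assume "n \<ge> n0"
    then have bd: "b n - a n < d" using n0[of n] by auto
    have ae: "AE y in mu (a n) (b n). \<bar>f y - f x\<bar> \<le> r / 2"
      using AE_mu_in
    proof eventually_elim
      case (elim y)
      then have "dist y x < d" using ab[of n] bd by (auto simp: dist_real_def)
      then show ?case using d(2)[of y] by (simp add: dist_real_def)
    qed
    have i: "integrable (mu (a n) (b n)) (\<lambda>y. f y - f x)" by (rule integrable_mu_bounded[OF _ ae]) simp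
    then have i': "integrable (mu (a n) (b n)) f" using Bochner_Integration.integrable_add[OF i, of "\<lambda>_. f x"] by simp
    have "\<bar>integral\<^sup>L (mu (a n) (b n)) (\<lambda>y. f y - f x)\<bar> \<le> r / 2 * (b n - a n)"
      by (rule abs_integral_mu_le[OF i ae]) (use ab(1)[of n] in simp)
    then have "\<bar>integral\<^sup>L (mu (a n) (b n)) f - f x * (b n - a n)\<bar> \<le> r / 2 * (b n - a n)"
      using i' ab(1)[of n] by (simp add: measure_mu mult.commute)
    then have "\<bar>(integral\<^sup>L (mu (a n) (b n)) f / (b n - a n) - f x) * (b n - a n)\<bar> \<le> r / 2 * (b n - a n)"
      using ab(1)[of n] by (simp add: left_diff_distrib)
    then have "\<bar>integral\<^sup>L (mu (a n) (b n)) f / (b n - a n) - f x\<bar> \<le> r / 2"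
      using ab(1)[of n] by (simp add: abs_mult)
    then show "norm (integral\<^sup>L (mu (a n) (b n)) f / (b n - a n) - f x) < r" using r by simp
  qed
qed

section \<open>The product rule for weighted squares\<close>

lemma integrable_mu_pair_subset:
  fixes f :: "real \<Rightarrow> real \<Rightarrow> real"
  assumes f: "integrable (mu a b \<Otimes>\<^sub>M mu c d) (\<lambda>(t, x). f t x)" and "a \<le> a'" "b' \<le> b"
  shows "integrable (mu a' b' \<Otimes>\<^sub>M mu c d) (\<lambda>(t, x). f t x)"
proof (rule mup.Fubini_integrable)
  have [measurable]: "case_prod f \<in> borel_measurable (borel \<Otimes>\<^sub>M borel)"
    using borel_measurable_integrable[OF f] by simp
  show "(\<lambda>(t, x). f t x) \<in> borel_measurable (mu a' b' \<Otimes>\<^sub>M mu c d)" by simp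
  have "integrable (mu a b \<Otimes>\<^sub>M mu c d) (\<lambda>(t, x). \<bar>f t x\<bar>)"
    using integrable_abs[OF f] by (simp add: case_prod_unfold)
  then have "integrable (mu a b) (\<lambda>t. \<integral>x. \<bar>f t x\<bar> \<partial>mu c d)" by (rule mup.integrable_fst)
  then show "integrable (mu a' b') (\<lambda>x. \<integral>y. norm (case (x, y) of (t, x) \<Rightarrow> f t x) \<partial>mu c d)"
    using integrable_mu_subset assms(2,3) by simp
  have "AE t in mu a b. integrable (mu c d) (f t)"
    using mup.AE_integrable_fst[OF f] by simp
  then show "AE x in mu a' b'. integrable (mu c d) (\<lambda>y. case (x, y) of (t, x) \<Rightarrow> f t x)"
    using AE_mu_subset assms(2,3) by simp
qed

text \<open>\<open>W\<close> has time derivative \<open>H\<close> and space derivative \<open>w\<close>, while the weight \<open>om\<close> satisfies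
  the conservation law with flux \<open>K\<close>, \<open>om\<^sub>t = K\<^sub>x\<close>. All functions are 1-periodic in space.\<close>

locale weighted_primitive =
  fixes H K w om W :: "real \<Rightarrow> real \<Rightarrow> real" and N :: "real \<Rightarrow> real" and T B :: real
  assumes T: "0 \<le> T" and B: "0 \<le> B"
    and H_m [measurable]: "case_prod H \<in> borel_measurable (borel \<Otimes>\<^sub>M borel)"
    and K_m [measurable]: "case_prod K \<in> borel_measurable (borel \<Otimes>\<^sub>M borel)"
    and w_m [measurable]: "case_prod w \<in> borel_measurable (borel \<Otimes>\<^sub>M borel)"
    and om_m [measurable]: "case_prod om \<in> borel_measurable (borel \<Otimes>\<^sub>M borel)"
    and N_m [measurable]: "N \<in> borel_measurable borel"
    and perH: "\<And>t x. H t (x + 1) = H t x" and perK: "\<And>t x. K t (x + 1) = K t x"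
    and iH: "integrable (mu 0 T \<Otimes>\<^sub>M mu 0 1) (\<lambda>(t, x). H t x)"
    and iK: "integrable (mu 0 T \<Otimes>\<^sub>M mu 0 1) (\<lambda>(t, x). K t x)"
    and iNH: "integrable (mu 0 T \<Otimes>\<^sub>M mu 0 1) (\<lambda>(t, x). N t * H t x)"
    and iNK: "integrable (mu 0 T \<Otimes>\<^sub>M mu 0 1) (\<lambda>(t, x). N t * K t x)"
    and iom: "\<And>t x y. t \<in> {0..T} \<Longrightarrow> integrable (mu x y) (om t)"
    and W_eq: "\<And>t x. W t x = integral\<^sup>L (mu 0 t) (\<lambda>s. H s x)"
    and repW: "\<And>t. t \<in> {0..T} \<Longrightarrow> \<exists>A. prim A (w t) \<and> (AE x in lborel. W t x = A x)"
    and repK: "\<And>t. t \<in> {0..T} \<Longrightarrow> \<exists>A. prim A (\<lambda>x. om t x - om 0 x) \<and>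
        (AE x in lborel. integral\<^sup>L (mu 0 t) (\<lambda>s. K s x) = A x)"
    and boundW: "\<And>t. t \<in> {0..T} \<Longrightarrow> AE x in lborel. \<bar>W t x\<bar> \<le> B"
    and N0: "\<And>t. 0 \<le> N t"
    and bom: "AE t in mu 0 T. (AE x in lborel. \<bar>om t x\<bar> \<le> N t) \<and>
        (\<exists>f. continuous_on UNIV f \<and> (AE x in lborel. om t x = f x))"
    and bw: "AE t in mu 0 T. (AE x in lborel. \<bar>w t x\<bar> \<le> N t) \<and>
        (\<exists>f. continuous_on UNIV f \<and> (AE x in lborel. w t x = f x))"
begin

lemma W_m [measurable]: "case_prod W \<in> borel_measurable (borel \<Otimes>\<^sub>M borel)"
  unfolding W_eq by measurable

lemma perW: "W t (x + 1) = W t x"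
  unfolding W_eq perH by simp

definition step :: "nat \<Rightarrow> real" where "step n = 1 / real (Suc n)"

lemma step_pos: "0 < step n" by (simp add: step_def)

lemma step_lim: "step \<longlonglongrightarrow> 0"
  unfolding step_def by (rule lim_1_over_n[THEN LIMSEQ_Suc])

text \<open>Averaging in space turns the time derivative of the weight into a difference quotient of
  \<open>K\<close>, which is again a function.\<close>

definition omE :: "nat \<Rightarrow> real \<Rightarrow> real \<Rightarrow> real" where
  "omE n s x = integral\<^sup>L (mu x (x + step n)) (om s) / step n"

definition dK :: "nat \<Rightarrow> real \<Rightarrow> real \<Rightarrow> real" where
  "dK n s x = (K s (x + step n) - K s x) / step n"

text \<open>The averaged conservation law integrated at fixed \<open>x\<close>. For almost every
  \<open>x\<close> this is a primitive in time, and at each time it agrees with \<open>omE\<close>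
  almost everywhere.\<close>

definition G :: "nat \<Rightarrow> real \<Rightarrow> real \<Rightarrow> real" where
  "G n s x = omE n 0 x + integral\<^sup>L (mu 0 s) (\<lambda>r. dK n r x)"

text \<open>The time derivative of \<open>(W s x)\<^sup>2 * G n s x\<close>.\<close>

definition \<Psi> :: "nat \<Rightarrow> real \<Rightarrow> real \<Rightarrow> real" where
  "\<Psi> n s x = 2 * W s x * H s x * G n s x + (W s x)\<^sup>2 * dK n s x"

text \<open>\<open>\<Psi>\<close> after a discrete integration by parts on the torus: the difference
  quotient has moved from \<open>K\<close> to the square of \<open>W\<close>.\<close>

definition \<Phi> :: "nat \<Rightarrow> real \<Rightarrow> real \<Rightarrow> real" where
  "\<Phi> n s x = 2 * W s x * H s x * omE n s x + K s x * ((W s (x - step n))\<^sup>2 - (W s x)\<^sup>2) / step n"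

text \<open>The limit of the space integrals of \<open>\<Phi>\<close>, that is, the rate of change
  of the integral of \<open>(W s x)\<^sup>2 * om s x\<close>.\<close>

definition Z :: "real \<Rightarrow> real" where
  "Z s = (\<integral>x. 2 * W s x * H s x * om s x - 2 * W s x * w s x * K s x \<partial>mu 0 1)"

text \<open>Majorant of \<open>\<Phi> n\<close> that does not depend on \<open>n\<close>. Its
  integrability comes from \<open>iNH\<close> and \<open>iNK\<close>.\<close>

definition k :: "real \<Rightarrow> real \<Rightarrow> real" where
  "k s x = 2 * B * (N s * \<bar>H s x\<bar>) + 2 * B * (N s * \<bar>K s x\<bar>)"

lemma omE_m [measurable]: "case_prod (omE n) \<in> borel_measurable (borel \<Otimes>\<^sub>M borel)"
  unfolding omE_def by measurable

lemma dK_m [measurable]: "case_prod (dK n) \<in> borel_measurable (borel \<Otimes>\<^sub>M borel)"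
  unfolding dK_def by measurable

lemma G_m [measurable]: "case_prod (G n) \<in> borel_measurable (borel \<Otimes>\<^sub>M borel)"
  unfolding G_def by measurable

lemma Psi_m [measurable]: "case_prod (\<Psi> n) \<in> borel_measurable (borel \<Otimes>\<^sub>M borel)"
  unfolding \<Psi>_def by measurable

lemma Phi_m [measurable]: "case_prod (\<Phi> n) \<in> borel_measurable (borel \<Otimes>\<^sub>M borel)"
  unfolding \<Phi>_def by measurable

lemma k_m [measurable]: "case_prod k \<in> borel_measurable (borel \<Otimes>\<^sub>M borel)"
  unfolding k_def by measurable

section \<open>The averaged identity at a fixed step, uniform bounds and the limit\<close>

lemma AE_H_time: "AE x in lborel. integrable (mu 0 T) (\<lambda>s. H s x)"
  by (rule AE_periodic) (use mup.AE_integrable_snd[OF iH] in \<open>auto simp: perH\<close>)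

lemma AE_K_time: "AE x in lborel. integrable (mu 0 T) (\<lambda>s. K s x)"
  by (rule AE_periodic) (use mup.AE_integrable_snd[OF iK] in \<open>auto simp: perK\<close>)

lemma dK_time:
  assumes "integrable (mu 0 T) (\<lambda>s. K s x)" "integrable (mu 0 T) (\<lambda>s. K s (x + step n))" "t \<le> T"
  shows "integrable (mu 0 t) (\<lambda>s. dK n s x)"
  unfolding dK_def using assms integrable_mu_subset[OF assms(1), of 0 t] integrable_mu_subset[OF assms(2), of 0 t]
  by simp

lemma omE_eq_G:
  assumes s: "s \<in> {0..T}"
  shows "AE x in lborel. omE n s x = G n s x"
proof -
  obtain A where A: "prim A (\<lambda>x. om s x - om 0 x)"
    and ae: "AE x in lborel. integral\<^sup>L (mu 0 s) (\<lambda>r. K r x) = A x" using repK[OF s] by blast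
  show ?thesis
    using ae AE_lborel_translate[OF ae, of "step n"] AE_K_time AE_lborel_translate[OF AE_K_time, of "step n"]
  proof eventually_elim
    case (elim x)
    have i: "integrable (mu 0 s) (\<lambda>r. K r x)" "integrable (mu 0 s) (\<lambda>r. K r (x + step n))"
      using elim(3,4) s integrable_mu_subset by auto
    have "integral\<^sup>L (mu 0 s) (\<lambda>r. dK n r x) = (A (x + step n) - A x) / step n"
      unfolding dK_def using i elim(1,2) by simp
    also have "A (x + step n) - A x = integral\<^sup>L (mu x (x + step n)) (\<lambda>x. om s x - om 0 x)"
      using primD(3)[OF A, of x "x + step n"] step_pos[of n] by simp
    also have "\<dots> = integral\<^sup>L (mu x (x + step n)) (om s) - integral\<^sup>L (mu x (x + step n)) (om 0)"
      using iom s T by simp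
    finally show ?case by (simp add: G_def omE_def diff_divide_distrib)
  qed
qed

text \<open>At almost every fixed \<open>x\<close> both factors are absolutely continuous in time.
  Integration by parts is applied to \<open>W\<close> times itself and then to this square times
  \<open>G\<close>.\<close>

lemma W_sq_G:
  assumes t: "t \<in> {0..T}"
  shows "AE x in lborel. (W t x)\<^sup>2 * G n t x = integral\<^sup>L (mu 0 t) (\<lambda>s. \<Psi> n s x)"
  using AE_H_time AE_K_time AE_lborel_translate[OF AE_K_time, of "step n"]
proof eventually_elim
  case (elim x)
  have iH: "integrable (mu 0 t) (\<lambda>s. H s x)" using elim(1) t integrable_mu_subset by auto
  have idK: "integrable (mu 0 t) (\<lambda>s. dK n s x)" using dK_time[OF elim(2,3)] t by simp
  have ff: "(\<lambda>s. H s x * (0 + integral\<^sup>L (mu 0 s) (\<lambda>s. H s x)) + (0 + integral\<^sup>L (mu 0 s) (\<lambda>s. H s x)) * H s x)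
      = (\<lambda>s. 2 * W s x * H s x)"
    by (simp add: W_eq fun_eq_iff)
  have iHW: "integrable (mu 0 t) (\<lambda>s. 2 * W s x * H s x)"
    using integral_by_parts_mu(1)[OF iH iH, where c=0 and d=0] t unfolding ff by simp
  have sq: "(W s x)\<^sup>2 = integral\<^sup>L (mu 0 s) (\<lambda>s. 2 * W s x * H s x)" if "s \<in> {0..t}" for s
  proof -
    have iHs: "integrable (mu 0 s) (\<lambda>s. H s x)" using elim(1) t that integrable_mu_subset by auto
    show ?thesis
      using integral_by_parts_mu(2)[OF iHs iHs, where c=0 and d=0] that unfolding ff
      by (simp add: W_eq power2_eq_square)
  qed
  have "(W t x)\<^sup>2 * G n t x = (0 + integral\<^sup>L (mu 0 t) (\<lambda>s. 2 * W s x * H s x)) * (omE n 0 x + integral\<^sup>L (mu 0 t) (\<lambda>s. dK n s x))"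
    using sq[of t] t by (simp add: G_def)
  also have "\<dots> = 0 * omE n 0 x + (\<integral>s. (2 * W s x * H s x) * (omE n 0 x + integral\<^sup>L (mu 0 s) (\<lambda>s. dK n s x))
      + (0 + integral\<^sup>L (mu 0 s) (\<lambda>s. 2 * W s x * H s x)) * dK n s x \<partial>mu 0 t)"
    by (rule integral_by_parts_mu(2)[OF iHW idK]) (use t in simp)
  also have "\<dots> = integral\<^sup>L (mu 0 t) (\<lambda>s. \<Psi> n s x)"
    unfolding mult_zero_left add_0
  proof (rule integral_cong_AE)
    show "AE s in mu 0 t. (2 * W s x * H s x) * (omE n 0 x + integral\<^sup>L (mu 0 s) (\<lambda>s. dK n s x))
      + integral\<^sup>L (mu 0 s) (\<lambda>s. 2 * W s x * H s x) * dK n s x = \<Psi> n s x"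
      using AE_mu_in
    proof eventually_elim
      case (elim s)
      then show ?case using sq[of s] by (simp add: \<Psi>_def G_def)
    qed
  qed simp_all
  finally show ?case .
qed

lemma omE_bound:
  assumes s: "s \<in> {0..T}" and N: "AE x in lborel. \<bar>om s x\<bar> \<le> N s"
  shows "\<bar>omE n s x\<bar> \<le> N s"
proof -
  have "\<bar>integral\<^sup>L (mu x (x + step n)) (om s)\<bar> \<le> N s * (x + step n - x)"
    by (rule abs_integral_mu_le[OF iom[OF s] AE_mu_lborel[OF N]]) (use step_pos[of n] in simp)
  then show ?thesis using step_pos[of n] by (simp add: omE_def abs_divide divide_le_eq)
qed

lemma iK_shift: "integrable (mu 0 T \<Otimes>\<^sub>M mu 0 1) (\<lambda>(t, x). K t (x + c))"
proof (rule mup.Fubini_integrable)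
  have aK: "AE t in mu 0 T. integrable (mu 0 1) (K t)" using mup.AE_integrable_fst[OF iK] by simp
  have "integrable (mu 0 T \<Otimes>\<^sub>M mu 0 1) (\<lambda>(t, x). \<bar>K t x\<bar>)"
    using integrable_abs[OF iK] by (simp add: case_prod_unfold)
  then have i: "integrable (mu 0 T) (\<lambda>t. \<integral>x. \<bar>K t x\<bar> \<partial>mu 0 1)" by (rule mup.integrable_fst)
  have ae: "AE t in mu 0 T. (\<integral>x. \<bar>K t x\<bar> \<partial>mu 0 1) = (\<integral>x. \<bar>K t (x + c)\<bar> \<partial>mu 0 1)"
    using aK by eventually_elim (subst periodic_shift(2)[where h="\<lambda>x. \<bar>K t x\<bar>" for t], auto simp: perK)
  show "integrable (mu 0 T) (\<lambda>x. \<integral>y. norm (case (x, y) of (t, x) \<Rightarrow> K t (x + c)) \<partial>mu 0 1)"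
    using i integrable_cong_AE[OF _ _ ae] by simp
  show "AE x in mu 0 T. integrable (mu 0 1) (\<lambda>y. case (x, y) of (t, x) \<Rightarrow> K t (x + c))"
    using aK by eventually_elim (simp add: periodic_shift(1) perK)
qed simp

text \<open>The majorant degenerates as the step tends to 0; it serves only to justify Fubini at
  fixed \<open>n\<close>.\<close>

lemma iPsi: "integrable (mu 0 T \<Otimes>\<^sub>M mu 0 1) (\<lambda>(s, x). \<Psi> n s x)"
proof (rule Bochner_Integration.integrable_bound)
  let ?M = "\<lambda>(s, x). 2 * B * \<bar>N s * H s x\<bar> + B\<^sup>2 / step n * (\<bar>K s (x + step n)\<bar> + \<bar>K s x\<bar>)"
  show "integrable (mu 0 T \<Otimes>\<^sub>M mu 0 1) ?M"
    using integrable_abs[OF iNH] integrable_abs[OF iK_shift[of "step n"]] integrable_abs[OF iK]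
    by (simp add: case_prod_unfold)
  have "AE p in mu 0 T \<Otimes>\<^sub>M mu 0 1. \<bar>W (fst p) (snd p)\<bar> \<le> B \<and> \<bar>G n (fst p) (snd p)\<bar> \<le> N (fst p)"
  proof (rule AE_mu_pairI)
    show "AE s in mu 0 T. AE x in mu 0 1. \<bar>W s x\<bar> \<le> B \<and> \<bar>G n s x\<bar> \<le> N s"
      using bom AE_mu_in
    proof eventually_elim
      case (elim s)
      show ?case
        using AE_mu_lborel[OF boundW[OF elim(2)]] AE_mu_lborel[OF omE_eq_G[OF elim(2), of n]]
      proof eventually_elim
        case (elim x)
        then show ?case using omE_bound[of s n x] \<open>s \<in> {0..T}\<close> \<open>(AE x in lborel. \<bar>om s x\<bar> \<le> N s) \<and> _\<close> by auto
      qed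
    qed
  qed measurable
  then show "AE p in mu 0 T \<Otimes>\<^sub>M mu 0 1. norm (case p of (s, x) \<Rightarrow> \<Psi> n s x) \<le> norm (?M p)"
  proof eventually_elim
    case (elim p)
    obtain s x where p: "p = (s, x)" by (cases p)
    have W: "\<bar>W s x\<bar> \<le> B" and G: "\<bar>G n s x\<bar> \<le> N s" using elim p by auto
    have "\<bar>2 * W s x * H s x * G n s x\<bar> \<le> 2 * B * \<bar>N s * H s x\<bar>"
    proof -
      have "\<bar>W s x\<bar> * (\<bar>H s x\<bar> * \<bar>G n s x\<bar>) \<le> B * (\<bar>H s x\<bar> * N s)"
        using W G B by (intro mult_mono) auto
      then show ?thesis using N0[of s] by (simp add: abs_mult mult_ac)
    qed
    moreover have "\<bar>(W s x)\<^sup>2 * dK n s x\<bar> \<le> B\<^sup>2 / step n * (\<bar>K s (x + step n)\<bar> + \<bar>K s x\<bar>)"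
    proof -
      have "\<bar>(W s x)\<^sup>2\<bar> * \<bar>dK n s x\<bar> \<le> B\<^sup>2 * ((\<bar>K s (x + step n)\<bar> + \<bar>K s x\<bar>) / step n)"
      proof (rule mult_mono)
        show "\<bar>(W s x)\<^sup>2\<bar> \<le> B\<^sup>2" using W by (simp add: abs_le_square_iff[symmetric])
        show "\<bar>dK n s x\<bar> \<le> (\<bar>K s (x + step n)\<bar> + \<bar>K s x\<bar>) / step n"
          using step_pos[of n] by (auto simp: dK_def abs_divide intro!: divide_right_mono)
      qed auto
      then show ?thesis by (simp add: abs_mult)
    qed
    moreover have "0 \<le> 2 * B * \<bar>N s * H s x\<bar> + B\<^sup>2 / step n * (\<bar>K s (x + step n)\<bar> + \<bar>K s x\<bar>)"
      using B step_pos[of n] by (intro add_nonneg_nonneg mult_nonneg_nonneg) auto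
    ultimately show ?case unfolding p \<Psi>_def by simp
  qed
qed simp

lemma ik: "integrable (mu 0 T \<Otimes>\<^sub>M mu 0 1) (\<lambda>(s, x). k s x)"
  using integrable_abs[OF iNH] integrable_abs[OF iNK] N0
  by (simp add: case_prod_unfold k_def abs_mult)

text \<open>The bound \<open>N s\<close> on \<open>w\<close> makes \<open>W\<close> Lipschitz in
  space, so the increment of its square is proportional to the step and the estimate is uniform in
  \<open>n\<close>.\<close>

lemma inner_bound:
  assumes s: "s \<in> {0..T}" and w: "AE x in lborel. \<bar>w s x\<bar> \<le> N s"
  shows "AE x in lborel. \<bar>K s x * ((W s (x - step n))\<^sup>2 - (W s x)\<^sup>2) / step n\<bar> \<le> 2 * B * (N s * \<bar>K s x\<bar>)"
proof -
  obtain A where A: "prim A (w s)" and ae: "AE x in lborel. W s x = A x" using repW[OF s] by blast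
  have W: "AE x in lborel. \<bar>W s x\<bar> \<le> B" using boundW[OF s] .
  show ?thesis
    using ae AE_lborel_translate[OF ae, of "- step n"] W AE_lborel_translate[OF W, of "- step n"]
  proof eventually_elim
    case (elim x)
    have d: "\<bar>W s (x - step n) - W s x\<bar> \<le> N s * step n"
      using prim_lipschitz[OF A w, of "x - step n" x] elim step_pos[of n] by simp
    have "(W s (x - step n))\<^sup>2 - (W s x)\<^sup>2 = (W s (x - step n) - W s x) * (W s (x - step n) + W s x)"
      by (simp add: power2_eq_square algebra_simps)
    moreover have "\<bar>W s (x - step n) - W s x\<bar> * \<bar>W s (x - step n) + W s x\<bar> \<le> (N s * step n) * (2 * B)"
      by (rule mult_mono[OF d]) (use elim N0[of s] step_pos[of n] in auto)
    ultimately have "\<bar>(W s (x - step n))\<^sup>2 - (W s x)\<^sup>2\<bar> \<le> (N s * step n) * (2 * B)"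
      by (simp only: abs_mult)
    then have "\<bar>(W s (x - step n))\<^sup>2 - (W s x)\<^sup>2\<bar> / step n \<le> N s * (2 * B)"
      using step_pos[of n] by (simp add: divide_le_eq mult_ac)
    then have "\<bar>K s x\<bar> * (\<bar>(W s (x - step n))\<^sup>2 - (W s x)\<^sup>2\<bar> / step n) \<le> \<bar>K s x\<bar> * (N s * (2 * B))"
      by (intro mult_left_mono) auto
    then show ?case using step_pos[of n] by (simp add: abs_mult mult_ac)
  qed
qed

lemma Phi_bound:
  assumes s: "s \<in> {0..T}" and w: "AE x in lborel. \<bar>w s x\<bar> \<le> N s" and om: "AE x in lborel. \<bar>om s x\<bar> \<le> N s"
  shows "AE x in lborel. \<bar>\<Phi> n s x\<bar> \<le> k s x"
  using inner_bound[OF s w, of n] boundW[OF s]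
proof eventually_elim
  case (elim x)
  have "\<bar>W s x\<bar> * (\<bar>H s x\<bar> * \<bar>omE n s x\<bar>) \<le> B * (\<bar>H s x\<bar> * N s)"
    using elim omE_bound[OF s om, of n x] B by (intro mult_mono) auto
  then have "\<bar>2 * W s x * H s x * omE n s x\<bar> \<le> 2 * B * (N s * \<bar>H s x\<bar>)"
    by (simp add: abs_mult mult_ac)
  with elim(1) show ?case unfolding \<Phi>_def k_def
    by (intro order_trans[OF abs_triangle_ineq] add_mono)
qed

text \<open>Integrals over a period do not change under a shift by one step, which moves the shift
  from \<open>K\<close> onto the square of \<open>W\<close>.\<close>

lemma Psi_integral:
  "AE s in mu 0 T. (\<integral>x. \<Psi> n s x \<partial>mu 0 1) = (\<integral>x. \<Phi> n s x \<partial>mu 0 1)"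
proof -
  have aK: "AE t in mu 0 T. integrable (mu 0 1) (K t)" using mup.AE_integrable_fst[OF iK] by simp
  have aNH: "AE t in mu 0 T. integrable (mu 0 1) (\<lambda>x. N t * H t x)" using mup.AE_integrable_fst[OF iNH] by simp
  show ?thesis using aK aNH bom AE_mu_in
  proof eventually_elim
    case (elim s)
    then have s: "s \<in> {0..T}" and om: "AE x in lborel. \<bar>om s x\<bar> \<le> N s" by auto
    have Wb: "AE x in mu 0 1. \<bar>W s x\<bar> \<le> B" by (rule AE_mu_lborel[OF boundW[OF s]])
    have Wsq: "(W s x)\<^sup>2 \<le> B\<^sup>2" if "\<bar>W s x\<bar> \<le> B" for x using that by (simp add: abs_le_square_iff[symmetric])
    have iK2: "integrable (mu 0 1) (\<lambda>x. (W s x)\<^sup>2 * K s (x + c))" if "c = 0 \<or> c = step n" for c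
    proof (rule Bochner_Integration.integrable_bound)
      show "integrable (mu 0 1) (\<lambda>x. B\<^sup>2 * K s (x + c))" using periodic_shift(1)[OF perK elim(1), of c] by simp
      show "AE x in mu 0 1. norm ((W s x)\<^sup>2 * K s (x + c)) \<le> norm (B\<^sup>2 * K s (x + c))"
        using Wb by eventually_elim (auto simp: abs_mult intro!: mult_right_mono Wsq)
    qed simp
    have iW: "integrable (mu 0 1) (\<lambda>x. 2 * W s x * H s x * omE n s x)"
    proof (rule Bochner_Integration.integrable_bound)
      show "integrable (mu 0 1) (\<lambda>x. 2 * B * (N s * H s x))" using elim(2) by simp
      show "AE x in mu 0 1. norm (2 * W s x * H s x * omE n s x) \<le> norm (2 * B * (N s * H s x))"
        using Wb
      proof eventually_elim
        case (elim x)
        have "\<bar>W s x\<bar> * (\<bar>H s x\<bar> * \<bar>omE n s x\<bar>) \<le> B * (\<bar>H s x\<bar> * N s)"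
          using elim omE_bound[OF s om, of n x] B by (intro mult_mono) auto
        then show ?case using B N0[of s] by (simp add: abs_mult mult_ac)
      qed
    qed simp
    have perh: "(W s (x + 1 - step n))\<^sup>2 * K s (x + 1) = (W s (x - step n))\<^sup>2 * K s x" for x
      using perW[of s "x - step n"] perK[of s x] by (simp add: algebra_simps)
    have ih: "integrable (mu 0 1) (\<lambda>x. (W s (x - step n))\<^sup>2 * K s x)"
    proof -
      have "integrable (mu 0 1) (\<lambda>x. (W s (x + - step n))\<^sup>2 * K s (x + - step n + step n))"
        by (rule periodic_shift(1)[where h="\<lambda>x. (W s x)\<^sup>2 * K s (x + step n)"])
           (use iK2[of "step n"] perW perK[of s "x + step n" for x] in \<open>auto simp: add_ac\<close>)
      then show ?thesis by simp
    qed
    have sh: "(\<integral>x. (W s x)\<^sup>2 * K s (x + step n) \<partial>mu 0 1) = (\<integral>x. (W s (x - step n))\<^sup>2 * K s x \<partial>mu 0 1)"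
      using periodic_shift(2)[where h="\<lambda>x. (W s (x - step n))\<^sup>2 * K s x" and c="step n", OF perh ih] by simp
    have "(\<integral>x. \<Psi> n s x \<partial>mu 0 1) = (\<integral>x. 2 * W s x * H s x * omE n s x + ((W s x)\<^sup>2 * K s (x + step n) - (W s x)\<^sup>2 * K s x) / step n \<partial>mu 0 1)"
    proof (rule integral_cong_AE)
      show "AE x in mu 0 1. \<Psi> n s x = 2 * W s x * H s x * omE n s x + ((W s x)\<^sup>2 * K s (x + step n) - (W s x)\<^sup>2 * K s x) / step n"
        using AE_mu_lborel[OF omE_eq_G[OF s, of n]]
        by eventually_elim (simp add: \<Psi>_def dK_def right_diff_distrib)
    qed simp_all
    also have "\<dots> = (\<integral>x. 2 * W s x * H s x * omE n s x \<partial>mu 0 1)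
        + ((\<integral>x. (W s x)\<^sup>2 * K s (x + step n) \<partial>mu 0 1) - (\<integral>x. (W s x)\<^sup>2 * K s x \<partial>mu 0 1)) / step n"
      using iW iK2[of "step n"] iK2[of 0] by simp
    also have "\<dots> = (\<integral>x. 2 * W s x * H s x * omE n s x + ((W s (x - step n))\<^sup>2 * K s x - (W s x)\<^sup>2 * K s x) / step n \<partial>mu 0 1)"
      using iW ih iK2[of 0] by (simp add: sh)
    also have "\<dots> = (\<integral>x. \<Phi> n s x \<partial>mu 0 1)"
      by (simp add: \<Phi>_def algebra_simps)
    finally show ?case .
  qed
qed

text \<open>At almost every time \<open>om\<close> and \<open>w\<close> have continuous
  representatives, so averages of \<open>om\<close> and difference quotients of \<open>W\<close>
  converge pointwise; \<open>k\<close> allows dominated convergence.\<close>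

lemma Phi_lim:
  "AE s in mu 0 T. (\<lambda>n. \<integral>x. \<Phi> n s x \<partial>mu 0 1) \<longlonglongrightarrow> Z s"
proof -
  have ak: "AE t in mu 0 T. integrable (mu 0 1) (k t)" using mup.AE_integrable_fst[OF ik] by simp
  show ?thesis using bom bw ak AE_mu_in
  proof eventually_elim
    case (elim s)
    then have s: "s \<in> {0..T}" and om: "AE x in lborel. \<bar>om s x\<bar> \<le> N s" and wN: "AE x in lborel. \<bar>w s x\<bar> \<le> N s" by auto
    obtain f where f: "continuous_on UNIV f" "AE x in lborel. om s x = f x" using elim by auto
    obtain g where g: "continuous_on UNIV g" "AE x in lborel. w s x = g x" using elim by auto
    have [measurable]: "f \<in> borel_measurable borel" "g \<in> borel_measurable borel"
      using f g by (auto intro: borel_measurable_continuous_onI)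
    obtain A where A: "prim A (w s)" and ae: "AE x in lborel. W s x = A x" using repW[OF s] by blast
    have A': "prim A g" by (rule prim_cong[OF A g(2)]) simp
    have contA: "continuous_on UNIV A" by (rule prim_continuous[OF A])
    show ?case unfolding Z_def
    proof (rule integral_dominated_convergence[where w = "k s"])
      show "AE x in mu 0 1. norm (\<Phi> n s x) \<le> k s x" for n
        using AE_mu_lborel[OF Phi_bound[OF s wN om]] by simp
      \<comment> \<open>One null set for all steps.\<close>
      have aen: "AE x in lborel. \<forall>n. W s (x - step n) = A (x - step n)"
        unfolding AE_all_countable using AE_lborel_translate[OF ae, of "- step n" for n] by simp
      show "AE x in mu 0 1. (\<lambda>n. \<Phi> n s x) \<longlonglongrightarrow> 2 * W s x * H s x * om s x - 2 * W s x * w s x * K s x"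
        using AE_mu_lborel[OF ae] AE_mu_lborel[OF aen] AE_mu_lborel[OF f(2)] AE_mu_lborel[OF g(2)]
      proof eventually_elim
        case (elim x)
        have omE: "omE n s x = integral\<^sup>L (mu x (x + step n)) f / step n" for n
        proof -
          have "integral\<^sup>L (mu x (x + step n)) (om s) = integral\<^sup>L (mu x (x + step n)) f"
            by (rule integral_cong_AE) (use AE_mu_lborel[OF f(2)] in auto)
          then show ?thesis by (simp add: omE_def)
        qed
        have l1: "(\<lambda>n. omE n s x) \<longlonglongrightarrow> f x"
          unfolding omE using averages_tendsto[OF f(1), of "\<lambda>n. x" "\<lambda>n. x + step n" x] step_pos step_lim
          by (simp add: less_imp_le)
        have l2: "(\<lambda>n. integral\<^sup>L (mu (x - step n) x) g / step n) \<longlonglongrightarrow> g x"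
          using averages_tendsto[OF g(1), of "\<lambda>n. x - step n" "\<lambda>n. x" x] step_pos step_lim
          by (simp add: less_imp_le)
        have Ad: "A x - A (x - step n) = integral\<^sup>L (mu (x - step n) x) g" for n
          using primD(3)[OF A', of "x - step n" x] step_pos[of n] by simp
        have "(\<lambda>n. x - step n) \<longlonglongrightarrow> x - 0" by (intro tendsto_intros step_lim)
        then have "(\<lambda>n. A (x - step n)) \<longlonglongrightarrow> A (x - 0)"
          using contA by (intro isCont_tendsto_compose[of _ A]) (auto simp: continuous_on_eq_continuous_at)
        then have l3: "(\<lambda>n. A (x - step n)) \<longlonglongrightarrow> A x" by simp
        have eq: "\<Phi> n s x = 2 * W s x * H s x * omE n s x
            - K s x * (A (x - step n) + A x) * (integral\<^sup>L (mu (x - step n) x) g / step n)" for n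
        proof -
          have "(A (x - step n))\<^sup>2 - (A x)\<^sup>2 = - ((A (x - step n) + A x) * (A x - A (x - step n)))"
            by (simp add: power2_eq_square algebra_simps)
          then show ?thesis unfolding \<Phi>_def using elim(1,2) by (simp add: Ad)
        qed
        have "(\<lambda>n. 2 * W s x * H s x * omE n s x - K s x * (A (x - step n) + A x) * (integral\<^sup>L (mu (x - step n) x) g / step n))
          \<longlonglongrightarrow> 2 * W s x * H s x * f x - K s x * (A x + A x) * g x"
          by (intro tendsto_intros l1 l2 l3)
        then show ?case unfolding eq using elim by (simp add: algebra_simps)
      qed
    qed (use elim(3) in auto)
  qed
qed

lemma Phi_le_k:
  "AE s in mu 0 T. \<bar>\<integral>x. \<Phi> n s x \<partial>mu 0 1\<bar> \<le> (\<integral>x. k s x \<partial>mu 0 1)"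
proof -
  have ak: "AE t in mu 0 T. integrable (mu 0 1) (k t)" using mup.AE_integrable_fst[OF ik] by simp
  show ?thesis using bom bw ak AE_mu_in
  proof eventually_elim
    case (elim s)
    have b: "AE x in mu 0 1. \<bar>\<Phi> n s x\<bar> \<le> k s x"
      by (rule AE_mu_lborel, rule Phi_bound) (use elim in auto)
    have "\<bar>\<integral>x. \<Phi> n s x \<partial>mu 0 1\<bar> \<le> (\<integral>x. \<bar>\<Phi> n s x\<bar> \<partial>mu 0 1)" by (rule integral_abs_bound)
    also have "\<dots> \<le> (\<integral>x. k s x \<partial>mu 0 1)"
      by (rule integral_mono_AE'[OF elim(3)]) (use b in auto)
    finally show ?case .
  qed
qed

lemma Z_m [measurable]: "Z \<in> borel_measurable borel"
  unfolding Z_def by measurable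

text \<open>The majorant of the approximations passes to their limit, outside a null set of times
  common to all \<open>n\<close>.\<close>

lemma iZ: "integrable (mu 0 T) Z"
proof (rule Bochner_Integration.integrable_bound)
  show "integrable (mu 0 T) (\<lambda>s. \<integral>x. k s x \<partial>mu 0 1)" by (rule mup.integrable_fst[OF ik])
  have "AE s in mu 0 T. \<forall>n. \<bar>\<integral>x. \<Phi> n s x \<partial>mu 0 1\<bar> \<le> (\<integral>x. k s x \<partial>mu 0 1)"
    unfolding AE_all_countable using Phi_le_k by blast
  then show "AE s in mu 0 T. norm (Z s) \<le> norm (\<integral>x. k s x \<partial>mu 0 1)"
    using Phi_lim
  proof eventually_elim
    case (elim s)
    have "(\<lambda>n. \<bar>\<integral>x. \<Phi> n s x \<partial>mu 0 1\<bar>) \<longlonglongrightarrow> \<bar>Z s\<bar>" by (intro tendsto_rabs elim)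
    then have "\<bar>Z s\<bar> \<le> (\<integral>x. k s x \<partial>mu 0 1)"
      by (rule LIMSEQ_le_const2) (use elim in auto)
    then show ?case by simp
  qed
qed simp

lemma slice_integrable:
  "AE s in mu 0 T. integrable (mu 0 1) (\<lambda>x. 2 * W s x * H s x * om s x - 2 * W s x * w s x * K s x)
     \<and> integrable (mu 0 1) (\<lambda>x. (W s x)\<^sup>2 * om s x)"
proof -
  have ak: "AE t in mu 0 T. integrable (mu 0 1) (k t)" using mup.AE_integrable_fst[OF ik] by simp
  show ?thesis using ak bom bw AE_mu_in
  proof eventually_elim
    case (elim s)
    have Wb: "AE x in mu 0 1. \<bar>W s x\<bar> \<le> B" by (rule AE_mu_lborel[OF boundW[OF elim(4)]])
    have omb: "AE x in mu 0 1. \<bar>om s x\<bar> \<le> N s" and wb: "AE x in mu 0 1. \<bar>w s x\<bar> \<le> N s"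
      using elim(2,3) by (auto intro: AE_mu_lborel)
    have "integrable (mu 0 1) (\<lambda>x. 2 * W s x * H s x * om s x - 2 * W s x * w s x * K s x)"
    proof (rule Bochner_Integration.integrable_bound[OF elim(1)])
      show "AE x in mu 0 1. norm (2 * W s x * H s x * om s x - 2 * W s x * w s x * K s x) \<le> norm (k s x)"
        using Wb omb wb
      proof eventually_elim
        case (elim x)
        have "\<bar>W s x\<bar> * (\<bar>H s x\<bar> * \<bar>om s x\<bar>) \<le> B * (\<bar>H s x\<bar> * N s)"
          using elim B by (intro mult_mono) auto
        moreover have "\<bar>W s x\<bar> * (\<bar>K s x\<bar> * \<bar>w s x\<bar>) \<le> B * (\<bar>K s x\<bar> * N s)"
          using elim B by (intro mult_mono) auto
        ultimately have "\<bar>2 * W s x * H s x * om s x\<bar> + \<bar>2 * W s x * w s x * K s x\<bar> \<le> k s x"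
          unfolding k_def by (simp add: abs_mult mult_ac)
        then show ?case by simp
      qed
    qed simp
    moreover have "integrable (mu 0 1) (\<lambda>x. (W s x)\<^sup>2 * om s x)"
    proof (rule integrable_mu_bounded)
      show "AE x in mu 0 1. \<bar>(W s x)\<^sup>2 * om s x\<bar> \<le> B\<^sup>2 * N s"
        using Wb omb by eventually_elim
          (auto simp: abs_mult abs_le_square_iff[symmetric] B intro!: mult_mono)
    qed simp
    ultimately show ?case by blast
  qed
qed

text \<open>Formally the rate is the integral of 2 W H om + W^2 K_x, and an integration by parts in
  space turns the last term into -2 W w K. No derivative of \<open>K\<close> is available, so the
  identity is established at a fixed step and the step is sent to 0 on both sides.\<close>

theorem product_rule:
  "AE t in mu 0 T. (\<integral>x. (W t x)\<^sup>2 * om t x \<partial>mu 0 1) = integral\<^sup>L (mu 0 t) Z"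
  using bom AE_mu_in
proof eventually_elim
  case (elim t)
  then have t: "t \<in> {0..T}" and om: "AE x in lborel. \<bar>om t x\<bar> \<le> N t" by auto
  obtain f where f: "continuous_on UNIV f" "AE x in lborel. om t x = f x" using elim by auto
  have [measurable]: "f \<in> borel_measurable borel" using f by (auto intro: borel_measurable_continuous_onI)
  have Wb: "AE x in mu 0 1. \<bar>W t x\<bar> \<le> B" by (rule AE_mu_lborel[OF boundW[OF t]])
  have Wsq: "(W t x)\<^sup>2 \<le> B\<^sup>2" if "\<bar>W t x\<bar> \<le> B" for x using that by (simp add: abs_le_square_iff[symmetric])
  have eq: "(\<integral>x. (W t x)\<^sup>2 * omE n t x \<partial>mu 0 1) = integral\<^sup>L (mu 0 t) (\<lambda>s. \<integral>x. \<Phi> n s x \<partial>mu 0 1)" for n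
  proof -
    have i: "integrable (mu 0 t \<Otimes>\<^sub>M mu 0 1) (\<lambda>(s, x). \<Psi> n s x)"
      by (rule integrable_mu_pair_subset[OF iPsi]) (use t in auto)
    have "(\<integral>x. (W t x)\<^sup>2 * omE n t x \<partial>mu 0 1) = (\<integral>x. (\<integral>s. \<Psi> n s x \<partial>mu 0 t) \<partial>mu 0 1)"
    proof (rule integral_cong_AE)
      show "AE x in mu 0 1. (W t x)\<^sup>2 * omE n t x = (\<integral>s. \<Psi> n s x \<partial>mu 0 t)"
        using AE_mu_lborel[OF W_sq_G[OF t, of n]] AE_mu_lborel[OF omE_eq_G[OF t, of n]]
        by eventually_elim simp
    qed simp_all
    also have "\<dots> = (\<integral>s. (\<integral>x. \<Psi> n s x \<partial>mu 0 1) \<partial>mu 0 t)"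
      by (rule mup.Fubini_integral[OF i])
    also have "\<dots> = integral\<^sup>L (mu 0 t) (\<lambda>s. \<integral>x. \<Phi> n s x \<partial>mu 0 1)"
      by (rule integral_cong_AE) (use AE_mu_subset[OF Psi_integral, of 0 t] t in auto)
    finally show ?thesis .
  qed
  have "(\<lambda>n. \<integral>x. (W t x)\<^sup>2 * omE n t x \<partial>mu 0 1) \<longlonglongrightarrow> (\<integral>x. (W t x)\<^sup>2 * om t x \<partial>mu 0 1)"
  proof (rule integral_dominated_convergence[where w = "\<lambda>x. B\<^sup>2 * N t"])
    show "AE x in mu 0 1. norm ((W t x)\<^sup>2 * omE n t x) \<le> B\<^sup>2 * N t" for n
      using Wb by eventually_elim (auto simp: abs_mult intro!: mult_mono Wsq omE_bound[OF t om])
    show "AE x in mu 0 1. (\<lambda>n. (W t x)\<^sup>2 * omE n t x) \<longlonglongrightarrow> (W t x)\<^sup>2 * om t x"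
      using AE_mu_lborel[OF f(2)]
    proof eventually_elim
      case (elim x)
      have omE: "omE n t x = integral\<^sup>L (mu x (x + step n)) f / step n" for n
      proof -
        have "integral\<^sup>L (mu x (x + step n)) (om t) = integral\<^sup>L (mu x (x + step n)) f"
          by (rule integral_cong_AE) (use AE_mu_lborel[OF f(2)] in auto)
        then show ?thesis by (simp add: omE_def)
      qed
      have "(\<lambda>n. omE n t x) \<longlonglongrightarrow> f x"
        unfolding omE using averages_tendsto[OF f(1), of "\<lambda>n. x" "\<lambda>n. x + step n" x] step_pos step_lim
        by (simp add: less_imp_le)
      then show ?case using elim by (simp add: tendsto_mult)
    qed
  qed simp_all
  moreover have "(\<lambda>n. integral\<^sup>L (mu 0 t) (\<lambda>s. \<integral>x. \<Phi> n s x \<partial>mu 0 1)) \<longlonglongrightarrow> integral\<^sup>L (mu 0 t) Z"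
  proof (rule integral_dominated_convergence[where w = "\<lambda>s. \<integral>x. k s x \<partial>mu 0 1"])
    show "integrable (mu 0 t) (\<lambda>s. \<integral>x. k s x \<partial>mu 0 1)"
      by (rule integrable_mu_subset[OF mup.integrable_fst[OF ik]]) (use t in auto)
    show "AE s in mu 0 t. norm (\<integral>x. \<Phi> n s x \<partial>mu 0 1) \<le> (\<integral>x. k s x \<partial>mu 0 1)" for n
      using AE_mu_subset[OF Phi_le_k, of 0 t n] t by simp
    show "AE s in mu 0 t. (\<lambda>n. \<integral>x. \<Phi> n s x \<partial>mu 0 1) \<longlonglongrightarrow> Z s"
      using AE_mu_subset[OF Phi_lim, of 0 t] t by simp
  qed simp_all
  ultimately show ?case unfolding eq by (rule LIMSEQ_unique)
qed

end

section \<open>Zero sets of antiderivatives\<close>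

lemma integrable_mu_pairI:
  fixes f :: "real \<Rightarrow> real \<Rightarrow> real"
  assumes [measurable]: "case_prod f \<in> borel_measurable (borel \<Otimes>\<^sub>M borel)"
    and i: "AE t in mu a b. integrable (mu c d) (f t)"
    and le: "AE t in mu a b. (\<integral>x. \<bar>f t x\<bar> \<partial>mu c d) \<le> k t" and k: "integrable (mu a b) k"
  shows "integrable (mu a b \<Otimes>\<^sub>M mu c d) (\<lambda>(t, x). f t x)"
proof (rule mup.Fubini_integrable)
  show "integrable (mu a b) (\<lambda>x. \<integral>y. norm (case (x, y) of (t, x) \<Rightarrow> f t x) \<partial>mu c d)"
  proof (rule Bochner_Integration.integrable_bound[OF k])
    show "AE x in mu a b. norm (\<integral>y. norm (case (x, y) of (t, x) \<Rightarrow> f t x) \<partial>mu c d) \<le> norm (k x)"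
      using le by eventually_elim (simp add: abs_of_nonneg)
  qed simp
qed (use i in auto)

lemma integrable_mu_time:
  assumes "integrable (mu a b) f" and "c \<le> d"
  shows "integrable (mu a b \<Otimes>\<^sub>M mu c d) (\<lambda>(t, x). f t :: real)"
proof (rule integrable_mu_pairI)
  have [measurable]: "f \<in> borel_measurable borel" by (rule integrable_mu_meas[OF assms(1)])
  show "case_prod (\<lambda>t x::real. f t) \<in> borel_measurable (borel \<Otimes>\<^sub>M borel)" by measurable
  show "integrable (mu a b) (\<lambda>t. \<bar>f t\<bar> * (d - c))" using assms by simp
qed (use assms in \<open>auto simp: measure_mu\<close>)

text \<open>Averages over short intervals to the right of \<open>x\<close> are nonnegative and
  converge to \<open>f x\<close>.\<close>

lemma continuous_AE_nonneg:
  fixes f :: "real \<Rightarrow> real"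
  assumes f: "continuous_on UNIV f" and ae: "AE x in lborel. 0 \<le> f x"
  shows "0 \<le> f x"
proof -
  have l: "(\<lambda>n. integral\<^sup>L (mu x (x + 1 / real (Suc n))) f / (x + 1 / real (Suc n) - x)) \<longlonglongrightarrow> f x"
  proof (rule averages_tendsto[OF f])
    have "(\<lambda>n. 1 / real (Suc n)) \<longlonglongrightarrow> 0" by (rule lim_1_over_n[THEN LIMSEQ_Suc])
    then show "(\<lambda>n. x + 1 / real (Suc n) - x) \<longlonglongrightarrow> 0" by (simp del: of_nat_Suc)
  qed auto
  show ?thesis
  proof (rule LIMSEQ_le_const[OF l], intro exI allI impI)
    fix n :: nat
    have "0 \<le> integral\<^sup>L (mu x (x + 1 / real (Suc n))) f"
      by (rule integral_nonneg_AE) (use ae in \<open>auto intro: AE_mu_lborel\<close>)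
    then show "0 \<le> integral\<^sup>L (mu x (x + 1 / real (Suc n))) f / (x + 1 / real (Suc n) - x)"
      by (intro divide_nonneg_nonneg) auto
  qed
qed

lemma continuous_AE_zero:
  fixes f :: "real \<Rightarrow> real"
  assumes f: "continuous_on UNIV f" and ae: "AE x in lborel. f x = 0"
  shows "f x = 0"
proof -
  have "0 \<le> f x" by (rule continuous_AE_nonneg[OF f]) (use ae in \<open>auto elim: eventually_mono\<close>)
  moreover have "0 \<le> - f x"
    by (rule continuous_AE_nonneg[where f="\<lambda>x. - f x"])
       (use ae f in \<open>auto elim: eventually_mono intro!: continuous_intros\<close>)
  ultimately show ?thesis by simp
qed

text \<open>The continuous function \<open>A\<close> vanishes everywhere, hence so do all integrals
  of its derivative. This leads from a vanishing primitive back to equal densities.\<close>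

lemma prim_zero:
  assumes A: "prim A a" and z: "AE x in lborel. A x = 0"
  shows "AE x in mu 0 1. a x = 0"
proof (rule AE_zero_of_indefinite)
  show "integrable (mu 0 1) a" by (rule primD(2)[OF A])
  fix x :: real assume "x \<in> {0..1}"
  then show "integral\<^sup>L (mu 0 x) a = 0"
    using primD(3)[OF A, of 0 x] continuous_AE_zero[OF prim_continuous[OF A] z] by simp
qed

lemma prim_frac:
  assumes "prim A a"
  shows "A (frac x) = A x"
  using periodic_of_int[of A "frac x" "\<lfloor>x\<rfloor>"] primD(1)[OF assms] by (simp add: frac_def)

text \<open>A value differs from the mean over a period by at most the integral of the modulus of
  the derivative. The signed form is meant for densities, whose mean is the mass.\<close>

lemma prim_bound:
  assumes A: "prim A a"
  shows "\<bar>A x\<bar> \<le> (\<integral>y. \<bar>A y\<bar> \<partial>mu 0 1) + (\<integral>y. \<bar>a y\<bar> \<partial>mu 0 1)"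
    and "A x \<le> (\<integral>y. A y \<partial>mu 0 1) + (\<integral>y. \<bar>a y\<bar> \<partial>mu 0 1)"
proof -
  have cont: "continuous_on {0..1} A" by (rule prim_continuous[OF A])
  then have "bounded (A ` {0..1})" by (intro compact_imp_bounded compact_continuous_image) auto
  then obtain C where C: "\<And>x. x \<in> {0..1} \<Longrightarrow> \<bar>A x\<bar> \<le> C" unfolding bounded_iff by force
  have iA: "integrable (mu 0 1) A"
  proof (rule integrable_mu_bounded[where B=C])
    show "AE x in mu 0 1. \<bar>A x\<bar> \<le> C" using AE_mu_in by eventually_elim (rule C)
  qed (rule prim_measurable[OF A])
  have fr: "frac x \<in> {0..1}" using frac_lt_1[of x] frac_ge_0[of x] by (simp add: less_imp_le)
  let ?I = "\<integral>y. \<bar>a y\<bar> \<partial>mu 0 1"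
  have d: "AE y in mu 0 1. \<bar>A x - A y\<bar> \<le> ?I"
    using AE_mu_in
  proof eventually_elim
    case (elim y)
    show ?case using prim_oscillation[OF A elim fr] prim_frac[OF A, of x] by simp
  qed
  have "A x = (\<integral>y. A x \<partial>mu 0 1)" by (simp add: measure_mu)
  also have "\<dots> \<le> (\<integral>y. A y + ?I \<partial>mu 0 1)"
    by (rule integral_mono_AE) (use iA d in \<open>auto elim: eventually_mono\<close>)
  also have "\<dots> = (\<integral>y. A y \<partial>mu 0 1) + ?I" using iA by (simp add: measure_mu)
  finally show "A x \<le> (\<integral>y. A y \<partial>mu 0 1) + ?I" .
  have "\<bar>A x\<bar> = (\<integral>y. \<bar>A x\<bar> \<partial>mu 0 1)" by (simp add: measure_mu)
  also have "\<dots> \<le> (\<integral>y. \<bar>A y\<bar> + ?I \<partial>mu 0 1)"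
    by (rule integral_mono_AE) (use iA d in \<open>auto elim: eventually_mono\<close>)
  also have "\<dots> = (\<integral>y. \<bar>A y\<bar> \<partial>mu 0 1) + ?I" using iA by (simp add: measure_mu)
  finally show "\<bar>A x\<bar> \<le> (\<integral>y. \<bar>A y\<bar> \<partial>mu 0 1) + ?I" .
qed

text \<open>With \<open>p = 1/(A + \<delta>)\<close> one has \<open>p' = - a/(A + \<delta>)\<^sup>2\<close>, hence
  \<open>\<integral> \<delta>\<^sup>2 a/(A + \<delta>)\<^sup>2 = O(\<delta>)\<close>, while the factor \<open>\<delta>\<^sup>2/(A + \<delta>)\<^sup>2\<close> tends to the indicator of \<open>{A = 0}\<close>.\<close>

lemma prim_deriv_zero:
  assumes A: "prim A a" and pos: "\<And>x. 0 \<le> A x"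
  shows "AE x in mu 0 1. A x = 0 \<longrightarrow> a x = 0"
proof -
  have ia: "integrable (mu 0 1) a" by (rule primD(2)[OF A])
  have [measurable]: "a \<in> borel_measurable borel" by (rule integrable_mu_meas[OF ia])
  have [measurable]: "A \<in> borel_measurable borel" by (rule prim_measurable[OF A])
  have key: "\<bar>integral\<^sup>L (mu 0 x) (\<lambda>y. \<delta>\<^sup>2 * a y / (A y + \<delta>)\<^sup>2)\<bar> \<le> 2 * \<delta>" if d: "0 < \<delta>" and x: "x \<in> {0..1}" for \<delta> x
  proof -
    define f where "f y = - a y / (A y + \<delta>)\<^sup>2" for y
    have [measurable]: "f \<in> borel_measurable borel" unfolding f_def by measurable
    have Ad: "A y + \<delta> > 0" "A y + \<delta> \<ge> \<delta>" for y using pos[of y] d by auto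
    have i_f: "integrable (mu 0 1) f"
    proof (rule Bochner_Integration.integrable_bound)
      show "integrable (mu 0 1) (\<lambda>y. a y / \<delta>\<^sup>2)" using ia by simp
      show "AE y in mu 0 1. norm (f y) \<le> norm (a y / \<delta>\<^sup>2)"
      proof (rule AE_I2)
        fix y
        have "\<bar>a y\<bar> / (A y + \<delta>)\<^sup>2 \<le> \<bar>a y\<bar> / \<delta>\<^sup>2"
          using Ad[of y] d by (intro divide_left_mono power_mono mult_pos_pos zero_less_power) auto
        then show "norm (f y) \<le> norm (a y / \<delta>\<^sup>2)" by (simp add: f_def)
      qed
    qed simp
    \<comment> \<open>\<open>p\<close> is introduced as a primitive and identified with 1/(A +
      \<delta>) afterwards: the defect \<open>D\<close> solves a homogeneous linear integral
      equation, so Gronwall forces it to vanish.\<close>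
    define p where "p y = 1 / (A 0 + \<delta>) + integral\<^sup>L (mu 0 y) f" for y
    have [measurable]: "p \<in> borel_measurable borel" unfolding p_def by measurable
    define D where "D y = (A y + \<delta>) * p y - 1" for y
    have [measurable]: "D \<in> borel_measurable borel" unfolding D_def by measurable
    have contp: "continuous_on {0..1} p" unfolding p_def
      by (intro continuous_intros continuous_indefinite_mu i_f)
    have D_eq: "D y = (\<integral>z. a z / (A z + \<delta>) * D z \<partial>mu 0 y)" if y: "y \<in> {0..1}" for y
    proof -
      have Ay: "A 0 + \<delta> + integral\<^sup>L (mu 0 z) a = A z + \<delta>" if "z \<ge> 0" for z
        using primD(3)[OF A that] by simp
      have "(A 0 + \<delta> + integral\<^sup>L (mu 0 y) a) * (1 / (A 0 + \<delta>) + integral\<^sup>L (mu 0 y) f)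
        = (A 0 + \<delta>) * (1 / (A 0 + \<delta>)) + (\<integral>z. a z * (1 / (A 0 + \<delta>) + integral\<^sup>L (mu 0 z) f)
          + (A 0 + \<delta> + integral\<^sup>L (mu 0 z) a) * f z \<partial>mu 0 y)"
        by (rule integral_by_parts_mu(2)) (use y integrable_mu_subset[OF ia] integrable_mu_subset[OF i_f] in auto)
      also have "(\<integral>z. a z * (1 / (A 0 + \<delta>) + integral\<^sup>L (mu 0 z) f)
          + (A 0 + \<delta> + integral\<^sup>L (mu 0 z) a) * f z \<partial>mu 0 y) = (\<integral>z. a z / (A z + \<delta>) * D z \<partial>mu 0 y)"
      proof (rule integral_cong_AE)
        show "AE z in mu 0 y. a z * (1 / (A 0 + \<delta>) + integral\<^sup>L (mu 0 z) f)
          + (A 0 + \<delta> + integral\<^sup>L (mu 0 z) a) * f z = a z / (A z + \<delta>) * D z"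
          using AE_mu_in
        proof eventually_elim
          case (elim z)
          have "a z * p z + (A z + \<delta>) * f z = a z / (A z + \<delta>) * D z"
          proof -
            have "(A z + \<delta>) * f z = - (a z / (A z + \<delta>))"
              using Ad(1)[of z] by (simp add: f_def power2_eq_square)
            moreover have "a z / (A z + \<delta>) * D z = a z * p z - a z / (A z + \<delta>)"
              using Ad(1)[of z] by (simp add: D_def right_diff_distrib)
            ultimately show ?thesis by simp
          qed
          moreover have "0 \<le> z" using elim by simp
          ultimately show ?case by (simp only: Ay p_def)
        qed
      qed simp_all
      finally have "(A y + \<delta>) * p y = (A 0 + \<delta>) * (1 / (A 0 + \<delta>)) + (\<integral>z. a z / (A z + \<delta>) * D z \<partial>mu 0 y)"
        using y by (simp only: Ay p_def atLeastAtMost_iff)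
      then show ?thesis using Ad(1)[of 0] unfolding D_def[of y] by simp
    qed
    have "continuous_on {0..1} D" unfolding D_def
      by (intro continuous_intros contp prim_continuous[OF A])
    then have "bounded (D ` {0..1})" by (intro compact_imp_bounded compact_continuous_image) auto
    then obtain C where C: "\<And>x. x \<in> {0..1} \<Longrightarrow> \<bar>D x\<bar> \<le> C" unfolding bounded_iff by force
    have D_le: "\<bar>D y\<bar> \<le> (\<integral>z. \<bar>a z\<bar> / \<delta> * \<bar>D z\<bar> \<partial>mu 0 y)" if y: "y \<in> {0..1}" for y
    proof -
      have i: "integrable (mu 0 y) (\<lambda>z. \<bar>a z\<bar> / \<delta> * \<bar>D z\<bar>)"
      proof (rule Bochner_Integration.integrable_bound)
        show "integrable (mu 0 y) (\<lambda>z. \<bar>a z\<bar> / \<delta> * C)" using integrable_mu_subset[OF ia, of 0 y] y by simp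
        show "AE z in mu 0 y. norm (\<bar>a z\<bar> / \<delta> * \<bar>D z\<bar>) \<le> norm (\<bar>a z\<bar> / \<delta> * C)"
          using AE_mu_in
        proof eventually_elim
          case (elim z)
          then have "\<bar>D z\<bar> \<le> \<bar>C\<bar>" using C[of z] y by fastforce
          then show ?case using d by (simp add: abs_mult mult_left_mono divide_right_mono)
        qed
      qed simp
      have "\<bar>D y\<bar> \<le> (\<integral>z. \<bar>a z / (A z + \<delta>) * D z\<bar> \<partial>mu 0 y)"
        unfolding D_eq[OF y] by (rule integral_abs_bound)
      also have "\<dots> \<le> (\<integral>z. \<bar>a z\<bar> / \<delta> * \<bar>D z\<bar> \<partial>mu 0 y)"
      proof (rule integral_mono_AE'[OF i])
        show "AE z in mu 0 y. \<bar>a z / (A z + \<delta>) * D z\<bar> \<le> \<bar>a z\<bar> / \<delta> * \<bar>D z\<bar>"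
          using Ad d by (auto simp: abs_mult abs_divide intro!: AE_I2 mult_right_mono divide_left_mono)
      qed (use d in simp)
      finally show ?thesis .
    qed
    have "AE y in mu 0 1. \<bar>D y\<bar> = 0"
    proof (rule gronwall_zero[where \<theta> = "\<lambda>z. \<bar>a z\<bar> / \<delta>" and B = C])
      show "AE t in mu 0 1. \<bar>D t\<bar> \<le> C" using AE_mu_in by eventually_elim (rule C)
      show "AE t in mu 0 1. \<bar>D t\<bar> \<le> (\<integral>z. \<bar>a z\<bar> / \<delta> * \<bar>D z\<bar> \<partial>mu 0 t)"
        using AE_mu_in by eventually_elim (rule D_le)
    qed (use ia d in auto)
    then have D0: "AE y in mu 0 1. D y = 0" by simp
    have Dx: "D y = 0" if y: "y \<in> {0..1}" for y
    proof -
      have "(\<integral>z. a z / (A z + \<delta>) * D z \<partial>mu 0 y) = 0"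
        by (rule integral_eq_zero_AE) (use AE_mu_subset[OF D0, of 0 y] y in auto)
      then show ?thesis using D_eq[OF y] by simp
    qed
    have px: "p y = 1 / (A y + \<delta>)" if y: "y \<in> {0..1}" for y
      using Dx[OF y] Ad(1)[of y] by (simp add: D_def field_simps)
    have pb: "0 \<le> p y \<and> p y \<le> 1 / \<delta>" if y: "y \<in> {0..1}" for y
      using px[OF y] Ad[of y] d by (simp add: frac_le)
    have "integral\<^sup>L (mu 0 x) (\<lambda>y. \<delta>\<^sup>2 * a y / (A y + \<delta>)\<^sup>2) = integral\<^sup>L (mu 0 x) (\<lambda>y. - \<delta>\<^sup>2 * f y)"
      by (simp add: f_def)
    also have "\<dots> = - \<delta>\<^sup>2 * (p x - p 0)" by (simp add: p_def)
    finally have "\<bar>integral\<^sup>L (mu 0 x) (\<lambda>y. \<delta>\<^sup>2 * a y / (A y + \<delta>)\<^sup>2)\<bar> = \<delta>\<^sup>2 * \<bar>p x - p 0\<bar>"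
      by (simp add: abs_mult)
    also have "\<dots> \<le> \<delta>\<^sup>2 * (2 / \<delta>)"
      using pb[OF x] pb[of 0] by (intro mult_left_mono) auto
    also have "\<dots> = 2 * \<delta>" using d by (simp add: power2_eq_square)
    finally show ?thesis .
  qed
  define h where "h x = (if A x = 0 then a x else 0)" for x
  have [measurable]: "h \<in> borel_measurable borel" unfolding h_def by measurable
  have ih: "integrable (mu 0 1) h"
    by (rule Bochner_Integration.integrable_bound[OF ia]) (auto simp: h_def)
  have "AE x in mu 0 1. h x = 0"
  proof (rule AE_zero_of_indefinite[OF ih])
    fix x :: real assume x: "x \<in> {0..1}"
    define e where "e n = 1 / real (Suc n)" for n
    have e: "e n > 0" for n by (simp add: e_def)
    have elim0: "e \<longlonglongrightarrow> 0" unfolding e_def by (rule lim_1_over_n[THEN LIMSEQ_Suc])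
    have "(\<lambda>n. integral\<^sup>L (mu 0 x) (\<lambda>y. (e n)\<^sup>2 * a y / (A y + e n)\<^sup>2)) \<longlonglongrightarrow> integral\<^sup>L (mu 0 x) h"
    proof (rule integral_dominated_convergence[where w = "\<lambda>y. \<bar>a y\<bar>"])
      show "AE y in mu 0 x. (\<lambda>n. (e n)\<^sup>2 * a y / (A y + e n)\<^sup>2) \<longlonglongrightarrow> h y"
      proof (rule AE_I2)
        fix y
        show "(\<lambda>n. (e n)\<^sup>2 * a y / (A y + e n)\<^sup>2) \<longlonglongrightarrow> h y"
        proof (cases "A y = 0")
          case True
          have ne: "e n \<noteq> 0" for n using e[of n] by simp
          show ?thesis using True by (simp add: h_def ne)
        next
          case False
          have "(\<lambda>n. (e n)\<^sup>2 * a y / (A y + e n)\<^sup>2) \<longlonglongrightarrow> 0\<^sup>2 * a y / (A y + 0)\<^sup>2"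
            by (intro tendsto_intros elim0) (use False in auto)
          then show ?thesis using False by (simp add: h_def)
        qed
      qed
      show "AE y in mu 0 x. norm ((e n)\<^sup>2 * a y / (A y + e n)\<^sup>2) \<le> \<bar>a y\<bar>" for n
      proof (rule AE_I2)
        fix y
        have "(e n)\<^sup>2 \<le> (A y + e n)\<^sup>2" using pos[of y] e[of n] by (intro power_mono) auto
        moreover have "0 < (A y + e n)\<^sup>2" using pos[of y] e[of n] by (intro zero_less_power) auto
        ultimately have "(e n)\<^sup>2 / (A y + e n)\<^sup>2 \<le> 1" by simp
        then have "(e n)\<^sup>2 / (A y + e n)\<^sup>2 * \<bar>a y\<bar> \<le> 1 * \<bar>a y\<bar>" by (rule mult_right_mono) simp
        then show "norm ((e n)\<^sup>2 * a y / (A y + e n)\<^sup>2) \<le> \<bar>a y\<bar>" by (simp add: abs_mult)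
      qed
    qed (use integrable_mu_subset[OF ia, of 0 x] x in auto)
    moreover have "(\<lambda>n. integral\<^sup>L (mu 0 x) (\<lambda>y. (e n)\<^sup>2 * a y / (A y + e n)\<^sup>2)) \<longlonglongrightarrow> 0"
    proof (rule Lim_null_comparison)
      show "\<forall>\<^sub>F n in sequentially. norm (integral\<^sup>L (mu 0 x) (\<lambda>y. (e n)\<^sup>2 * a y / (A y + e n)\<^sup>2)) \<le> 2 * e n"
        using key[OF e x] by simp
      show "(\<lambda>n. 2 * e n) \<longlonglongrightarrow> 0" using tendsto_mult_right_zero[OF elim0, of 2] by simp
    qed
    ultimately show "integral\<^sup>L (mu 0 x) h = 0" by (rule LIMSEQ_unique)
  qed
  then show ?thesis by eventually_elim (auto simp: h_def)
qed

text \<open>Used for the exact derivative of a product of three factors.\<close>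

lemma prim_mult:
  assumes A: "prim A a" and B: "prim B b"
  shows "prim (\<lambda>x. A x * B x) (\<lambda>x. a x * B x + A x * b x)"
proof -
  have [measurable]: "a \<in> borel_measurable borel" "b \<in> borel_measurable borel"
    using primD(2)[OF A, of 0 1] primD(2)[OF B, of 0 1] by (auto intro: integrable_mu_meas)
  have [measurable]: "A \<in> borel_measurable borel" "B \<in> borel_measurable borel"
    using A B by (auto intro: prim_measurable)
  have "integrable (mu x y) (\<lambda>x. a x * B x + A x * b x) \<and>
      A y * B y = A x * B x + integral\<^sup>L (mu x y) (\<lambda>x. a x * B x + A x * b x)" if xy: "x \<le> y" for x y
  proof -
    note p = integral_by_parts_mu[OF primD(2)[OF A, of x y] primD(2)[OF B, of x y] xy, where c = "A x" and d = "B x"]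
    have ae: "AE z in mu x y. a z * (B x + integral\<^sup>L (mu x z) b) + (A x + integral\<^sup>L (mu x z) a) * b z
        = a z * B z + A z * b z"
      using AE_mu_in
    proof eventually_elim
      case (elim z)
      then show ?case using primD(3)[OF A, of x z] primD(3)[OF B, of x z] by simp
    qed
    have "integral\<^sup>L (mu x y) (\<lambda>z. a z * (B x + integral\<^sup>L (mu x z) b) + (A x + integral\<^sup>L (mu x z) a) * b z)
      = integral\<^sup>L (mu x y) (\<lambda>x. a x * B x + A x * b x)"
      by (rule integral_cong_AE[OF _ _ ae]) auto
    then show ?thesis
      using p primD(3)[OF A xy] primD(3)[OF B xy] integrable_cong_AE[OF _ _ ae] by simp
  qed
  then show ?thesis unfolding prim_def using primD(1)[OF A] primD(1)[OF B] by simp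
qed

section \<open>Finite energy solutions\<close>

lemma weighted_am_gm:
  fixes y s a :: real
  assumes "0 < a" "0 < s"
  shows "\<bar>y\<bar> \<le> a / 2 * (y\<^sup>2 / s) + s / (2 * a)"
proof -
  have "0 \<le> (a * \<bar>y\<bar> - s)\<^sup>2 / (2 * a * s)" using assms by simp
  also have "\<dots> = a / 2 * (y\<^sup>2 / s) + s / (2 * a) - \<bar>y\<bar>"
    using assms by (simp add: power2_diff power_mult_distrib field_simps) (simp add: power2_eq_square field_simps)
  finally show ?thesis by simp
qed

text \<open>Optimising the parameter recovers the Cauchy-Schwarz inequality. The choice
  \<open>a = M / X\<close> turns the second term into \<open>X / 2\<close> and avoids a division by
  \<open>E\<close>, which may be zero.\<close>

lemma square_le_of_am_gm:
  fixes X M E :: real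
  assumes X: "0 \<le> X" and M: "0 < M" and E: "0 \<le> E" and am: "\<And>a. 0 < a \<Longrightarrow> X \<le> a / 2 * E + M / (2 * a)"
  shows "X\<^sup>2 \<le> M * E"
proof (cases "X = 0")
  case True
  then show ?thesis using M E by simp
next
  case False
  then have X: "0 < X" using X by simp
  define q where "q = M * E / X"
  have "M / X / 2 * E + M / (2 * (M / X)) = q / 2 + X / 2"
    unfolding q_def using M X by (simp add: field_simps)
  moreover have "X \<le> M / X / 2 * E + M / (2 * (M / X))" by (rule am) (use M X in simp)
  ultimately have "X \<le> q" by linarith
  then have "X \<le> M * E / X" by (simp add: q_def)
  then show ?thesis using X by (simp add: power2_eq_square field_simps)
qed

text \<open>The assumptions range over all indices, also beyond \<open>m\<close>, where the fields
  are later extended by zero; this spares most lemmas a range condition. The quotient in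
  \<open>energy_c\<close> is 0 where the density vanishes, so there it says nothing about the
  gradient.\<close>

locale energy_state =
  fixes m :: nat and lam T beta :: real
    and b :: "nat \<Rightarrow> real \<Rightarrow> real \<Rightarrow> real" and \<Gamma> :: "nat \<Rightarrow> nat \<Rightarrow> real \<Rightarrow> real \<Rightarrow> real"
    and r g :: "nat \<Rightarrow> real \<Rightarrow> real \<Rightarrow> real" and mass :: "nat \<Rightarrow> real"
  assumes lam: "0 < lam" and T: "0 \<le> T"
    and b_m [measurable]: "\<And>c. case_prod (b c) \<in> borel_measurable (borel \<Otimes>\<^sub>M borel)"
    and G_m [measurable]: "\<And>i j. case_prod (\<Gamma> i j) \<in> borel_measurable (borel \<Otimes>\<^sub>M borel)"
    and r_m [measurable]: "\<And>c. case_prod (r c) \<in> borel_measurable (borel \<Otimes>\<^sub>M borel)"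
    and g_m [measurable]: "\<And>c. case_prod (g c) \<in> borel_measurable (borel \<Otimes>\<^sub>M borel)"
    and b_per: "\<And>c t x. b c t (x + 1) = b c t x" and G_per: "\<And>i j t x. \<Gamma> i j t (x + 1) = \<Gamma> i j t x"
    and r_per: "\<And>c t x. r c t (x + 1) = r c t x" and g_per: "\<And>c t x. g c t (x + 1) = g c t x"
    and b_bound: "\<And>c t x. t \<in> {0..T} \<Longrightarrow> \<bar>b c t x\<bar> \<le> beta"
    and G_bound: "\<And>i j t x. t \<in> {0..T} \<Longrightarrow> \<bar>\<Gamma> i j t x\<bar> \<le> beta"
    and skew: "\<And>i j t x. \<Gamma> i j t x = - \<Gamma> j i t x"
    and r_nonneg: "\<And>c t x. t \<in> {0..T} \<Longrightarrow> 0 \<le> r c t x"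
    and r_int: "\<And>c t. t \<in> {0..T} \<Longrightarrow> integrable (mu 0 1) (r c t)"
    and r_mass: "\<And>c t. t \<in> {0..T} \<Longrightarrow> (\<integral>x. r c t x \<partial>mu 0 1) = mass c"
    and g_int: "\<And>c. integrable (mu 0 T \<Otimes>\<^sub>M mu 0 1) (\<lambda>(t, x). g c t x)"
    and slice: "\<And>c. AE t in mu 0 T. \<exists>A. prim A (g c t) \<and> (AE x in lborel. r c t x = A x)"
    and energy: "integrable (mu 0 T \<Otimes>\<^sub>M mu 0 1) (\<lambda>(t, x). (\<Sum>c<m. g c t x)\<^sup>2 / (lam + (\<Sum>c<m. r c t x)))"
    and energy_c: "\<And>c. integrable (mu 0 T \<Otimes>\<^sub>M mu 0 1) (\<lambda>(t, x). (g c t x)\<^sup>2 / ((lam + (\<Sum>c<m. r c t x)) * r c t x))"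
    and r_le: "\<And>c t x. t \<in> {0..T} \<Longrightarrow> r c t x \<le> (\<Sum>j<m. r j t x)"
begin

definition tot :: "real \<Rightarrow> real \<Rightarrow> real" where "tot t x = (\<Sum>c<m. r c t x)"
definition gt :: "real \<Rightarrow> real \<Rightarrow> real" where "gt t x = (\<Sum>c<m. g c t x)"
text \<open>Component \<open>c\<close> of D(rho) applied to the gradients.\<close>

definition J :: "nat \<Rightarrow> real \<Rightarrow> real \<Rightarrow> real" where
  "J c t x = (lam * g c t x + r c t x * gt t x) / (lam + tot t x)"
text \<open>Component \<open>c\<close> of A(rho) applied to b - Gamma rho / lam, in the form that
  remains after skew-symmetry has removed the double sum.\<close>

definition F :: "nat \<Rightarrow> real \<Rightarrow> real \<Rightarrow> real" where
  "F c t x = r c t x * (lam * b c t x + (\<Sum>k<m. (b k t x - \<Gamma> c k t x) * r k t x)) / (lam + tot t x)"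
definition flux :: "nat \<Rightarrow> real \<Rightarrow> real \<Rightarrow> real" where "flux c t x = J c t x / 2 - F c t x"
definition drift :: "real \<Rightarrow> real \<Rightarrow> real" where "drift t x = (\<Sum>c<m. b c t x * r c t x)"
text \<open>A bound for \<open>lam + tot\<close> depending on time only: the mean over the torus
  plus the variation in space.\<close>

definition nb :: "real \<Rightarrow> real" where "nb t = lam + (\<Sum>c<m. mass c) + (\<integral>x. \<bar>gt t x\<bar> \<partial>mu 0 1)"

lemma tot_m [measurable]: "case_prod tot \<in> borel_measurable (borel \<Otimes>\<^sub>M borel)" unfolding tot_def by measurable
lemma gt_m [measurable]: "case_prod gt \<in> borel_measurable (borel \<Otimes>\<^sub>M borel)" unfolding gt_def by measurable
lemma J_m [measurable]: "case_prod (J c) \<in> borel_measurable (borel \<Otimes>\<^sub>M borel)" unfolding J_def by measurable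
lemma F_m [measurable]: "case_prod (F c) \<in> borel_measurable (borel \<Otimes>\<^sub>M borel)" unfolding F_def by measurable
lemma flux_m [measurable]: "case_prod (flux c) \<in> borel_measurable (borel \<Otimes>\<^sub>M borel)" unfolding flux_def by measurable
lemma drift_m [measurable]: "case_prod drift \<in> borel_measurable (borel \<Otimes>\<^sub>M borel)" unfolding drift_def by measurable
lemma nb_m [measurable]: "nb \<in> borel_measurable borel" unfolding nb_def by measurable

lemma flux_per: "flux c t (x + 1) = flux c t x"
  by (simp add: flux_def J_def F_def tot_def gt_def r_per g_per b_per G_per)

lemma tot_per: "tot t (x + 1) = tot t x" by (simp add: tot_def r_per)
lemma gt_per: "gt t (x + 1) = gt t x" by (simp add: gt_def g_per)
lemma drift_per: "drift t (x + 1) = drift t x" by (simp add: drift_def r_per b_per)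

section \<open>Time slices and a bound for the total density that is square integrable in
  time\<close>

lemma tot_nonneg: "t \<in> {0..T} \<Longrightarrow> 0 \<le> tot t x"
  unfolding tot_def by (intro sum_nonneg r_nonneg)

lemma mass_nonneg: "0 \<le> mass c"
proof -
  have "0 \<le> (\<integral>x. r c 0 x \<partial>mu 0 1)" by (rule integral_nonneg_AE) (use r_nonneg[of 0] T in auto)
  then show ?thesis using r_mass[of 0 c] T by simp
qed

lemma tot_int: "t \<in> {0..T} \<Longrightarrow> integrable (mu 0 1) (tot t)"
  unfolding tot_def using r_int by simp

lemma tot_mass: "t \<in> {0..T} \<Longrightarrow> (\<integral>x. tot t x \<partial>mu 0 1) = (\<Sum>c<m. mass c)"
  unfolding tot_def using r_int by (simp add: r_mass)

lemma gt_int: "integrable (mu 0 T \<Otimes>\<^sub>M mu 0 1) (\<lambda>(t, x). gt t x)"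
  using g_int unfolding gt_def by (simp add: case_prod_unfold)

lemma gt_int_slice: "AE t in mu 0 T. integrable (mu 0 1) (gt t)"
  using mup.AE_integrable_fst[OF gt_int] by simp

lemma slice_all: "AE t in mu 0 T. \<forall>c. \<exists>A. prim A (g c t) \<and> (AE x in lborel. r c t x = A x)"
  unfolding AE_all_countable using slice by blast

lemma slice_tot: "AE t in mu 0 T. \<exists>A. prim A (gt t) \<and> (AE x in lborel. tot t x = A x)"
  using slice_all
proof eventually_elim
  case (elim t)
  then obtain A where A: "\<And>c. prim (A c) (g c t)" "\<And>c. AE x in lborel. r c t x = A c x" by metis
  have "AE x in lborel. \<forall>c. r c t x = A c x" unfolding AE_all_countable using A by blast
  then have "AE x in lborel. tot t x = (\<Sum>c<m. A c x)" by eventually_elim (simp add: tot_def)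
  moreover have "prim (\<lambda>x. \<Sum>c<m. A c x) (gt t)" unfolding gt_def by (rule prim_sum) (auto intro: A)
  ultimately show ?case by blast
qed

lemma tot_bound: "AE t in mu 0 T. AE x in lborel. lam + tot t x \<le> nb t"
  using slice_tot AE_mu_in
proof eventually_elim
  case (elim t)
  then obtain A where A: "prim A (gt t)" and ae: "AE x in lborel. tot t x = A x" by blast
  have "(\<integral>x. A x \<partial>mu 0 1) = (\<integral>x. tot t x \<partial>mu 0 1)"
  proof (rule integral_cong_AE)
    show "AE x in mu 0 1. A x = tot t x" using AE_mu_lborel[OF ae] by eventually_elim simp
  qed (use prim_measurable[OF A] in simp_all)
  then have m: "(\<integral>x. A x \<partial>mu 0 1) = (\<Sum>c<m. mass c)" using tot_mass elim by simp
  show ?case using ae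
  proof eventually_elim
    case (elim x)
    then show ?case using prim_bound(2)[OF A, of x] m by (simp add: nb_def)
  qed
qed

lemma nb_nonneg: "0 \<le> nb t"
proof -
  have "0 \<le> (\<Sum>c<m. mass c)" "0 \<le> (\<integral>x. \<bar>gt t x\<bar> \<partial>mu 0 1)" by (auto intro: sum_nonneg mass_nonneg)
  then show ?thesis using lam by (simp add: nb_def)
qed

text \<open>Cauchy--Schwarz in the form \<open>(\<integral>\<bar>gt\<bar>)\<^sup>2 \<le> (\<integral>gt\<^sup>2/(lam + tot)) (\<integral>lam + tot)\<close>.\<close>

lemma nb_sq_int: "integrable (mu 0 T) (\<lambda>t. (nb t)\<^sup>2)"
proof (rule Bochner_Integration.integrable_bound)
  let ?M = "lam + (\<Sum>c<m. mass c)"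
  let ?E = "\<lambda>t. \<integral>x. (gt t x)\<^sup>2 / (lam + tot t x) \<partial>mu 0 1"
  have M: "0 < ?M" using lam sum_nonneg[of "{..<m}" mass] mass_nonneg by (simp add: add_pos_nonneg)
  have en: "integrable (mu 0 T \<Otimes>\<^sub>M mu 0 1) (\<lambda>(t, x). (gt t x)\<^sup>2 / (lam + tot t x))"
    using energy by (simp add: gt_def tot_def)
  show "integrable (mu 0 T) (\<lambda>t. 2 * ?M\<^sup>2 + 2 * (?M * ?E t))"
    using mup.integrable_fst[OF en] by simp
  show "AE t in mu 0 T. norm ((nb t)\<^sup>2) \<le> norm (2 * ?M\<^sup>2 + 2 * (?M * ?E t))"
    using gt_int_slice mup.AE_integrable_fst[OF en] AE_mu_in
  proof eventually_elim
    case (elim t)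
    define X where "X = (\<integral>x. \<bar>gt t x\<bar> \<partial>mu 0 1)"
    have X0: "0 \<le> X" by (simp add: X_def)
    have pos: "0 < lam + tot t x" for x using lam tot_nonneg[OF elim(3), of x] by simp
    have E0: "0 \<le> ?E t"
    proof (rule integral_nonneg_AE, rule AE_I2)
      show "0 \<le> (gt t x)\<^sup>2 / (lam + tot t x)" for x using pos[of x] by simp
    qed
    have am: "X \<le> a / 2 * ?E t + ?M / (2 * a)" if a: "0 < a" for a
    proof -
      define q where "q x = (gt t x)\<^sup>2 / (lam + tot t x)" for x
      have iq: "integrable (mu 0 1) q" unfolding q_def using elim(2) by simp
      have i: "integrable (mu 0 1) (\<lambda>x. a / 2 * ((gt t x)\<^sup>2 / (lam + tot t x)) + (lam + tot t x) / (2 * a))"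
        unfolding q_def[symmetric] using iq tot_int[OF elim(3)] by simp
      have "X \<le> (\<integral>x. a / 2 * ((gt t x)\<^sup>2 / (lam + tot t x)) + (lam + tot t x) / (2 * a) \<partial>mu 0 1)"
        unfolding X_def
      proof (rule integral_mono[OF integrable_abs[OF elim(1)] i])
        show "\<bar>gt t x\<bar> \<le> a / 2 * ((gt t x)\<^sup>2 / (lam + tot t x)) + (lam + tot t x) / (2 * a)" for x
          by (rule weighted_am_gm[OF a pos])
      qed
      also have "\<dots> = a / 2 * ?E t + ?M / (2 * a)"
        unfolding q_def[symmetric] using iq tot_int[OF elim(3)] by (simp add: tot_mass[OF elim(3)] measure_mu)
      finally show ?thesis .
    qed
    have "X\<^sup>2 \<le> ?M * ?E t" by (rule square_le_of_am_gm[OF X0 M E0 am])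
    moreover have "(nb t)\<^sup>2 \<le> 2 * ?M\<^sup>2 + 2 * X\<^sup>2"
    proof -
      have "nb t = ?M + X" by (simp add: nb_def X_def)
      moreover have "0 \<le> (?M - X)\<^sup>2" by simp
      ultimately show ?thesis by (simp add: power2_sum power2_diff)
    qed
    ultimately have "(nb t)\<^sup>2 \<le> 2 * ?M\<^sup>2 + 2 * (?M * ?E t)" by simp
    then show ?case by simp
  qed
qed simp

text \<open>A nonnegative absolutely continuous function has zero derivative almost everywhere on
  its zero set. This supplies the information that the energy, with its quotient 0 at vacuum, does
  not contain.\<close>

lemma g_zero: "AE t in mu 0 T. AE x in mu 0 1. \<forall>c. r c t x = 0 \<longrightarrow> g c t x = 0"
  using slice_all AE_mu_in
proof eventually_elim
  case (elim t)
  show ?case unfolding AE_all_countable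
  proof
    fix c
    obtain A where A: "prim A (g c t)" and ae: "AE x in lborel. r c t x = A x" using elim by blast
    have "AE x in lborel. 0 \<le> A x" using ae by eventually_elim (use r_nonneg elim in metis)
    then have "0 \<le> A x" for x by (rule continuous_AE_nonneg[OF prim_continuous[OF A]])
    then have "AE x in mu 0 1. A x = 0 \<longrightarrow> g c t x = 0" by (rule prim_deriv_zero[OF A])
    then show "AE x in mu 0 1. r c t x = 0 \<longrightarrow> g c t x = 0"
      using AE_mu_lborel[OF ae] by eventually_elim auto
  qed
qed

lemma r_over: "t \<in> {0..T} \<Longrightarrow> r c t x / (lam + tot t x) \<le> 1"
  using r_le[of t c x] lam tot_nonneg[of t x] unfolding tot_def by (simp add: divide_le_eq)

text \<open>The field multiplying \<open>r c\<close> is at most of the order of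
  \<open>lam + tot\<close>, which cancels the denominator: the drift flux is linear in the
  density.\<close>

lemma F_bound:
  assumes t: "t \<in> {0..T}"
  shows "\<bar>F c t x\<bar> \<le> 2 * beta * r c t x"
    and "\<bar>lam * b c t x + (\<Sum>k<m. (b k t x - \<Gamma> c k t x) * r k t x)\<bar> \<le> 2 * beta * (lam + tot t x)"
proof -
  have beta: "0 \<le> beta" using b_bound[OF t, of 0 0] by simp
  have "\<bar>lam * b c t x + (\<Sum>k<m. (b k t x - \<Gamma> c k t x) * r k t x)\<bar>
      \<le> \<bar>lam * b c t x\<bar> + (\<Sum>k<m. \<bar>(b k t x - \<Gamma> c k t x) * r k t x\<bar>)"
    by (rule order_trans[OF abs_triangle_ineq add_left_mono[OF sum_abs]])
  also have "\<dots> \<le> lam * (2 * beta) + (\<Sum>k<m. 2 * beta * r k t x)"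
  proof (intro add_mono sum_mono)
    show "\<bar>lam * b c t x\<bar> \<le> lam * (2 * beta)"
      using b_bound[OF t, of c x] lam beta by (simp add: abs_mult)
    fix k
    have "\<bar>b k t x - \<Gamma> c k t x\<bar> \<le> 2 * beta" using b_bound[OF t, of k x] G_bound[OF t, of c k x] by linarith
    then show "\<bar>(b k t x - \<Gamma> c k t x) * r k t x\<bar> \<le> 2 * beta * r k t x"
      using r_nonneg[OF t, of k x] by (simp add: abs_mult mult_right_mono)
  qed
  also have "\<dots> = 2 * beta * (lam + tot t x)"
    by (simp add: tot_def sum_distrib_left distrib_left mult_ac)
  finally show le: "\<bar>lam * b c t x + (\<Sum>k<m. (b k t x - \<Gamma> c k t x) * r k t x)\<bar> \<le> 2 * beta * (lam + tot t x)" .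
  have pos: "0 < lam + tot t x" using lam tot_nonneg[OF t, of x] by simp
  have "r c t x * \<bar>lam * b c t x + (\<Sum>k<m. (b k t x - \<Gamma> c k t x) * r k t x)\<bar>
      \<le> r c t x * (2 * beta * (lam + tot t x))"
    by (rule mult_left_mono[OF le r_nonneg[OF t]])
  then show "\<bar>F c t x\<bar> \<le> 2 * beta * r c t x"
    unfolding F_def abs_divide abs_mult using pos r_nonneg[OF t, of c x]
    by (simp only: abs_of_nonneg abs_of_pos pos_divide_le_eq mult_ac)
qed

lemma drift_bound: "t \<in> {0..T} \<Longrightarrow> \<bar>drift t x\<bar> \<le> beta * tot t x"
  unfolding drift_def tot_def sum_distrib_left
  by (rule order_trans[OF sum_abs sum_mono]) (auto simp: abs_mult r_nonneg intro!: mult_right_mono b_bound)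

text \<open>Each column of D sums to 1, and skew-symmetry cancels \<open>\<Gamma>\<close> after
  summation over the colours.\<close>

lemma flux_sum:
  assumes t: "t \<in> {0..T}"
  shows "(\<Sum>c<m. flux c t x) = gt t x / 2 - drift t x"
proof -
  have pos: "lam + tot t x \<noteq> 0" using lam tot_nonneg[OF t, of x] by simp
  have "(\<Sum>c<m. J c t x) = (lam * gt t x + tot t x * gt t x) / (lam + tot t x)"
    unfolding J_def by (simp add: sum_divide_distrib[symmetric] sum.distrib sum_distrib_left[symmetric]
      sum_distrib_right[symmetric] gt_def[symmetric] tot_def[symmetric])
  then have J: "(\<Sum>c<m. J c t x) = gt t x" using pos by (simp add: distrib_right[symmetric])
  have S0: "(\<Sum>i<m. \<Sum>k<m. r i t x * (\<Gamma> i k t x * r k t x)) = 0" (is "?S = 0")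
  proof -
    have "?S = (\<Sum>k<m. \<Sum>i<m. r i t x * (\<Gamma> i k t x * r k t x))" by (rule sum.swap)
    also have "\<dots> = (\<Sum>k<m. \<Sum>i<m. - (r k t x * (\<Gamma> k i t x * r i t x)))"
      by (intro sum.cong refl) (subst skew, simp)
    also have "\<dots> = - ?S" by (simp add: sum_negf)
    finally show ?thesis by simp
  qed
  have "(\<Sum>c<m. r c t x * (lam * b c t x + (\<Sum>k<m. (b k t x - \<Gamma> c k t x) * r k t x)))
     = (\<Sum>c<m. lam * (b c t x * r c t x) + r c t x * drift t x - (\<Sum>k<m. r c t x * (\<Gamma> c k t x * r k t x)))"
    by (intro sum.cong refl) (simp add: drift_def left_diff_distrib sum_subtractf sum_distrib_left algebra_simps)
  also have "\<dots> = lam * drift t x + tot t x * drift t x"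
    using S0 by (simp add: sum.distrib sum_subtractf sum_distrib_left[symmetric] sum_distrib_right[symmetric] drift_def[symmetric] tot_def[symmetric])
  finally have "(\<Sum>c<m. F c t x) = drift t x"
    unfolding F_def using pos by (simp add: sum_divide_distrib[symmetric] distrib_right[symmetric])
  then show ?thesis unfolding flux_def using J by (simp add: sum_subtractf sum_divide_distrib[symmetric])
qed

section \<open>Integrability of the flux against weights that are square integrable in time\<close>

lemma weighted_gt_int:
  assumes N: "integrable (mu 0 T) (\<lambda>t. (N t)\<^sup>2)" and [measurable]: "N \<in> borel_measurable borel"
  shows "integrable (mu 0 T \<Otimes>\<^sub>M mu 0 1) (\<lambda>(t, x). N t * gt t x)"
proof (rule integrable_mu_pairI)
  show "AE t in mu 0 T. integrable (mu 0 1) (\<lambda>x. N t * gt t x)"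
    using gt_int_slice by eventually_elim simp
  show "integrable (mu 0 T) (\<lambda>t. ((N t)\<^sup>2 + (nb t)\<^sup>2) / 2)" using N nb_sq_int by simp
  show "AE t in mu 0 T. (\<integral>x. \<bar>N t * gt t x\<bar> \<partial>mu 0 1) \<le> ((N t)\<^sup>2 + (nb t)\<^sup>2) / 2"
  proof (rule AE_I2)
    fix t
    have "(\<integral>x. \<bar>N t * gt t x\<bar> \<partial>mu 0 1) = \<bar>N t\<bar> * (\<integral>x. \<bar>gt t x\<bar> \<partial>mu 0 1)" by (simp add: abs_mult)
    also have "\<dots> \<le> \<bar>N t\<bar> * nb t"
      unfolding nb_def using lam sum_nonneg[of "{..<m}" mass] mass_nonneg by (intro mult_left_mono) auto
    also have "\<dots> \<le> ((N t)\<^sup>2 + (nb t)\<^sup>2) / 2"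
      using sum_squares_bound[of "\<bar>N t\<bar>" "nb t"] by simp
    finally show "(\<integral>x. \<bar>N t * gt t x\<bar> \<partial>mu 0 1) \<le> ((N t)\<^sup>2 + (nb t)\<^sup>2) / 2" .
  qed
qed measurable

lemma weighted_r_int:
  assumes N: "integrable (mu 0 T) N"
  shows "integrable (mu 0 T \<Otimes>\<^sub>M mu 0 1) (\<lambda>(t, x). N t * r c t x)"
proof (rule integrable_mu_pairI)
  have [measurable]: "N \<in> borel_measurable borel" by (rule integrable_mu_meas[OF N])
  show "case_prod (\<lambda>t x. N t * r c t x) \<in> borel_measurable (borel \<Otimes>\<^sub>M borel)" by measurable
  show "AE t in mu 0 T. integrable (mu 0 1) (\<lambda>x. N t * r c t x)"
    using AE_mu_in by eventually_elim (simp add: r_int)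
  show "integrable (mu 0 T) (\<lambda>t. \<bar>N t\<bar> * mass c)" using N by simp
  show "AE t in mu 0 T. (\<integral>x. \<bar>N t * r c t x\<bar> \<partial>mu 0 1) \<le> \<bar>N t\<bar> * mass c"
    using AE_mu_in
  proof eventually_elim
    case (elim t)
    have "(\<integral>x. \<bar>N t * r c t x\<bar> \<partial>mu 0 1) = (\<integral>x. \<bar>N t\<bar> * r c t x \<partial>mu 0 1)"
      using r_nonneg[OF elim] by (simp add: abs_mult)
    then show ?case using r_mass[OF elim] by simp
  qed
qed

text \<open>By \<open>r c \<le> lam + tot\<close> the square of \<open>g c / (lam + tot)\<close> is
  at most the energy density of colour \<open>c\<close>. The total gradient has a space integral of
  its modulus that is square integrable in time. Both can be paired with a weight whose square is
  integrable.\<close>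

lemma weighted_flux_int:
  assumes N: "integrable (mu 0 T) (\<lambda>t. (N t)\<^sup>2)" and Nm [measurable]: "N \<in> borel_measurable borel"
  shows "integrable (mu 0 T \<Otimes>\<^sub>M mu 0 1) (\<lambda>(t, x). N t * flux c t x)"
proof (rule Bochner_Integration.integrable_bound)
  have N1: "integrable (mu 0 T) N"
  proof (rule Bochner_Integration.integrable_bound)
    show "integrable (mu 0 T) (\<lambda>t. 1 + (N t)\<^sup>2)" using N by simp
    show "AE t in mu 0 T. norm (N t) \<le> norm (1 + (N t)\<^sup>2)"
    proof (rule AE_I2)
      fix t show "norm (N t) \<le> norm (1 + (N t)\<^sup>2)"
        using sum_squares_bound[of 1 "\<bar>N t\<bar>"] by simp
    qed
  qed simp
  define E where "E t x = (g c t x)\<^sup>2 / ((lam + tot t x) * r c t x)" for t x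
  have [measurable]: "case_prod E \<in> borel_measurable (borel \<Otimes>\<^sub>M borel)" unfolding E_def by measurable
  define M where "M t x = lam * ((N t)\<^sup>2 + E t x) + \<bar>N t * gt t x\<bar> + 2 * beta * \<bar>N t * r c t x\<bar>" for t x
  have M_m [measurable]: "case_prod M \<in> borel_measurable (borel \<Otimes>\<^sub>M borel)" unfolding M_def by measurable
  have iE: "integrable (mu 0 T \<Otimes>\<^sub>M mu 0 1) (\<lambda>(t, x). E t x)"
    using energy_c[of c] by (simp add: tot_def E_def)
  show "integrable (mu 0 T \<Otimes>\<^sub>M mu 0 1) (\<lambda>(t, x). M t x)"
    using iE integrable_mu_time[OF N, of 0 1] integrable_abs[OF weighted_gt_int[OF N Nm]] integrable_abs[OF weighted_r_int[OF N1, of c]]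
    unfolding M_def by (simp add: case_prod_unfold)
  have "AE p in mu 0 T \<Otimes>\<^sub>M mu 0 1. \<bar>N (fst p) * flux c (fst p) (snd p)\<bar> \<le> M (fst p) (snd p)"
  proof (rule AE_mu_pairI)
    show "AE t in mu 0 T. AE x in mu 0 1. \<bar>N t * flux c t x\<bar> \<le> M t x"
      using g_zero AE_mu_in
    proof eventually_elim
      case (elim t)
      note t = elim(2)
      show ?case using elim(1)
      proof eventually_elim
        case (elim x)
        have pos: "0 < lam + tot t x" using lam tot_nonneg[OF t, of x] by simp
        have r0: "0 \<le> r c t x" by (rule r_nonneg[OF t])
        \<comment> \<open>Where the density vanishes, \<open>E\<close> is 0 as a quotient by zero,
          and the left side is 0 because the gradient vanishes too.\<close>
        have E: "(g c t x / (lam + tot t x))\<^sup>2 \<le> E t x"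
        proof (cases "r c t x = 0")
          case True
          then show ?thesis using elim by (simp add: E_def)
        next
          case False
          then have rp: "0 < r c t x" using r0 by simp
          have "r c t x \<le> lam + tot t x" using r_le[OF t, of c x] lam by (simp add: tot_def)
          then have "(g c t x)\<^sup>2 / ((lam + tot t x) * (lam + tot t x)) \<le> E t x"
            unfolding E_def using pos rp by (intro divide_left_mono mult_left_mono mult_pos_pos) auto
          then show ?thesis by (simp add: power_divide power2_eq_square)
        qed
        have J: "\<bar>J c t x\<bar> \<le> lam * \<bar>g c t x / (lam + tot t x)\<bar> + \<bar>gt t x\<bar>"
        proof -
          have "J c t x = lam * (g c t x / (lam + tot t x)) + r c t x / (lam + tot t x) * gt t x"
            by (simp add: J_def add_divide_distrib)
          also have "\<bar>\<dots>\<bar> \<le> \<bar>lam * (g c t x / (lam + tot t x))\<bar> + \<bar>r c t x / (lam + tot t x) * gt t x\<bar>"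
            by (rule abs_triangle_ineq)
          also have "\<dots> \<le> lam * \<bar>g c t x / (lam + tot t x)\<bar> + 1 * \<bar>gt t x\<bar>"
            unfolding abs_mult using lam r_over[OF t, of c x] r0 pos
            by (intro add_mono mult_right_mono) auto
          finally show ?thesis by simp
        qed
        have "\<bar>flux c t x\<bar> \<le> \<bar>J c t x\<bar> + \<bar>F c t x\<bar>" unfolding flux_def by linarith
        also have "\<dots> \<le> lam * \<bar>g c t x / (lam + tot t x)\<bar> + \<bar>gt t x\<bar> + 2 * beta * r c t x"
          using J F_bound(1)[OF t, of c x] by linarith
        finally have "\<bar>N t\<bar> * \<bar>flux c t x\<bar> \<le> \<bar>N t\<bar> * (lam * \<bar>g c t x / (lam + tot t x)\<bar> + \<bar>gt t x\<bar> + 2 * beta * r c t x)"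
          by (rule mult_left_mono) simp
        also have "\<dots> = lam * (\<bar>N t\<bar> * \<bar>g c t x / (lam + tot t x)\<bar>) + \<bar>N t * gt t x\<bar> + 2 * beta * \<bar>N t * r c t x\<bar>"
          using r0 by (simp add: abs_mult algebra_simps)
        also have "\<dots> \<le> M t x"
        proof -
          have "\<bar>N t\<bar> * \<bar>g c t x / (lam + tot t x)\<bar> \<le> (N t)\<^sup>2 + (g c t x / (lam + tot t x))\<^sup>2"
          proof -
            have "2 * \<bar>N t\<bar> * \<bar>g c t x / (lam + tot t x)\<bar> \<le> (N t)\<^sup>2 + (g c t x / (lam + tot t x))\<^sup>2"
              using sum_squares_bound[of "\<bar>N t\<bar>" "\<bar>g c t x / (lam + tot t x)\<bar>"] by (simp only: power2_abs)
            moreover have "0 \<le> \<bar>N t\<bar> * \<bar>g c t x / (lam + tot t x)\<bar>" by simp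
            ultimately show ?thesis by linarith
          qed
          then have "\<bar>N t\<bar> * \<bar>g c t x / (lam + tot t x)\<bar> \<le> (N t)\<^sup>2 + E t x" using E by linarith
          then have "lam * (\<bar>N t\<bar> * \<bar>g c t x / (lam + tot t x)\<bar>) \<le> lam * ((N t)\<^sup>2 + E t x)"
            using lam by (intro mult_left_mono) auto
          then show ?thesis unfolding M_def by linarith
        qed
        finally show ?case by (simp add: abs_mult)
      qed
    qed
    show "Measurable.pred (borel \<Otimes>\<^sub>M borel) (\<lambda>p. \<bar>N (fst p) * flux c (fst p) (snd p)\<bar> \<le> M (fst p) (snd p))"
      unfolding pred_def by (intro borel_measurable_le) measurable
  qed
  then show "AE p in mu 0 T \<Otimes>\<^sub>M mu 0 1. norm (case p of (t, x) \<Rightarrow> N t * flux c t x) \<le> norm (case p of (t, x) \<Rightarrow> M t x)"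
    by eventually_elim (simp add: case_prod_unfold)
qed simp

lemma flux_int: "integrable (mu 0 T \<Otimes>\<^sub>M mu 0 1) (\<lambda>(t, x). flux c t x)"
  using weighted_flux_int[of "\<lambda>_. 1"] by simp

lemma flux_time: "AE x in lborel. \<forall>c. integrable (mu 0 T) (\<lambda>s. flux c s x)"
  unfolding AE_all_countable
proof
  fix c
  show "AE x in lborel. integrable (mu 0 T) (\<lambda>s. flux c s x)"
    by (rule AE_periodic) (use mup.AE_integrable_snd[OF flux_int] in \<open>auto simp: flux_per\<close>)
qed

end

text \<open>The conservation law in integrated form: the time integral of the flux is a space
  primitive of the increment of the density, so that no derivative of the flux occurs.\<close>

locale energy_solution = energy_state +
  assumes weak: "\<And>c t. t \<in> {0..T} \<Longrightarrow> \<exists>A. prim A (\<lambda>x. r c t x - r c 0 x) \<and>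
    (AE x in lborel. integral\<^sup>L (mu 0 t) (\<lambda>s. flux c s x) = A x)"

section \<open>The pointwise energy estimate\<close>

text \<open>The integral of the modulus of the flux controls the mean of the primitive, and the
  integral of the modulus of \<open>w\<close> controls its variation. Neither bound depends on
  \<open>t\<close>.\<close>

lemma primitive_bounded:
  fixes H :: "real \<Rightarrow> real \<Rightarrow> real" and w :: "real \<Rightarrow> real"
  assumes [measurable]: "case_prod H \<in> borel_measurable (borel \<Otimes>\<^sub>M borel)"
    and iH: "integrable (mu 0 T \<Otimes>\<^sub>M mu 0 1) (\<lambda>(t, x). H t x)"
    and t: "t \<in> {0..T}" and A: "prim A w"
    and WA: "AE x in lborel. integral\<^sup>L (mu 0 t) (\<lambda>s. H s x) = A x"
    and M: "(\<integral>x. \<bar>w x\<bar> \<partial>mu 0 1) \<le> M"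
  shows "AE x in lborel. \<bar>integral\<^sup>L (mu 0 t) (\<lambda>s. H s x)\<bar> \<le> (\<integral>x. (\<integral>s. \<bar>H s x\<bar> \<partial>mu 0 T) \<partial>mu 0 1) + M"
proof -
  have [measurable]: "A \<in> borel_measurable borel" by (rule prim_measurable[OF A])
  have iHa: "integrable (mu 0 T \<Otimes>\<^sub>M mu 0 1) (\<lambda>(t, x). \<bar>H t x\<bar>)"
    using integrable_abs[OF iH] by (simp add: case_prod_unfold)
  have le: "AE x in mu 0 1. \<bar>A x\<bar> \<le> (\<integral>s. \<bar>H s x\<bar> \<partial>mu 0 T)"
    using AE_mu_lborel[OF WA] mup.AE_integrable_snd[OF iH]
  proof eventually_elim
    case (elim x)
    then show ?case using abs_indefinite_mu_le[of 0 T "\<lambda>s. H s x" t] t by simp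
  qed
  have "(\<integral>x. \<bar>A x\<bar> \<partial>mu 0 1) \<le> (\<integral>x. (\<integral>s. \<bar>H s x\<bar> \<partial>mu 0 T) \<partial>mu 0 1)"
    by (rule integral_mono_AE'[OF mup.integrable_snd[OF iHa] le]) simp
  then have bd: "\<bar>A x\<bar> \<le> (\<integral>x. (\<integral>s. \<bar>H s x\<bar> \<partial>mu 0 T) \<partial>mu 0 1) + M" for x
    using prim_bound(1)[OF A, of x] M by linarith
  show ?thesis using WA by eventually_elim (simp add: bd)
qed

lemma two_mult_le:
  fixes X Y \<tau> :: real
  assumes "0 < \<tau>"
  shows "2 * X * Y \<le> X\<^sup>2 / \<tau> + \<tau> * Y\<^sup>2"
proof -
  have "0 \<le> (X - \<tau> * Y)\<^sup>2 / \<tau>" using assms by simp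
  also have "\<dots> = X\<^sup>2 / \<tau> + \<tau> * Y\<^sup>2 - 2 * X * Y"
    using assms by (simp add: power2_diff power_mult_distrib field_simps) (simp add: power2_eq_square)
  finally show ?thesis by simp
qed

text \<open>Young's inequality spends the dissipation, lam times the sum \<open>S\<close> of the
  squares of the \<open>w c\<close>, in quarters: one on the terms with \<open>u c * wt\<close>, one
  on the drift terms of the colours, one on the drift term of the total; one is left. The terms in
  \<open>wt\<^sup>2\<close> add up to \<open>\<kappa> * wt\<^sup>2\<close> and cancel against the
  total dissipation. The resulting rate is linear in \<open>N\<close>, hence integrable in time
  later.\<close>

lemma energy_pointwise:
  fixes w W u gu Ju dF :: "nat \<Rightarrow> real" and lam beta R R' q om N bw drift :: real and m :: nat
  assumes m: "1 \<le> m" and lam: "0 < lam" and om: "lam \<le> om" "om \<le> N" and N: "1 \<le> N"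
  defines "\<sigma> \<equiv> \<Sum>c<m. \<bar>w c\<bar>" and "wt \<equiv> \<Sum>c<m. w c" and "Wt \<equiv> \<Sum>c<m. W c"
  defines "\<kappa> \<equiv> real m * R\<^sup>2 / lam + real m"
  assumes u: "\<And>c. c < m \<Longrightarrow> \<bar>u c\<bar> \<le> R" and gu: "\<And>c. c < m \<Longrightarrow> \<bar>gu c\<bar> \<le> R" and Ju: "\<And>c. c < m \<Longrightarrow> \<bar>Ju c\<bar> \<le> R'"
    and dF: "\<And>c. c < m \<Longrightarrow> \<bar>dF c\<bar> \<le> om * q * \<sigma>" and drift: "\<bar>drift\<bar> \<le> beta * om" and bw: "\<bar>bw\<bar> \<le> beta * \<sigma>"
  shows "(\<Sum>c<m. - lam * (w c)\<^sup>2 - w c * u c * wt - W c * gu c * wt - W c * wt * Ju c - 2 * W c * dF c + 2 * W c * w c * drift)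
      + \<kappa> * (- wt\<^sup>2 - 2 * Wt * bw)
    \<le> ((R + R')\<^sup>2 / lam + 4 * (real m)\<^sup>2 * (q + beta)\<^sup>2 / lam + 4 * real m * \<kappa> * beta\<^sup>2 / lam) * N
        * ((\<Sum>c<m. (W c)\<^sup>2 * om) + \<kappa> * Wt\<^sup>2)"
proof -
  have m0: "0 < real m" using m by simp
  have sig0: "0 \<le> \<sigma>" unfolding \<sigma>_def by (simp add: sum_nonneg)
  define S where "S = (\<Sum>c<m. (w c)\<^sup>2)"
  have sq: "\<sigma>\<^sup>2 \<le> real m * S"
    using sum_squared_le_sum_of_squares[of "\<lambda>c. \<bar>w c\<bar>" "{..<m}"] unfolding \<sigma>_def S_def by (simp add: mult.commute)
  have wsig: "\<bar>w c\<bar> \<le> \<sigma>" if "c < m" for c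
    unfolding \<sigma>_def using that by (intro member_le_sum[of c _ "\<lambda>c. \<bar>w c\<bar>"]) auto
  have om0: "0 < om" using om lam by simp
  \<comment> \<open>\<open>gu c\<close> and \<open>Ju c\<close> multiply the same product
    \<open>W c * wt\<close>, so their bounds are added.\<close>
  define Q where "Q = R + R'"
  \<comment> \<open>Chosen so that \<open>m\<close> copies of
    \<open>\<tau> * \<sigma>\<^sup>2\<close>, with \<open>\<sigma>\<^sup>2 \<le> m * S\<close>, use
    up a quarter of the dissipation.\<close>
  define \<tau> where "\<tau> = lam / (4 * (real m)\<^sup>2)"
  have tau: "0 < \<tau>" using lam m0 by (simp add: \<tau>_def)
  define z where "z c = - lam * (w c)\<^sup>2 - w c * u c * wt - W c * gu c * wt - W c * wt * Ju c - 2 * W c * dF c + 2 * W c * w c * drift" for c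
  have zc: "z c \<le> - (3/4 * lam) * (w c)\<^sup>2 + (R\<^sup>2 / lam + 1) * wt\<^sup>2 + Q\<^sup>2 * (W c)\<^sup>2
      + (W c * om * (q + beta))\<^sup>2 / \<tau> + \<tau> * \<sigma>\<^sup>2" if c: "c < m" for c
  proof -
    have R0: "0 \<le> R" using u[OF c] by simp
    have Q0: "0 \<le> Q" using u[OF c] Ju[OF c] by (simp add: Q_def)
    have 1: "- (w c * u c * wt) \<le> lam / 4 * (w c)\<^sup>2 + R\<^sup>2 / lam * wt\<^sup>2"
    proof -
      have "- (w c * u c * wt) \<le> \<bar>w c\<bar> * \<bar>u c\<bar> * \<bar>wt\<bar>"
        using abs_ge_minus_self[of "w c * u c * wt"] by (simp only: abs_mult)
      also have "\<dots> \<le> \<bar>w c\<bar> * R * \<bar>wt\<bar>"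
        using u[OF c] by (intro mult_right_mono mult_left_mono) auto
      also have "\<dots> = 2 * (R * \<bar>wt\<bar>) * (\<bar>w c\<bar> / 2)" by simp
      also have "\<dots> \<le> (R * \<bar>wt\<bar>)\<^sup>2 / lam + lam * (\<bar>w c\<bar> / 2)\<^sup>2" by (rule two_mult_le[OF lam])
      also have "\<dots> = lam / 4 * (w c)\<^sup>2 + R\<^sup>2 / lam * wt\<^sup>2"
        by (simp add: power_mult_distrib power_divide)
      finally show ?thesis .
    qed
    have 2: "- (W c * gu c * wt) - W c * wt * Ju c \<le> wt\<^sup>2 + Q\<^sup>2 * (W c)\<^sup>2"
    proof -
      have "- (W c * gu c * wt) - W c * wt * Ju c = - ((gu c + Ju c) * (W c * wt))" by (simp add: algebra_simps)
      also have "\<dots> \<le> \<bar>gu c + Ju c\<bar> * (\<bar>W c\<bar> * \<bar>wt\<bar>)"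
        using abs_ge_minus_self[of "(gu c + Ju c) * (W c * wt)"] by (simp only: abs_mult)
      also have "\<dots> \<le> Q * (\<bar>W c\<bar> * \<bar>wt\<bar>)"
        using gu[OF c] Ju[OF c] by (intro mult_right_mono) (auto simp: Q_def)
      also have "\<dots> \<le> 2 * (Q * \<bar>W c\<bar>) * \<bar>wt\<bar>" using Q0 by simp
      also have "\<dots> \<le> (Q * \<bar>W c\<bar>)\<^sup>2 / 1 + 1 * \<bar>wt\<bar>\<^sup>2" by (rule two_mult_le) simp
      also have "\<dots> = wt\<^sup>2 + Q\<^sup>2 * (W c)\<^sup>2" by (simp add: power_mult_distrib)
      finally show ?thesis .
    qed
    have 3: "- (2 * W c * dF c) + 2 * W c * w c * drift \<le> (W c * om * (q + beta))\<^sup>2 / \<tau> + \<tau> * \<sigma>\<^sup>2"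
    proof -
      have "\<bar>w c * drift - dF c\<bar> \<le> \<bar>w c\<bar> * \<bar>drift\<bar> + \<bar>dF c\<bar>"
        using abs_triangle_ineq4[of "w c * drift" "dF c"] by (simp only: abs_mult)
      also have "\<dots> \<le> \<sigma> * (beta * om) + om * q * \<sigma>"
        using wsig[OF c] drift dF[OF c] sig0 by (intro add_mono mult_mono) auto
      finally have d: "\<bar>w c * drift - dF c\<bar> \<le> om * (q + beta) * \<sigma>" by (simp add: algebra_simps)
      have "- (2 * W c * dF c) + 2 * W c * w c * drift = 2 * (W c * (w c * drift - dF c))" by (simp add: algebra_simps)
      also have "\<dots> \<le> 2 * (\<bar>W c\<bar> * \<bar>w c * drift - dF c\<bar>)" by (simp only: abs_mult[symmetric])
      also have "\<dots> \<le> 2 * (\<bar>W c\<bar> * (om * (q + beta) * \<sigma>))" using d by (simp add: mult_left_mono)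
      also have "\<dots> = 2 * (\<bar>W c\<bar> * om * (q + beta)) * \<sigma>" by simp
      also have "\<dots> \<le> (\<bar>W c\<bar> * om * (q + beta))\<^sup>2 / \<tau> + \<tau> * \<sigma>\<^sup>2" by (rule two_mult_le[OF tau])
      finally show ?thesis by (simp add: power_mult_distrib)
    qed
    show ?thesis unfolding z_def using 1 2 3 by (simp add: algebra_simps)
  qed
  have "(\<Sum>c<m. z c) \<le> (\<Sum>c<m. - (3/4 * lam) * (w c)\<^sup>2 + (R\<^sup>2 / lam + 1) * wt\<^sup>2 + Q\<^sup>2 * (W c)\<^sup>2
      + (W c * om * (q + beta))\<^sup>2 / \<tau> + \<tau> * \<sigma>\<^sup>2)"
    by (intro sum_mono zc) simp
  also have "\<dots> = - (3/4 * lam) * S + real m * ((R\<^sup>2 / lam + 1) * wt\<^sup>2) + Q\<^sup>2 * (\<Sum>c<m. (W c)\<^sup>2)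
      + (q + beta)\<^sup>2 / \<tau> * (\<Sum>c<m. (W c)\<^sup>2 * om\<^sup>2) + real m * (\<tau> * \<sigma>\<^sup>2)"
    by (simp add: sum.distrib sum_distrib_left S_def power_mult_distrib mult_ac sum_subtractf sum_divide_distrib)
  also have "real m * ((R\<^sup>2 / lam + 1) * wt\<^sup>2) = \<kappa> * wt\<^sup>2" by (simp add: \<kappa>_def algebra_simps)
  also have "real m * (\<tau> * \<sigma>\<^sup>2) \<le> lam / 4 * S"
  proof -
    have "real m * (\<tau> * \<sigma>\<^sup>2) \<le> real m * (\<tau> * (real m * S))" using sq tau m0 by (intro mult_left_mono) auto
    also have "\<dots> = lam / 4 * S" using m0 by (simp add: \<tau>_def power2_eq_square)
    finally show ?thesis .
  qed
  finally have A: "(\<Sum>c<m. z c) \<le> - (3/4 * lam) * S + \<kappa> * wt\<^sup>2 + Q\<^sup>2 * (\<Sum>c<m. (W c)\<^sup>2)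
      + (q + beta)\<^sup>2 / \<tau> * (\<Sum>c<m. (W c)\<^sup>2 * om\<^sup>2) + lam / 4 * S" by simp
  have k0: "0 \<le> \<kappa>" using lam by (simp add: \<kappa>_def)
  have B: "\<kappa> * (- wt\<^sup>2 - 2 * Wt * bw) \<le> - \<kappa> * wt\<^sup>2 + 4 * real m / lam * (\<kappa> * beta * Wt)\<^sup>2 + lam / 4 * S"
  proof -
    \<comment> \<open>Only one such term occurs here instead of one per colour, hence one factor
      \<open>m\<close> less than in \<open>\<tau>\<close>.\<close>
    define \<tau>' where "\<tau>' = lam / (4 * real m)"
    have t': "0 < \<tau>'" using lam m0 by (simp add: \<tau>'_def)
    have "- (Wt * bw) \<le> \<bar>Wt\<bar> * \<bar>bw\<bar>" using abs_ge_minus_self[of "Wt * bw"] by (simp only: abs_mult)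
    also have "\<dots> \<le> \<bar>Wt\<bar> * (beta * \<sigma>)" using bw by (intro mult_left_mono) auto
    finally have "\<kappa> * (2 * (- (Wt * bw))) \<le> \<kappa> * (2 * (\<bar>Wt\<bar> * (beta * \<sigma>)))" using k0 by (intro mult_left_mono) auto
    also have "\<dots> = 2 * (\<kappa> * beta * \<bar>Wt\<bar>) * \<sigma>" by simp
    also have "\<dots> \<le> (\<kappa> * beta * \<bar>Wt\<bar>)\<^sup>2 / \<tau>' + \<tau>' * \<sigma>\<^sup>2" by (rule two_mult_le[OF t'])
    also have "\<tau>' * \<sigma>\<^sup>2 \<le> \<tau>' * (real m * S)" using sq t' by (intro mult_left_mono) auto
    also have "\<tau>' * (real m * S) = lam / 4 * S" using m0 by (simp add: \<tau>'_def)
    also have "(\<kappa> * beta * \<bar>Wt\<bar>)\<^sup>2 / \<tau>' = 4 * real m / lam * (\<kappa> * beta * Wt)\<^sup>2"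
      using lam m0 by (simp add: \<tau>'_def power_mult_distrib)
    finally show ?thesis by (simp add: algebra_simps)
  qed
  have S0: "0 \<le> S" unfolding S_def by (simp add: sum_nonneg)
  define P where "P = (\<Sum>c<m. (W c)\<^sup>2 * om)"
  have P0: "0 \<le> P" unfolding P_def using om0 by (simp add: sum_nonneg)
  have C: "Q\<^sup>2 * (\<Sum>c<m. (W c)\<^sup>2) \<le> Q\<^sup>2 / lam * N * P"
  proof -
    have "(\<Sum>c<m. (W c)\<^sup>2) * lam \<le> P"
      unfolding P_def sum_distrib_right using om by (intro sum_mono mult_left_mono) auto
    then have "(\<Sum>c<m. (W c)\<^sup>2) \<le> P / lam" using lam by (simp add: pos_le_divide_eq)
    also have "\<dots> \<le> P / lam * N" using mult_left_mono[OF N, of "P / lam"] P0 lam by simp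
    finally have "Q\<^sup>2 * (\<Sum>c<m. (W c)\<^sup>2) \<le> Q\<^sup>2 * (P / lam * N)" by (rule mult_left_mono) simp
    then show ?thesis by (simp add: mult_ac)
  qed
  have D: "(q + beta)\<^sup>2 / \<tau> * (\<Sum>c<m. (W c)\<^sup>2 * om\<^sup>2) \<le> 4 * (real m)\<^sup>2 * (q + beta)\<^sup>2 / lam * N * P"
  proof -
    \<comment> \<open>One factor \<open>om\<close> remains in \<open>P\<close> and only the other is
      replaced by \<open>N\<close>.\<close>
    have "(\<Sum>c<m. (W c)\<^sup>2 * om\<^sup>2) = P * om" unfolding P_def sum_distrib_right by (simp add: power2_eq_square mult_ac)
    also have "\<dots> \<le> P * N" using om P0 by (intro mult_left_mono)
    finally have "(q + beta)\<^sup>2 / \<tau> * (\<Sum>c<m. (W c)\<^sup>2 * om\<^sup>2) \<le> (q + beta)\<^sup>2 / \<tau> * (P * N)"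
      using tau by (intro mult_left_mono) auto
    also have "\<dots> = 4 * (real m)\<^sup>2 * (q + beta)\<^sup>2 / lam * N * P" using lam m0 by (simp add: \<tau>_def field_simps)
    finally show ?thesis .
  qed
  have E: "4 * real m / lam * (\<kappa> * beta * Wt)\<^sup>2 \<le> 4 * real m * \<kappa> * beta\<^sup>2 / lam * N * (\<kappa> * Wt\<^sup>2)"
  proof -
    have nn: "0 \<le> 4 * real m * \<kappa> * beta\<^sup>2 / lam * (\<kappa> * Wt\<^sup>2)" using k0 lam by simp
    have "4 * real m / lam * (\<kappa> * beta * Wt)\<^sup>2 = 4 * real m * \<kappa> * beta\<^sup>2 / lam * (\<kappa> * Wt\<^sup>2)"
      by (simp add: power2_eq_square)
    also have "\<dots> \<le> N * (4 * real m * \<kappa> * beta\<^sup>2 / lam * (\<kappa> * Wt\<^sup>2))" using mult_right_mono[OF N nn] by simp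
    finally show ?thesis by (simp add: mult_ac)
  qed
  define c1 c2 c3 where "c1 = Q\<^sup>2 / lam" and "c2 = 4 * (real m)\<^sup>2 * (q + beta)\<^sup>2 / lam" and "c3 = 4 * real m * \<kappa> * beta\<^sup>2 / lam"
  have c: "0 \<le> c1" "0 \<le> c2" "0 \<le> c3" using lam k0 by (auto simp: c1_def c2_def c3_def)
  define V where "V = \<kappa> * Wt\<^sup>2"
  have V0: "0 \<le> V" using k0 by (simp add: V_def)
  have "(\<Sum>c<m. z c) + \<kappa> * (- wt\<^sup>2 - 2 * Wt * bw) \<le> - (lam / 4 * S) + c1 * N * P + c2 * N * P + c3 * N * V"
    using A B C D E unfolding c1_def[symmetric] c2_def[symmetric] c3_def[symmetric] V_def[symmetric] by linarith
  also have "\<dots> \<le> c1 * N * P + c2 * N * P + c3 * N * V" using lam S0 by simp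
  also have "\<dots> \<le> (c1 + c2 + c3) * N * (P + V)"
  proof -
    have "0 \<le> c3 * N * P + c1 * N * V + c2 * N * V" using c N P0 V0 by simp
    then show ?thesis by (simp add: algebra_simps)
  qed
  finally show ?thesis
    unfolding z_def c1_def c2_def c3_def P_def V_def Q_def .
qed

section \<open>The difference of two solutions\<close>

locale two_solutions =
  V: energy_solution m lam T beta b \<Gamma> v gv mass + U: energy_solution m lam T beta b \<Gamma> u gu mass
  for m :: nat and lam T beta :: real and b \<Gamma> v gv u gu and mass :: "nat \<Rightarrow> real" +
  fixes eta R :: real
  assumes m: "1 \<le> m"
    and init: "\<And>c. AE x in lborel. v c 0 x = u c 0 x"
    and b_vanish: "\<And>c t x. t \<in> {0..T} \<Longrightarrow> t \<le> eta \<Longrightarrow> b c t x = 0"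
    and G_vanish: "\<And>i j t x. t \<in> {0..T} \<Longrightarrow> t \<le> eta \<Longrightarrow> \<Gamma> i j t x = 0"
    and u_bound: "AE t in mu 0 T. eta \<le> t \<longrightarrow> (AE x in mu 0 1. \<forall>c. \<bar>u c t x\<bar> \<le> R \<and> \<bar>gu c t x\<bar> \<le> R)"
begin

definition w :: "nat \<Rightarrow> real \<Rightarrow> real \<Rightarrow> real" where "w c t x = v c t x - u c t x"
definition H :: "nat \<Rightarrow> real \<Rightarrow> real \<Rightarrow> real" where "H c t x = V.flux c t x - U.flux c t x"
definition W :: "nat \<Rightarrow> real \<Rightarrow> real \<Rightarrow> real" where "W c t x = integral\<^sup>L (mu 0 t) (\<lambda>s. H c s x)"
definition om :: "real \<Rightarrow> real \<Rightarrow> real" where "om t x = lam + V.tot t x"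
definition K :: "real \<Rightarrow> real \<Rightarrow> real" where "K t x = V.gt t x / 2 - V.drift t x"
text \<open>A single bound for \<open>om\<close>, all \<open>w c\<close> and \<open>wt\<close>;
  being at least 1, it also covers the unit weight of the total estimate.\<close>

definition N :: "real \<Rightarrow> real" where "N t = 1 + V.nb t + U.nb t"
definition wt :: "real \<Rightarrow> real \<Rightarrow> real" where "wt t x = (\<Sum>c<m. w c t x)"
definition Ht :: "real \<Rightarrow> real \<Rightarrow> real" where "Ht t x = (\<Sum>c<m. H c t x)"
definition Wt :: "real \<Rightarrow> real \<Rightarrow> real" where "Wt t x = integral\<^sup>L (mu 0 t) (\<lambda>s. Ht s x)"
text \<open>The bound supplied by \<open>primitive_bounded\<close>; two solutions of equal mass give
  \<open>2 * mass c\<close> for the integral of the modulus of \<open>w c\<close>.\<close>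

definition B :: "nat \<Rightarrow> real" where
  "B c = (\<integral>x. (\<integral>s. \<bar>H c s x\<bar> \<partial>mu 0 T) \<partial>mu 0 1) + 2 * mass c"
definition Bt :: real where
  "Bt = (\<integral>x. (\<integral>s. \<bar>Ht s x\<bar> \<partial>mu 0 T) \<partial>mu 0 1) + (\<Sum>c<m. 2 * mass c)"

lemma w_m [measurable]: "case_prod (w c) \<in> borel_measurable (borel \<Otimes>\<^sub>M borel)" unfolding w_def by measurable
lemma H_m [measurable]: "case_prod (H c) \<in> borel_measurable (borel \<Otimes>\<^sub>M borel)" unfolding H_def by measurable
lemma W_m [measurable]: "case_prod (W c) \<in> borel_measurable (borel \<Otimes>\<^sub>M borel)" unfolding W_def by measurable
lemma om_m [measurable]: "case_prod om \<in> borel_measurable (borel \<Otimes>\<^sub>M borel)" unfolding om_def by measurable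
lemma K_m [measurable]: "case_prod K \<in> borel_measurable (borel \<Otimes>\<^sub>M borel)" unfolding K_def by measurable
lemma N_m [measurable]: "N \<in> borel_measurable borel" unfolding N_def by measurable
lemma wt_m [measurable]: "case_prod wt \<in> borel_measurable (borel \<Otimes>\<^sub>M borel)" unfolding wt_def by measurable
lemma Ht_m [measurable]: "case_prod Ht \<in> borel_measurable (borel \<Otimes>\<^sub>M borel)" unfolding Ht_def by measurable
lemma Wt_m [measurable]: "case_prod Wt \<in> borel_measurable (borel \<Otimes>\<^sub>M borel)" unfolding Wt_def by measurable

section \<open>Integrability and absolutely continuous representatives of the differences\<close>

lemma N1: "1 \<le> N t" unfolding N_def using V.nb_nonneg[of t] U.nb_nonneg[of t] by simp

lemma N_sq_int: "integrable (mu 0 T) (\<lambda>t. (N t)\<^sup>2)"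
proof (rule Bochner_Integration.integrable_bound)
  show "integrable (mu 0 T) (\<lambda>t. 3 * (1 + (V.nb t)\<^sup>2 + (U.nb t)\<^sup>2))" using V.nb_sq_int U.nb_sq_int by simp
  show "AE t in mu 0 T. norm ((N t)\<^sup>2) \<le> norm (3 * (1 + (V.nb t)\<^sup>2 + (U.nb t)\<^sup>2))"
  proof (rule AE_I2)
    fix t
    have "0 \<le> (1 - V.nb t)\<^sup>2 + (1 - U.nb t)\<^sup>2 + (V.nb t - U.nb t)\<^sup>2" by simp
    then have "(N t)\<^sup>2 \<le> 3 * (1 + (V.nb t)\<^sup>2 + (U.nb t)\<^sup>2)"
      unfolding N_def by (simp add: power2_eq_square algebra_simps)
    then show "norm ((N t)\<^sup>2) \<le> norm (3 * (1 + (V.nb t)\<^sup>2 + (U.nb t)\<^sup>2))" by simp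
  qed
qed simp

lemma N_int: "integrable (mu 0 T) N"
proof (rule Bochner_Integration.integrable_bound[OF N_sq_int])
  show "AE t in mu 0 T. norm (N t) \<le> norm ((N t)\<^sup>2)"
  proof (rule AE_I2)
    fix t show "norm (N t) \<le> norm ((N t)\<^sup>2)"
      using N1[of t] mult_right_mono[of 1 "N t" "N t"] by (simp add: power2_eq_square)
  qed
qed simp

lemma H_int: "integrable (mu 0 T \<Otimes>\<^sub>M mu 0 1) (\<lambda>(t, x). H c t x)"
  using V.flux_int[of c] U.flux_int[of c] unfolding H_def by (simp add: case_prod_unfold)

lemma NH_int: "integrable (mu 0 T \<Otimes>\<^sub>M mu 0 1) (\<lambda>(t, x). N t * H c t x)"
  using V.weighted_flux_int[OF N_sq_int N_m, of c] U.weighted_flux_int[OF N_sq_int N_m, of c]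
  unfolding H_def by (simp add: case_prod_unfold right_diff_distrib)

lemma Ht_int: "integrable (mu 0 T \<Otimes>\<^sub>M mu 0 1) (\<lambda>(t, x). Ht t x)"
  using H_int unfolding Ht_def by (simp add: case_prod_unfold)

lemma NHt_int: "integrable (mu 0 T \<Otimes>\<^sub>M mu 0 1) (\<lambda>(t, x). N t * Ht t x)"
  using NH_int unfolding Ht_def by (simp add: case_prod_unfold sum_distrib_left)

lemma K_eq: "t \<in> {0..T} \<Longrightarrow> K t x = (\<Sum>c<m. V.flux c t x)"
  by (simp add: K_def V.flux_sum)

lemma K_int: "integrable (mu 0 T \<Otimes>\<^sub>M mu 0 1) (\<lambda>(t, x). K t x)"
  and NK_int: "integrable (mu 0 T \<Otimes>\<^sub>M mu 0 1) (\<lambda>(t, x). N t * K t x)"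
proof -
  have ae: "AE p in mu 0 T \<Otimes>\<^sub>M mu 0 1. (\<Sum>c<m. V.flux c (fst p) (snd p)) = K (fst p) (snd p)"
  proof (rule AE_mu_pairI)
    show "Measurable.pred (borel \<Otimes>\<^sub>M borel) (\<lambda>p. (\<Sum>c<m. V.flux c (fst p) (snd p)) = K (fst p) (snd p))"
      unfolding pred_def by (intro borel_measurable_eq) measurable
    show "AE t in mu 0 T. AE x in mu 0 1. (\<Sum>c<m. V.flux c t x) = K t x"
      using AE_mu_in by eventually_elim (simp add: K_eq)
  qed
  have "integrable (mu 0 T \<Otimes>\<^sub>M mu 0 1) (\<lambda>p. \<Sum>c<m. V.flux c (fst p) (snd p))"
    using V.flux_int by (simp add: case_prod_unfold)
  then have "integrable (mu 0 T \<Otimes>\<^sub>M mu 0 1) (\<lambda>p. K (fst p) (snd p))"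
    by (rule integrable_cong_AE_imp) (use ae in \<open>simp_all add: eq_commute\<close>)
  then show "integrable (mu 0 T \<Otimes>\<^sub>M mu 0 1) (\<lambda>(t, x). K t x)" by (simp add: case_prod_unfold)
  have "integrable (mu 0 T \<Otimes>\<^sub>M mu 0 1) (\<lambda>p. \<Sum>c<m. N (fst p) * V.flux c (fst p) (snd p))"
    using V.weighted_flux_int[OF N_sq_int N_m] by (simp add: case_prod_unfold)
  then have "integrable (mu 0 T \<Otimes>\<^sub>M mu 0 1) (\<lambda>p. N (fst p) * K (fst p) (snd p))"
  proof (rule integrable_cong_AE_imp)
    show "AE p in mu 0 T \<Otimes>\<^sub>M mu 0 1. (\<Sum>c<m. N (fst p) * V.flux c (fst p) (snd p)) = N (fst p) * K (fst p) (snd p)"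
      using ae by eventually_elim (simp add: sum_distrib_left[symmetric])
  qed simp
  then show "integrable (mu 0 T \<Otimes>\<^sub>M mu 0 1) (\<lambda>(t, x). N t * K t x)" by (simp add: case_prod_unfold)
qed

lemma H_time: "AE x in lborel. \<forall>c. integrable (mu 0 T) (\<lambda>s. H c s x)"
  using V.flux_time U.flux_time by eventually_elim (simp add: H_def)

text \<open>The common initial data cancel, so the difference of the two increments is
  \<open>w c\<close> itself.\<close>

lemma repW:
  assumes t: "t \<in> {0..T}"
  shows "\<exists>A. prim A (w c t) \<and> (AE x in lborel. W c t x = A x)"
proof -
  obtain A1 where A1: "prim A1 (\<lambda>x. v c t x - v c 0 x)" "AE x in lborel. integral\<^sup>L (mu 0 t) (\<lambda>s. V.flux c s x) = A1 x"
    using V.weak[OF t] by blast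
  obtain A2 where A2: "prim A2 (\<lambda>x. u c t x - u c 0 x)" "AE x in lborel. integral\<^sup>L (mu 0 t) (\<lambda>s. U.flux c s x) = A2 x"
    using U.weak[OF t] by blast
  have "prim (\<lambda>x. A1 x - A2 x) (w c t)"
  proof (rule prim_cong[OF prim_diff[OF A1(1) A2(1)]])
    show "AE x in lborel. v c t x - v c 0 x - (u c t x - u c 0 x) = w c t x"
      using init[of c] by eventually_elim (simp add: w_def)
  qed simp
  moreover have "AE x in lborel. W c t x = A1 x - A2 x"
    using A1(2) A2(2) V.flux_time U.flux_time
  proof eventually_elim
    case (elim x)
    have "integrable (mu 0 t) (\<lambda>s. V.flux c s x)" "integrable (mu 0 t) (\<lambda>s. U.flux c s x)"
      using elim(3,4) t integrable_mu_subset[of 0 T "\<lambda>s. V.flux c s x" 0 t]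
        integrable_mu_subset[of 0 T "\<lambda>s. U.flux c s x" 0 t] by auto
    then show ?case using elim(1,2) by (simp add: W_def H_def)
  qed
  ultimately show ?thesis by blast
qed

lemma Wt_sum:
  assumes t: "t \<in> {0..T}"
  shows "AE x in lborel. Wt t x = (\<Sum>c<m. W c t x)"
  using H_time
proof eventually_elim
  case (elim x)
  have "integrable (mu 0 t) (\<lambda>s. H c s x)" for c
    using elim t integrable_mu_subset[of 0 T "\<lambda>s. H c s x" 0 t] by auto
  then show ?case by (simp add: Wt_def W_def Ht_def)
qed

lemma repWt:
  assumes t: "t \<in> {0..T}"
  shows "\<exists>A. prim A (wt t) \<and> (AE x in lborel. Wt t x = A x)"
proof -
  obtain A where A: "\<And>c. prim (A c) (w c t)" "\<And>c. AE x in lborel. W c t x = A c x" using repW[OF t] by metis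
  have ae: "AE x in lborel. \<forall>c. W c t x = A c x" unfolding AE_all_countable using A by blast
  have "AE x in lborel. Wt t x = (\<Sum>c<m. A c x)" using Wt_sum[OF t] ae by eventually_elim simp
  moreover have "prim (\<lambda>x. \<Sum>c<m. A c x) (wt t)"
    using prim_sum[of "{..<m}" A "\<lambda>c. w c t"] A(1) unfolding wt_def by simp
  ultimately show ?thesis by blast
qed

text \<open>Summing the conservation laws of the colours of \<open>v\<close> gives the one for the
  weight.\<close>

lemma repK:
  assumes t: "t \<in> {0..T}"
  shows "\<exists>A. prim A (\<lambda>x. om t x - om 0 x) \<and> (AE x in lborel. integral\<^sup>L (mu 0 t) (\<lambda>s. K s x) = A x)"
proof -
  obtain A where A: "\<And>c. prim (A c) (\<lambda>x. v c t x - v c 0 x)"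
    "\<And>c. AE x in lborel. integral\<^sup>L (mu 0 t) (\<lambda>s. V.flux c s x) = A c x" using V.weak[OF t] by metis
  have ae: "AE x in lborel. \<forall>c. integral\<^sup>L (mu 0 t) (\<lambda>s. V.flux c s x) = A c x"
    unfolding AE_all_countable using A by blast
  have "AE x in lborel. integral\<^sup>L (mu 0 t) (\<lambda>s. K s x) = (\<Sum>c<m. A c x)"
    using ae V.flux_time
  proof eventually_elim
    case (elim x)
    have i: "integrable (mu 0 t) (\<lambda>s. V.flux c s x)" for c
      using elim(2) t integrable_mu_subset[of 0 T "\<lambda>s. V.flux c s x" 0 t] by auto
    have "integral\<^sup>L (mu 0 t) (\<lambda>s. K s x) = integral\<^sup>L (mu 0 t) (\<lambda>s. \<Sum>c<m. V.flux c s x)"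
    proof (rule integral_cong_AE)
      show "AE s in mu 0 t. K s x = (\<Sum>c<m. V.flux c s x)"
        using AE_mu_in
      proof eventually_elim
        case (elim s)
        then show ?case using t by (intro K_eq) auto
      qed
    qed simp_all
    then show ?case using i elim(1) by simp
  qed
  moreover have "prim (\<lambda>x. \<Sum>c<m. A c x) (\<lambda>x. om t x - om 0 x)"
    using prim_sum[of "{..<m}" A "\<lambda>c x. v c t x - v c 0 x"] A(1)
    by (simp add: om_def V.tot_def sum_subtractf)
  ultimately show ?thesis by blast
qed

lemma w_abs_int:
  assumes t: "t \<in> {0..T}"
  shows "integrable (mu 0 1) (w c t)" "(\<integral>x. \<bar>w c t x\<bar> \<partial>mu 0 1) \<le> 2 * mass c"
proof -
  show i: "integrable (mu 0 1) (w c t)" unfolding w_def using V.r_int[OF t] U.r_int[OF t] by simp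
  have "(\<integral>x. \<bar>w c t x\<bar> \<partial>mu 0 1) \<le> (\<integral>x. v c t x + u c t x \<partial>mu 0 1)"
  proof (rule integral_mono)
    show "\<bar>w c t x\<bar> \<le> v c t x + u c t x" for x
      using V.r_nonneg[OF t, of c x] U.r_nonneg[OF t, of c x] by (simp add: w_def)
  qed (use i V.r_int[OF t] U.r_int[OF t] in auto)
  also have "\<dots> = 2 * mass c" using V.r_int[OF t] U.r_int[OF t] V.r_mass[OF t] U.r_mass[OF t] by simp
  finally show "(\<integral>x. \<bar>w c t x\<bar> \<partial>mu 0 1) \<le> 2 * mass c" .
qed

lemma boundW:
  assumes t: "t \<in> {0..T}"
  shows "AE x in lborel. \<bar>W c t x\<bar> \<le> B c"
proof -
  obtain A where A: "prim A (w c t)" "AE x in lborel. W c t x = A x" using repW[OF t] by blast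
  show ?thesis
    using primitive_bounded[OF H_m H_int t A(1) A(2)[unfolded W_def] w_abs_int(2)[OF t]]
    unfolding W_def B_def .
qed

lemma boundWt:
  assumes t: "t \<in> {0..T}"
  shows "AE x in lborel. \<bar>Wt t x\<bar> \<le> Bt"
proof -
  obtain A where A: "prim A (wt t)" "AE x in lborel. Wt t x = A x" using repWt[OF t] by blast
  have "(\<integral>x. \<bar>wt t x\<bar> \<partial>mu 0 1) \<le> (\<integral>x. (\<Sum>c<m. \<bar>w c t x\<bar>) \<partial>mu 0 1)"
    by (rule integral_mono) (use w_abs_int(1)[OF t] in \<open>auto simp: wt_def\<close>)
  also have "\<dots> = (\<Sum>c<m. \<integral>x. \<bar>w c t x\<bar> \<partial>mu 0 1)" using w_abs_int(1)[OF t] by simp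
  also have "\<dots> \<le> (\<Sum>c<m. 2 * mass c)" by (intro sum_mono w_abs_int(2)[OF t])
  finally show ?thesis
    using primitive_bounded[OF Ht_m Ht_int t A(1) A(2)[unfolded Wt_def]] unfolding Wt_def Bt_def by blast
qed

lemma B_nonneg: "0 \<le> B c"
proof -
  have "0 \<le> (\<integral>x. (\<integral>s. \<bar>H c s x\<bar> \<partial>mu 0 T) \<partial>mu 0 1)" by simp
  then show ?thesis unfolding B_def using V.mass_nonneg[of c] by simp
qed

lemma Bt_nonneg: "0 \<le> Bt"
proof -
  have "0 \<le> (\<integral>x. (\<integral>s. \<bar>Ht s x\<bar> \<partial>mu 0 T) \<partial>mu 0 1)" by simp
  then show ?thesis unfolding Bt_def using V.mass_nonneg by (simp add: sum_nonneg)
qed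

lemma om_slice: "AE t in mu 0 T. (AE x in lborel. \<bar>om t x\<bar> \<le> N t) \<and>
    (\<exists>f. continuous_on UNIV f \<and> (AE x in lborel. om t x = f x))"
  using V.tot_bound V.slice_tot AE_mu_in
proof eventually_elim
  case (elim t)
  obtain A where A: "prim A (V.gt t)" "AE x in lborel. V.tot t x = A x" using elim by blast
  have "AE x in lborel. \<bar>om t x\<bar> \<le> N t"
    using elim(1)
  proof eventually_elim
    case (elim x)
    then show ?case using V.tot_nonneg[of t x] V.lam U.nb_nonneg[of t] \<open>t \<in> {0..T}\<close> by (simp add: om_def N_def)
  qed
  moreover have "continuous_on UNIV (\<lambda>x. lam + A x)" by (intro continuous_intros prim_continuous[OF A(1)])
  moreover have "AE x in lborel. om t x = lam + A x" using A(2) by eventually_elim (simp add: om_def)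
  ultimately show ?case by blast
qed

lemma w_slices: "AE t in mu 0 T. \<forall>c. \<exists>A. prim A (\<lambda>x. gv c t x - gu c t x) \<and> (AE x in lborel. w c t x = A x)"
  using V.slice_all U.slice_all
proof eventually_elim
  case (elim t)
  show ?case
  proof
    fix c
    obtain A1 where A1: "prim A1 (gv c t)" "AE x in lborel. v c t x = A1 x" using elim(1) by blast
    obtain A2 where A2: "prim A2 (gu c t)" "AE x in lborel. u c t x = A2 x" using elim(2) by blast
    have "AE x in lborel. w c t x = A1 x - A2 x" using A1(2) A2(2) by eventually_elim (simp add: w_def)
    then show "\<exists>A. prim A (\<lambda>x. gv c t x - gu c t x) \<and> (AE x in lborel. w c t x = A x)"
      using prim_diff[OF A1(1) A2(1)] by blast
  qed
qed

lemma wt_slices: "AE t in mu 0 T. \<exists>A. prim A (\<lambda>x. V.gt t x - U.gt t x) \<and> (AE x in lborel. wt t x = A x)"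
  using V.slice_tot U.slice_tot
proof eventually_elim
  case (elim t)
  obtain A1 where A1: "prim A1 (V.gt t)" "AE x in lborel. V.tot t x = A1 x" using elim(1) by blast
  obtain A2 where A2: "prim A2 (U.gt t)" "AE x in lborel. U.tot t x = A2 x" using elim(2) by blast
  have "AE x in lborel. wt t x = A1 x - A2 x"
    using A1(2) A2(2) by eventually_elim (simp add: wt_def w_def V.tot_def U.tot_def sum_subtractf)
  then show ?case using prim_diff[OF A1(1) A2(1)] by blast
qed

lemma w_le: "t \<in> {0..T} \<Longrightarrow> \<bar>w c t x\<bar> \<le> V.tot t x + U.tot t x"
  using V.r_le[of t c x] U.r_le[of t c x] V.r_nonneg[of t c x] U.r_nonneg[of t c x]
  unfolding w_def V.tot_def U.tot_def by linarith

lemma wt_le: "t \<in> {0..T} \<Longrightarrow> \<bar>wt t x\<bar> \<le> V.tot t x + U.tot t x"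
  using V.tot_nonneg[of t x] U.tot_nonneg[of t x]
  unfolding wt_def w_def V.tot_def U.tot_def sum_subtractf by linarith

lemma tot_le_N: "AE t in mu 0 T. AE x in lborel. V.tot t x + U.tot t x \<le> N t"
  using V.tot_bound U.tot_bound
proof eventually_elim
  case (elim t)
  show ?case using elim
  proof eventually_elim
    case (elim x)
    then show ?case using V.lam by (simp add: N_def)
  qed
qed

lemma bw: "AE t in mu 0 T. (AE x in lborel. \<bar>w c t x\<bar> \<le> N t) \<and>
    (\<exists>f. continuous_on UNIV f \<and> (AE x in lborel. w c t x = f x))"
  using tot_le_N w_slices AE_mu_in
proof eventually_elim
  case (elim t)
  note t = elim(3)
  have "AE x in lborel. \<bar>w c t x\<bar> \<le> N t"
    using elim(1) by eventually_elim (rule order_trans[OF w_le[OF t]])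
  then show ?case using elim(2) prim_continuous by blast
qed

lemma bwt: "AE t in mu 0 T. (AE x in lborel. \<bar>wt t x\<bar> \<le> N t) \<and>
    (\<exists>f. continuous_on UNIV f \<and> (AE x in lborel. wt t x = f x))"
  using tot_le_N wt_slices AE_mu_in
proof eventually_elim
  case (elim t)
  note t = elim(3)
  have "AE x in lborel. \<bar>wt t x\<bar> \<le> N t"
    using elim(1) by eventually_elim (rule order_trans[OF wt_le[OF t]])
  then show ?case using elim(2) prim_continuous by blast
qed

lemma N0: "0 \<le> N t" using N1[of t] by simp

lemma om_int: "t \<in> {0..T} \<Longrightarrow> integrable (mu x y) (om t)"
  unfolding om_def by (rule periodic_integrable) (auto simp: V.tot_per V.tot_int)

lemma H_per: "H c t (x + 1) = H c t x" by (simp add: H_def V.flux_per U.flux_per)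
lemma Ht_per: "Ht t (x + 1) = Ht t x" by (simp add: Ht_def H_per)
lemma K_per: "K t (x + 1) = K t x" by (simp add: K_def V.gt_per V.drift_per)

text \<open>All colours share one weight, whose flux \<open>K\<close> is the total flux of
  \<open>v\<close>.\<close>

sublocale C: weighted_primitive "H c" K "w c" om "W c" N T "B c" for c
proof unfold_locales
  show "AE t in mu 0 T. (AE x in lborel. \<bar>om t x\<bar> \<le> N t) \<and>
    (\<exists>f. continuous_on UNIV f \<and> (AE x in lborel. om t x = f x))" by (rule om_slice)
  show "AE t in mu 0 T. (AE x in lborel. \<bar>w c t x\<bar> \<le> N t) \<and>
    (\<exists>f. continuous_on UNIV f \<and> (AE x in lborel. w c t x = f x))" by (rule bw)
qed (auto simp: H_per K_per intro: V.T B_nonneg H_int K_int NH_int NK_int W_def N0 om_int repW repK boundW)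

end

lemma integral_nonpos_AE:
  fixes f :: "'a \<Rightarrow> real"
  assumes "AE x in M. f x \<le> 0"
  shows "integral\<^sup>L M f \<le> 0"
  using integral_nonneg_AE[where f = "\<lambda>x. - f x" and M = M] assms by simp

context two_solutions
begin

text \<open>The constant weight 1 is conserved with flux 0, so the same product rule yields the
  plain squared norm of the total primitive.\<close>

sublocale Tot: weighted_primitive Ht "\<lambda>_ _. 0" wt "\<lambda>_ _. 1" Wt N T Bt
proof unfold_locales
  fix t assume "t \<in> {0..T}"
  show "\<exists>A. prim A (\<lambda>x. 1 - 1) \<and> (AE x in lborel. integral\<^sup>L (mu 0 t) (\<lambda>s. 0) = A x)"
    by (rule exI[of _ "\<lambda>_. 0"]) (use prim_const[of 0] in simp)
next
  show "AE t in mu 0 T. (AE x in lborel. \<bar>1\<bar> \<le> N t) \<and>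
    (\<exists>f. continuous_on UNIV f \<and> (AE x::real in lborel. 1 = f x))"
  proof (rule AE_I2, rule conjI)
    fix t
    show "AE x in lborel. \<bar>1\<bar> \<le> N t" using N1[of t] by simp
    show "\<exists>f. continuous_on UNIV f \<and> (AE x::real in lborel. 1 = f x)" by (rule exI[of _ "\<lambda>_. 1"]) simp
  qed
next
  show "AE t in mu 0 T. (AE x in lborel. \<bar>wt t x\<bar> \<le> N t) \<and>
    (\<exists>f. continuous_on UNIV f \<and> (AE x in lborel. wt t x = f x))" by (rule bwt)
next
  show "integrable (mu 0 T \<Otimes>\<^sub>M mu 0 1) (\<lambda>(t, x). 0)"
    "integrable (mu 0 T \<Otimes>\<^sub>M mu 0 1) (\<lambda>(t, x). N t * 0)" by (simp_all add: case_prod_unfold)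
qed (auto simp: Ht_per intro: V.T Bt_nonneg Ht_int NHt_int Wt_def N0 repWt boundWt)

text \<open>The factor \<open>om\<close> clears the denominator of the drift flux of
  \<open>v\<close>.\<close>

definition dF :: "nat \<Rightarrow> real \<Rightarrow> real \<Rightarrow> real" where "dF c t x = om t x * (V.F c t x - U.F c t x)"
definition bdiff :: "real \<Rightarrow> real \<Rightarrow> real" where "bdiff t x = V.drift t x - U.drift t x"
text \<open>What remains of the rate of colour \<open>c\<close> once the exact derivatives are
  removed; it contains no gradient of \<open>v\<close>.\<close>

definition z :: "nat \<Rightarrow> real \<Rightarrow> real \<Rightarrow> real" where
  "z c t x = - lam * (w c t x)\<^sup>2 - w c t x * u c t x * wt t x - W c t x * gu c t x * wt t x
     - W c t x * wt t x * U.J c t x - 2 * W c t x * dF c t x + 2 * W c t x * w c t x * V.drift t x"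
definition zt :: "real \<Rightarrow> real \<Rightarrow> real" where "zt t x = - (wt t x)\<^sup>2 - 2 * Wt t x * bdiff t x"
definition ZC :: "nat \<Rightarrow> real \<Rightarrow> real" where
  "ZC c s = (\<integral>x. 2 * W c s x * H c s x * om s x - 2 * W c s x * w c s x * K s x \<partial>mu 0 1)"
definition ZT :: "real \<Rightarrow> real" where
  "ZT s = (\<integral>x. 2 * Wt s x * Ht s x * 1 - 2 * Wt s x * wt s x * 0 \<partial>mu 0 1)"

lemma dF_m [measurable]: "case_prod (dF c) \<in> borel_measurable (borel \<Otimes>\<^sub>M borel)" unfolding dF_def by measurable
lemma bdiff_m [measurable]: "case_prod bdiff \<in> borel_measurable (borel \<Otimes>\<^sub>M borel)" unfolding bdiff_def by measurable
lemma z_m [measurable]: "case_prod (z c) \<in> borel_measurable (borel \<Otimes>\<^sub>M borel)" unfolding z_def by measurable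
lemma zt_m [measurable]: "case_prod zt \<in> borel_measurable (borel \<Otimes>\<^sub>M borel)" unfolding zt_def by measurable
lemma ZC_m [measurable]: "ZC c \<in> borel_measurable borel" unfolding ZC_def by measurable
lemma ZT_m [measurable]: "ZT \<in> borel_measurable borel" unfolding ZT_def by measurable

lemma balance_c:
  "AE t in mu 0 T. (\<integral>x. (W c t x)\<^sup>2 * om t x \<partial>mu 0 1) = integral\<^sup>L (mu 0 t) (ZC c)"
  "integrable (mu 0 T) (ZC c)"
proof -
  have eq: "weighted_primitive.Z (H c) K (w c) om (W c) = ZC c" by (rule ext) (simp add: C.Z_def ZC_def)
  show "AE t in mu 0 T. (\<integral>x. (W c t x)\<^sup>2 * om t x \<partial>mu 0 1) = integral\<^sup>L (mu 0 t) (ZC c)"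
    "integrable (mu 0 T) (ZC c)"
    using C.product_rule[of c] C.iZ[of c] unfolding eq by auto
qed

lemma balance_t:
  "AE t in mu 0 T. (\<integral>x. (Wt t x)\<^sup>2 * 1 \<partial>mu 0 1) = integral\<^sup>L (mu 0 t) ZT"
  "integrable (mu 0 T) ZT"
proof -
  have eq: "weighted_primitive.Z Ht (\<lambda>_ _. 0) wt (\<lambda>_ _. 1) Wt = ZT" by (rule ext) (simp add: Tot.Z_def ZT_def)
  show "AE t in mu 0 T. (\<integral>x. (Wt t x)\<^sup>2 * 1 \<partial>mu 0 1) = integral\<^sup>L (mu 0 t) ZT"
    "integrable (mu 0 T) ZT"
    using Tot.product_rule Tot.iZ unfolding eq by auto
qed

text \<open>The unbounded derivatives of \<open>v\<close> only enter through the exact derivatives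
  \<open>(W w)\<^sub>x\<close> and \<open>(W u wt)\<^sub>x\<close>, which integrate to zero; the terms with \<open>w v\<^sub>x\<close> cancel
  because the weight is \<open>lam + tot\<close>.\<close>

lemma integrand_identity:
  assumes t: "t \<in> {0..T}"
  shows "2 * W c t x * H c t x * om t x - 2 * W c t x * w c t x * K t x
    = z c t x + lam * (w c t x * w c t x + W c t x * (gv c t x - gu c t x))
      + ((w c t x * u c t x + W c t x * gu c t x) * wt t x + W c t x * u c t x * (V.gt t x - U.gt t x))"
proof -
  have pV: "om t x \<noteq> 0" using V.tot_nonneg[OF t, of x] V.lam by (simp add: om_def)
  have pU: "lam + U.tot t x \<noteq> 0" using U.tot_nonneg[OF t, of x] V.lam by simp
  have tw: "om t x = lam + U.tot t x + wt t x"
    by (simp add: om_def wt_def w_def V.tot_def U.tot_def sum_subtractf)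
  have JV: "om t x * V.J c t x = lam * gv c t x + v c t x * V.gt t x" using pV by (simp add: V.J_def om_def)
  have "(lam + U.tot t x) * U.J c t x = lam * gu c t x + u c t x * U.gt t x" using pU by (simp add: U.J_def)
  \<comment> \<open>The weight belongs to \<open>v\<close>, so the flux of \<open>u\<close> leaves
    the remainder \<open>wt * U.J\<close>, in which only \<open>wt\<close> involves
    \<open>v\<close>.\<close>
  then have JU: "om t x * U.J c t x = lam * gu c t x + u c t x * U.gt t x + wt t x * U.J c t x"
    unfolding tw by (simp add: distrib_right)
  have v: "v c t x = w c t x + u c t x" by (simp add: w_def)
  have "2 * W c t x * H c t x * om t x = W c t x * (om t x * V.J c t x) - W c t x * (om t x * U.J c t x) - 2 * W c t x * dF c t x"
    by (simp add: H_def V.flux_def U.flux_def dF_def algebra_simps)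
  also have "\<dots> = W c t x * (lam * gv c t x + (w c t x + u c t x) * V.gt t x)
      - W c t x * (lam * gu c t x + u c t x * U.gt t x + wt t x * U.J c t x) - 2 * W c t x * dF c t x"
    unfolding JV JU v ..
  finally show ?thesis unfolding z_def K_def by (simp add: algebra_simps power2_eq_square)
qed

text \<open>With \<open>W\<close>, \<open>w\<close>, \<open>u\<close> and \<open>wt\<close> replaced
  by their absolutely continuous representatives, the two groups of extra terms are derivatives of
  periodic products, the second one of the triple product of \<open>A\<close>, \<open>Cu\<close> and
  \<open>D\<close>.\<close>

lemma ZC_eq: "AE s in mu 0 T. integrable (mu 0 1) (z c s) \<and> ZC c s = (\<integral>x. z c s x \<partial>mu 0 1)"
  using C.slice_integrable[of c] w_slices U.slice_all wt_slices AE_mu_in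
proof eventually_elim
  case (elim s)
  note s = elim(5)
  obtain A where A: "prim A (w c s)" and WA: "AE x in lborel. W c s x = A x" using repW[OF s] by blast
  obtain Bw where Bw: "prim Bw (\<lambda>x. gv c s x - gu c s x)" and wB: "AE x in lborel. w c s x = Bw x" using elim(2) by blast
  obtain Cu where Cu: "prim Cu (gu c s)" and uC: "AE x in lborel. u c s x = Cu x" using elim(3) by blast
  obtain D where D: "prim D (\<lambda>x. V.gt s x - U.gt s x)" and wD: "AE x in lborel. wt s x = D x" using elim(4) by blast
  define p1 where "p1 x = w c s x * Bw x + A x * (gv c s x - gu c s x)" for x
  define p2 where "p2 x = (w c s x * Cu x + A x * gu c s x) * D x + (A x * Cu x) * (V.gt s x - U.gt s x)" for x
  define f where "f x = 2 * W c s x * H c s x * om s x - 2 * W c s x * w c s x * K s x" for x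
  have p1: "integrable (mu 0 1) p1" "integral\<^sup>L (mu 0 1) p1 = 0"
    using prim_by_parts[OF A Bw] by (auto simp: p1_def[abs_def])
  have p2: "integrable (mu 0 1) p2" "integral\<^sup>L (mu 0 1) p2 = 0"
    using prim_by_parts[OF prim_mult[OF A Cu] D] by (auto simp: p2_def[abs_def])
  have f: "integrable (mu 0 1) f" using elim(1) by (simp add: f_def[abs_def])
  have ae: "AE x in mu 0 1. f x - lam * p1 x - p2 x = z c s x"
    using AE_mu_lborel[OF WA] AE_mu_lborel[OF wB] AE_mu_lborel[OF uC] AE_mu_lborel[OF wD]
  proof eventually_elim
    case (elim x)
    show ?case unfolding f_def p1_def p2_def integrand_identity[OF s]
      unfolding elim[symmetric] by simp
  qed
  have i: "integrable (mu 0 1) (\<lambda>x. f x - lam * p1 x - p2 x)" using f p1 p2 by simp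
  have iz: "integrable (mu 0 1) (z c s)" by (rule integrable_cong_AE_imp[OF i _ ae]) simp
  have "(\<integral>x. z c s x \<partial>mu 0 1) = (\<integral>x. f x - lam * p1 x - p2 x \<partial>mu 0 1)"
    by (rule integral_cong_AE) (use ae i in \<open>auto simp: eq_commute intro: integrable_mu_meas\<close>)
  also have "\<dots> = ZC c s" using f p1 p2 by (simp add: ZC_def f_def[abs_def])
  finally show ?case using iz by simp
qed

lemma ZT_eq: "AE s in mu 0 T. integrable (mu 0 1) (zt s) \<and> ZT s = (\<integral>x. zt s x \<partial>mu 0 1)"
  using Tot.slice_integrable wt_slices AE_mu_in
proof eventually_elim
  case (elim s)
  note s = elim(3)
  obtain A where A: "prim A (wt s)" and WA: "AE x in lborel. Wt s x = A x" using repWt[OF s] by blast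
  obtain D where D: "prim D (\<lambda>x. V.gt s x - U.gt s x)" and wD: "AE x in lborel. wt s x = D x" using elim(2) by blast
  define p1 where "p1 x = wt s x * D x + A x * (V.gt s x - U.gt s x)" for x
  define f where "f x = 2 * Wt s x * Ht s x * 1 - 2 * Wt s x * wt s x * 0" for x
  have p1: "integrable (mu 0 1) p1" "integral\<^sup>L (mu 0 1) p1 = 0"
    using prim_by_parts[OF A D] by (auto simp: p1_def[abs_def])
  have f: "integrable (mu 0 1) f" using elim(1) by (simp add: f_def[abs_def])
  have Ht: "Ht s x = V.gt s x / 2 - V.drift s x - (U.gt s x / 2 - U.drift s x)" for x
    by (simp add: Ht_def H_def sum_subtractf V.flux_sum[OF s] U.flux_sum[OF s])
  have ae: "AE x in mu 0 1. f x - p1 x = zt s x"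
    using AE_mu_lborel[OF WA] AE_mu_lborel[OF wD]
  proof eventually_elim
    case (elim x)
    show ?case unfolding f_def p1_def zt_def bdiff_def Ht elim[symmetric]
      by (simp add: algebra_simps power2_eq_square)
  qed
  have i: "integrable (mu 0 1) (\<lambda>x. f x - p1 x)" using f p1 by simp
  have iz: "integrable (mu 0 1) (zt s)" by (rule integrable_cong_AE_imp[OF i _ ae]) simp
  have "(\<integral>x. zt s x \<partial>mu 0 1) = (\<integral>x. f x - p1 x \<partial>mu 0 1)"
    by (rule integral_cong_AE) (use ae i in \<open>auto simp: eq_commute intro: integrable_mu_meas\<close>)
  also have "\<dots> = ZT s" using f p1 by (simp add: ZT_def f_def[abs_def])
  finally show ?case using iz by simp
qed

section \<open>The initial interval on which the coefficients vanish\<close>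

lemma V_drift_early: "t \<in> {0..T} \<Longrightarrow> t \<le> eta \<Longrightarrow> V.drift t x = 0" by (simp add: V.drift_def b_vanish)
lemma U_drift_early: "t \<in> {0..T} \<Longrightarrow> t \<le> eta \<Longrightarrow> U.drift t x = 0" by (simp add: U.drift_def b_vanish)
lemma dF_early: "t \<in> {0..T} \<Longrightarrow> t \<le> eta \<Longrightarrow> dF c t x = 0"
  by (simp add: dF_def V.F_def U.F_def b_vanish G_vanish)

lemma Wt_slice: "AE s in mu 0 T. integrable (mu 0 1) (\<lambda>x. (Wt s x)\<^sup>2) \<and> (\<integral>x. (Wt s x)\<^sup>2 \<partial>mu 0 1) \<le> Bt\<^sup>2"
  using AE_mu_in
proof eventually_elim
  case (elim s)
  have b: "AE x in mu 0 1. (Wt s x)\<^sup>2 \<le> Bt\<^sup>2"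
    using AE_mu_lborel[OF boundWt[OF elim]] by eventually_elim (simp add: abs_le_square_iff[symmetric] Bt_nonneg)
  have i: "integrable (mu 0 1) (\<lambda>x. (Wt s x)\<^sup>2)" by (rule integrable_mu_bounded[where B="Bt\<^sup>2"]) (use b in auto)
  have "(\<integral>x. (Wt s x)\<^sup>2 \<partial>mu 0 1) \<le> (\<integral>x. Bt\<^sup>2 \<partial>mu 0 1)" by (rule integral_mono_AE[OF i _ b]) simp
  then show ?case using i by (simp add: measure_mu)
qed

lemma wt_early: "AE s in mu 0 T. s \<le> eta \<longrightarrow> (AE x in mu 0 1. wt s x = 0)"
proof -
  \<comment> \<open>The final time may come before \<open>eta\<close>.\<close>
  define e where "e = min eta T"
  define y where "y s = (\<integral>x. (Wt s x)\<^sup>2 \<partial>mu 0 1)" for s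
  have [measurable]: "y \<in> borel_measurable borel" unfolding y_def by measurable
  have sub: "AE s in mu 0 e. P s" if "AE s in mu 0 T. P s" for P
    by (rule AE_mu_subset[OF that]) (auto simp: e_def)
  have neg: "AE s in mu 0 e. ZT s \<le> 0"
    using sub[OF ZT_eq] AE_mu_in
  proof eventually_elim
    case (elim s)
    then have s: "s \<in> {0..T}" "s \<le> eta" by (auto simp: e_def)
    have "(\<integral>x. zt s x \<partial>mu 0 1) \<le> 0"
      by (rule integral_nonpos_AE) (simp add: zt_def bdiff_def V_drift_early[OF s] U_drift_early[OF s])
    then show ?case using elim by simp
  qed
  \<comment> \<open>The balance with a nonpositive rate already gives that \<open>y\<close> is at
    most 0; the Gronwall lemma with rate 0 combines this with nonnegativity.\<close>
  have "AE s in mu 0 e. y s = 0"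
  proof (rule gronwall_zero[where \<theta> = "\<lambda>_. 0" and B = "Bt\<^sup>2"])
    show "AE t in mu 0 e. y t \<le> integral\<^sup>L (mu 0 t) (\<lambda>s. 0 * y s)"
      using sub[OF balance_t(1)] AE_mu_in
    proof eventually_elim
      case (elim t)
      have "integral\<^sup>L (mu 0 t) ZT \<le> 0"
        by (rule integral_nonpos_AE, rule AE_mu_subset[OF neg]) (use elim in auto)
      then show ?case using elim by (simp add: y_def)
    qed
    show "AE t in mu 0 e. y t \<le> Bt\<^sup>2" using sub[OF Wt_slice] by eventually_elim (simp add: y_def)
  qed (auto simp: y_def)
  then have "AE s in mu 0 e. AE x in mu 0 1. wt s x = 0"
    using sub[OF Wt_slice] AE_mu_in
  proof eventually_elim
    case (elim s)
    then have s: "s \<in> {0..T}" by (auto simp: e_def)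
    have "AE x in mu 0 1. (Wt s x)\<^sup>2 = 0"
      using integral_nonneg_eq_0_iff_AE[of "mu 0 1" "\<lambda>x. (Wt s x)\<^sup>2"] elim by (simp add: y_def)
    then have W0: "AE x in lborel. Wt s x = 0" by (intro AE_periodic) (auto simp: Tot.perW)
    obtain A where A: "prim A (wt s)" and WA: "AE x in lborel. Wt s x = A x" using repWt[OF s] by blast
    have "AE x in lborel. A x = 0" using W0 WA by eventually_elim simp
    then show ?case by (rule prim_zero[OF A])
  qed
  then have "AE s in lborel. s \<in> {0..e} \<longrightarrow> (AE x in mu 0 1. wt s x = 0)" by (simp only: AE_mu)
  then show ?thesis unfolding AE_mu by eventually_elim (auto simp: e_def)
qed

section \<open>Bounds for the lower-order terms and the Gronwall functional\<close>

definition \<sigma> :: "real \<Rightarrow> real \<Rightarrow> real" where "\<sigma> t x = (\<Sum>c<m. \<bar>w c t x\<bar>)"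

lemma beta0: "0 \<le> beta" using V.b_bound[of 0 0 0] V.T by simp

lemma bdiff_bound: "t \<in> {0..T} \<Longrightarrow> \<bar>bdiff t x\<bar> \<le> beta * \<sigma> t x"
proof -
  assume t: "t \<in> {0..T}"
  have "\<bar>bdiff t x\<bar> = \<bar>\<Sum>c<m. b c t x * w c t x\<bar>"
    by (simp add: bdiff_def V.drift_def U.drift_def w_def right_diff_distrib sum_subtractf)
  also have "\<dots> \<le> (\<Sum>c<m. \<bar>b c t x * w c t x\<bar>)" by (rule sum_abs)
  also have "\<dots> \<le> (\<Sum>c<m. beta * \<bar>w c t x\<bar>)"
    unfolding abs_mult by (intro sum_mono mult_right_mono V.b_bound[OF t]) simp
  finally show ?thesis by (simp add: \<sigma>_def sum_distrib_left)
qed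

lemma dF_bound:
  assumes t: "t \<in> {0..T}" and c: "c < m" and uR: "\<bar>u c t x\<bar> \<le> R"
  shows "\<bar>dF c t x\<bar> \<le> om t x * (2 * beta + 4 * beta * R / lam) * \<sigma> t x"
proof -
  let ?a = "\<lambda>r. lam * b c t x + (\<Sum>k<m. (b k t x - \<Gamma> c k t x) * r k t x)"
  define av au where "av = ?a v" and "au = ?a u"
  let ?s = "\<sigma> t x"
  have R0: "0 \<le> R" using uR by simp
  have u0: "0 \<le> u c t x" "u c t x \<le> R" using U.r_nonneg[OF t, of c x] uR by auto
  have s0: "0 \<le> ?s" by (simp add: \<sigma>_def sum_nonneg)
  have pV: "lam \<le> om t x" using V.tot_nonneg[OF t, of x] by (simp add: om_def)
  have pU: "lam + U.tot t x \<noteq> 0" using U.tot_nonneg[OF t, of x] V.lam by simp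
  have ws: "\<bar>w c t x\<bar> \<le> ?s" unfolding \<sigma>_def using c by (intro member_le_sum[of c _ "\<lambda>c. \<bar>w c t x\<bar>"]) auto
  have wts: "\<bar>wt t x\<bar> \<le> ?s" unfolding wt_def \<sigma>_def by (rule sum_abs)
  have tw: "om t x = (lam + U.tot t x) + wt t x"
    by (simp add: om_def wt_def w_def V.tot_def U.tot_def sum_subtractf)
  have FV: "om t x * V.F c t x = v c t x * av"
    using pV V.lam by (simp add: V.F_def om_def av_def)
  have FU: "(lam + U.tot t x) * U.F c t x = u c t x * au" using pU by (simp add: U.F_def au_def)
  have "om t x * U.F c t x = (lam + U.tot t x) * U.F c t x + wt t x * U.F c t x"
    unfolding tw by (rule distrib_right)
  then have "om t x * U.F c t x = u c t x * au + wt t x * U.F c t x"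
    unfolding FU .
  \<comment> \<open>Three contributions: the difference of the prefactors \<open>v c\<close> and
    \<open>u c\<close>, the difference of the fields \<open>av\<close> and \<open>au\<close>, and
    the difference of the denominators.\<close>
  then have eq: "dF c t x = w c t x * av + u c t x * (av - au) - wt t x * U.F c t x"
    unfolding dF_def right_diff_distrib FV by (simp add: w_def algebra_simps)
  have 1: "\<bar>w c t x * av\<bar> \<le> ?s * (2 * beta * om t x)"
  proof -
    have "\<bar>av\<bar> \<le> 2 * beta * om t x" unfolding av_def om_def by (rule V.F_bound(2)[OF t])
    then show ?thesis unfolding abs_mult by (rule mult_mono[OF ws]) (simp_all add: s0)
  qed
  have ad: "\<bar>av - au\<bar> \<le> 2 * beta * ?s"
  proof -
    have "\<bar>av - au\<bar> = \<bar>\<Sum>k<m. (b k t x - \<Gamma> c k t x) * w k t x\<bar>"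
      by (simp add: av_def au_def w_def right_diff_distrib sum_subtractf)
    also have "\<dots> \<le> (\<Sum>k<m. \<bar>(b k t x - \<Gamma> c k t x) * w k t x\<bar>)" by (rule sum_abs)
    also have "\<dots> \<le> (\<Sum>k<m. 2 * beta * \<bar>w k t x\<bar>)"
    proof (rule sum_mono)
      fix k
      have "\<bar>b k t x - \<Gamma> c k t x\<bar> \<le> 2 * beta" using V.b_bound[OF t, of k x] V.G_bound[OF t, of c k x] by linarith
      then show "\<bar>(b k t x - \<Gamma> c k t x) * w k t x\<bar> \<le> 2 * beta * \<bar>w k t x\<bar>" by (simp add: abs_mult mult_right_mono)
    qed
    finally show ?thesis by (simp add: \<sigma>_def sum_distrib_left)
  qed
  have 2: "\<bar>u c t x * (av - au)\<bar> \<le> R * (2 * beta * ?s)"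
    unfolding abs_mult using u0 ad R0 by (intro mult_mono) auto
  have "\<bar>U.F c t x\<bar> \<le> 2 * beta * R"
    using U.F_bound(1)[OF t, of c x] mult_left_mono[OF u0(2), of "2 * beta"] beta0 by simp
  then have 3: "\<bar>wt t x * U.F c t x\<bar> \<le> ?s * (2 * beta * R)"
    unfolding abs_mult using wts s0 by (intro mult_mono) auto
  have "\<bar>dF c t x\<bar> \<le> ?s * (2 * beta * om t x) + R * (2 * beta * ?s) + ?s * (2 * beta * R)"
    unfolding eq using 1 2 3 by linarith
  also have "\<dots> = om t x * (2 * beta) * ?s + 4 * beta * R * ?s" by (simp add: algebra_simps)
  \<comment> \<open>The factor \<open>om / lam\<close>, which is at least 1, is inserted to reach
    the form \<open>om * q * \<sigma>\<close> required by \<open>energy_pointwise\<close>.\<close>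
  also have "4 * beta * R * ?s \<le> om t x * (4 * beta * R / lam) * ?s"
  proof -
    have "lam * (4 * beta * R / lam) \<le> om t x * (4 * beta * R / lam)"
      using pV beta0 R0 V.lam by (intro mult_right_mono) auto
    then have "4 * beta * R \<le> om t x * (4 * beta * R / lam)" using V.lam by simp
    then show ?thesis by (rule mult_right_mono[OF _ s0])
  qed
  finally show ?thesis by (simp add: algebra_simps)
qed

lemma UJ_bound:
  assumes t: "t \<in> {0..T}" and uR: "\<And>c. \<bar>u c t x\<bar> \<le> R" and guR: "\<And>c. \<bar>gu c t x\<bar> \<le> R"
  shows "\<bar>U.J c t x\<bar> \<le> R + R * (real m * R) / lam"
proof -
  have R0: "0 \<le> R" using uR[of 0] by simp
  have pU: "lam \<le> lam + U.tot t x" using U.tot_nonneg[OF t, of x] by simp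
  have "\<bar>U.gt t x\<bar> \<le> (\<Sum>c<m. \<bar>gu c t x\<bar>)" unfolding U.gt_def by (rule sum_abs)
  also have "\<dots> \<le> (\<Sum>c<m. R)" by (intro sum_mono guR)
  finally have g: "\<bar>U.gt t x\<bar> \<le> real m * R" by simp
  have "\<bar>lam * gu c t x + u c t x * U.gt t x\<bar> \<le> lam * \<bar>gu c t x\<bar> + \<bar>u c t x\<bar> * \<bar>U.gt t x\<bar>"
    using abs_triangle_ineq[of "lam * gu c t x" "u c t x * U.gt t x"] V.lam by (simp add: abs_mult)
  also have "\<dots> \<le> lam * R + R * (real m * R)"
    using guR[of c] uR[of c] g V.lam R0 by (intro add_mono mult_mono) auto
  finally have n: "\<bar>lam * gu c t x + u c t x * U.gt t x\<bar> \<le> lam * R + R * (real m * R)" .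
  have "\<bar>U.J c t x\<bar> = \<bar>lam * gu c t x + u c t x * U.gt t x\<bar> / (lam + U.tot t x)"
    using pU V.lam by (simp add: U.J_def abs_divide)
  also have "\<dots> \<le> (lam * R + R * (real m * R)) / lam"
    using n pU V.lam by (intro frac_le) auto
  also have "\<dots> = R + R * (real m * R) / lam" using V.lam by (simp add: add_divide_distrib)
  finally show ?thesis .
qed

definition \<kappa> :: real where "\<kappa> = real m * R\<^sup>2 / lam + real m"
text \<open>The constant of \<open>energy_pointwise\<close>, with the bounds of
  \<open>UJ_bound\<close> and \<open>dF_bound\<close> in the places of \<open>R'\<close> and
  \<open>q\<close>.\<close>

definition Cst :: real where
  "Cst = ((R + (R + R * (real m * R) / lam))\<^sup>2 / lam + 4 * (real m)\<^sup>2 * ((2 * beta + 4 * beta * R / lam) + beta)\<^sup>2 / lam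
     + 4 * real m * \<kappa> * beta\<^sup>2 / lam)"
definition E :: "real \<Rightarrow> real" where
  "E t = (\<Sum>c<m. \<integral>x. (W c t x)\<^sup>2 * om t x \<partial>mu 0 1) + \<kappa> * (\<integral>x. (Wt t x)\<^sup>2 \<partial>mu 0 1)"

lemma E_m [measurable]: "E \<in> borel_measurable borel" unfolding E_def by measurable

lemma kappa0: "0 \<le> \<kappa>" using V.lam by (simp add: \<kappa>_def)
lemma Cst0: "0 \<le> Cst" using V.lam kappa0 by (simp add: Cst_def)

lemma om_pos: "t \<in> {0..T} \<Longrightarrow> lam \<le> om t x" using V.tot_nonneg[of t x] by (simp add: om_def)

lemma E_nonneg:
  assumes t: "t \<in> {0..T}"
  shows "0 \<le> E t"
proof -
  have "0 \<le> (W c t x)\<^sup>2 * om t x" for c x using om_pos[OF t, of x] V.lam by simp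
  then have "0 \<le> (\<integral>x. (W c t x)\<^sup>2 * om t x \<partial>mu 0 1)" for c by (intro integral_nonneg_AE) simp
  then show ?thesis unfolding E_def using kappa0 by (intro add_nonneg_nonneg sum_nonneg mult_nonneg_nonneg) auto
qed

lemma C_slice: "AE s in mu 0 T. \<forall>c. integrable (mu 0 1) (\<lambda>x. (W c s x)\<^sup>2 * om s x)"
  unfolding AE_all_countable
proof
  fix c
  show "AE s in mu 0 T. integrable (mu 0 1) (\<lambda>x. (W c s x)\<^sup>2 * om s x)"
    using C.slice_integrable[of c] by eventually_elim simp
qed

lemma late_pointwise:
  assumes s: "s \<in> {0..T}" and uR: "\<And>c. \<bar>u c s x\<bar> \<le> R" and guR: "\<And>c. \<bar>gu c s x\<bar> \<le> R"
    and omN: "om s x \<le> N s" and Ws: "Wt s x = (\<Sum>c<m. W c s x)"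
  shows "(\<Sum>c<m. z c s x) + \<kappa> * zt s x \<le> Cst * N s * ((\<Sum>c<m. (W c s x)\<^sup>2 * om s x) + \<kappa> * (Wt s x)\<^sup>2)"
proof -
  have dr: "\<bar>V.drift s x\<bar> \<le> beta * om s x"
    using V.drift_bound[OF s, of x] mult_left_mono[of "V.tot s x" "om s x" beta] beta0 V.lam by (simp add: om_def)
  show ?thesis
    unfolding z_def zt_def Cst_def \<kappa>_def wt_def Ws
    by (rule energy_pointwise)
      (use m V.lam om_pos[OF s, of x] omN N1[of s] uR guR UJ_bound[OF s uR guR] dF_bound[OF s _ uR, unfolded \<sigma>_def] dr
        bdiff_bound[OF s, unfolded \<sigma>_def] in auto)
qed

lemma om_le_N: "AE s in mu 0 T. AE x in mu 0 1. om s x \<le> N s"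
  using om_slice
proof eventually_elim
  case (elim s)
  then have "AE x in lborel. \<bar>om s x\<bar> \<le> N s" by blast
  then have "AE x in mu 0 1. \<bar>om s x\<bar> \<le> N s" by (rule AE_mu_lborel)
  then show ?case by eventually_elim simp
qed

text \<open>Up to \<open>eta\<close> both \<open>wt\<close> and the drift vanish, so each
  \<open>z c\<close> reduces to \<open>- lam * (w c)\<^sup>2\<close> and the size of
  \<open>u\<close> does not enter. Afterwards the pointwise estimate is integrated in space.\<close>

lemma E_deriv_le: "AE s in mu 0 T. (\<Sum>c<m. ZC c s) + \<kappa> * ZT s \<le> Cst * N s * E s"
proof -
  have Zall: "AE s in mu 0 T. \<forall>c. integrable (mu 0 1) (z c s) \<and> ZC c s = (\<integral>x. z c s x \<partial>mu 0 1)"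
    unfolding AE_all_countable using ZC_eq by blast
  show ?thesis
    using Zall ZT_eq wt_early u_bound om_le_N C_slice Wt_slice AE_mu_in
  proof eventually_elim
    case (elim s)
    note s = elim(8)
    have int: "(\<Sum>c<m. ZC c s) + \<kappa> * ZT s = (\<integral>x. (\<Sum>c<m. z c s x) + \<kappa> * zt s x \<partial>mu 0 1)"
      using elim(1,2) by simp
    show ?case
    proof (cases "s \<le> eta")
      case True
      then have w0: "AE x in mu 0 1. wt s x = 0" using elim(3) by simp
      have "(\<integral>x. (\<Sum>c<m. z c s x) + \<kappa> * zt s x \<partial>mu 0 1) \<le> 0"
      proof (rule integral_nonpos_AE)
        show "AE x in mu 0 1. (\<Sum>c<m. z c s x) + \<kappa> * zt s x \<le> 0"
          using w0
        proof eventually_elim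
          case (elim x)
          have "z c s x \<le> 0" for c
            using elim V.lam by (simp add: z_def dF_early[OF s True] V_drift_early[OF s True])
          then have "(\<Sum>c<m. z c s x) \<le> 0" by (intro sum_nonpos) simp
          moreover have "zt s x = 0" using elim by (simp add: zt_def bdiff_def V_drift_early[OF s True] U_drift_early[OF s True])
          ultimately show ?case by simp
        qed
      qed
      moreover have "0 \<le> Cst * N s * E s" using Cst0 N0[of s] E_nonneg[OF s] by simp
      ultimately show ?thesis using int by simp
    next
      case False
      then have uR: "AE x in mu 0 1. \<forall>c. \<bar>u c s x\<bar> \<le> R \<and> \<bar>gu c s x\<bar> \<le> R" using elim(4) by simp
      have i2: "integrable (mu 0 1) (\<lambda>x. Cst * N s * ((\<Sum>c<m. (W c s x)\<^sup>2 * om s x) + \<kappa> * (Wt s x)\<^sup>2))"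
        using elim(6,7) by simp
      have "(\<integral>x. (\<Sum>c<m. z c s x) + \<kappa> * zt s x \<partial>mu 0 1)
        \<le> (\<integral>x. Cst * N s * ((\<Sum>c<m. (W c s x)\<^sup>2 * om s x) + \<kappa> * (Wt s x)\<^sup>2) \<partial>mu 0 1)"
      proof (rule integral_mono_AE[OF _ i2])
        show "integrable (mu 0 1) (\<lambda>x. (\<Sum>c<m. z c s x) + \<kappa> * zt s x)" using elim(1,2) by simp
        show "AE x in mu 0 1. (\<Sum>c<m. z c s x) + \<kappa> * zt s x \<le> Cst * N s * ((\<Sum>c<m. (W c s x)\<^sup>2 * om s x) + \<kappa> * (Wt s x)\<^sup>2)"
          using uR elim(5) AE_mu_lborel[OF Wt_sum[OF s]]
          by eventually_elim (rule late_pointwise[OF s], auto)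
      qed
      also have "\<dots> = Cst * N s * E s" using elim(6,7) by (simp add: E_def)
      finally show ?thesis using int by simp
    qed
  qed
qed

text \<open>\<open>gronwall_zero\<close> asks for some bound on \<open>E\<close>; the primitives are
  bounded and the weight has the constant integral \<open>lam\<close> plus the masses.\<close>

lemma E_bound: "AE t in mu 0 T. E t \<le> (\<Sum>c<m. (B c)\<^sup>2 * (lam + (\<Sum>c<m. mass c))) + \<kappa> * Bt\<^sup>2"
  using C_slice Wt_slice AE_mu_in
proof eventually_elim
  case (elim t)
  note t = elim(3)
  have "(\<integral>x. (W c t x)\<^sup>2 * om t x \<partial>mu 0 1) \<le> (B c)\<^sup>2 * (lam + (\<Sum>c<m. mass c))" for c
  proof -
    have "(\<integral>x. (W c t x)\<^sup>2 * om t x \<partial>mu 0 1) \<le> (\<integral>x. (B c)\<^sup>2 * om t x \<partial>mu 0 1)"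
    proof (rule integral_mono_AE)
      show "AE x in mu 0 1. (W c t x)\<^sup>2 * om t x \<le> (B c)\<^sup>2 * om t x"
        using AE_mu_lborel[OF boundW[OF t, of c]]
      proof eventually_elim
        case (elim x)
        then show ?case using om_pos[OF t, of x] V.lam B_nonneg[of c]
          by (intro mult_right_mono) (auto simp: abs_le_square_iff[symmetric])
      qed
    qed (use elim(1) om_int[OF t] in auto)
    also have "\<dots> = (B c)\<^sup>2 * (lam + (\<Sum>c<m. mass c))"
      using V.tot_int[OF t] V.tot_mass[OF t] by (simp add: om_def measure_mu)
    finally show ?thesis .
  qed
  then show ?case unfolding E_def using elim(2) kappa0 by (intro add_mono sum_mono mult_left_mono) auto
qed

text \<open>Gronwall gives \<open>E = 0\<close>. The weight is at least \<open>lam\<close>, so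
  \<open>W c\<close> vanishes, and so does its space derivative \<open>w c\<close>. The product rule
  holds at almost every time, which is why the conclusion does too.\<close>

theorem uniqueness: "AE t in mu 0 T. AE x in mu 0 1. \<forall>c<m. v c t x = u c t x"
proof -
  have ball: "AE t in mu 0 T. \<forall>c. (\<integral>x. (W c t x)\<^sup>2 * om t x \<partial>mu 0 1) = integral\<^sup>L (mu 0 t) (ZC c)"
    unfolding AE_all_countable using balance_c(1) by blast
  have E0: "AE t in mu 0 T. E t = 0"
  proof (rule gronwall_zero[where \<theta> = "\<lambda>t. Cst * N t"])
    show "integrable (mu 0 T) (\<lambda>t. Cst * N t)" using N_int by simp
    show "AE t in mu 0 T. 0 \<le> Cst * N t" using Cst0 N0 by simp
    show "AE t in mu 0 T. 0 \<le> E t" using AE_mu_in by eventually_elim (rule E_nonneg)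
    show "AE t in mu 0 T. E t \<le> (\<Sum>c<m. (B c)\<^sup>2 * (lam + (\<Sum>c<m. mass c))) + \<kappa> * Bt\<^sup>2" by (rule E_bound)
    show "AE t in mu 0 T. E t \<le> integral\<^sup>L (mu 0 t) (\<lambda>s. Cst * N s * E s)"
      using ball balance_t(1) AE_mu_in
    proof eventually_elim
      case (elim t)
      then have t: "0 \<le> t" "t \<le> T" by auto
      have iZ: "integrable (mu 0 t) (ZC c)" "integrable (mu 0 t) ZT" for c
        using integrable_mu_subset[OF balance_c(2)[of c], of 0 t] integrable_mu_subset[OF balance_t(2), of 0 t] t by auto
      have iE: "integrable (mu 0 T) (\<lambda>s. Cst * N s * E s)"
      proof (rule Bochner_Integration.integrable_bound)
        let ?Y = "(\<Sum>c<m. (B c)\<^sup>2 * (lam + (\<Sum>c<m. mass c))) + \<kappa> * Bt\<^sup>2"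
        show "integrable (mu 0 T) (\<lambda>s. Cst * N s * ?Y)" using N_int by simp
        show "AE s in mu 0 T. norm (Cst * N s * E s) \<le> norm (Cst * N s * ?Y)"
          using E_bound AE_mu_in
        proof eventually_elim
          case (elim s)
          have "\<bar>E s\<bar> \<le> \<bar>?Y\<bar>" using elim E_nonneg[OF elim(2)] by linarith
          then show ?case unfolding real_norm_def abs_mult by (intro mult_left_mono) auto
        qed
      qed simp
      have "E t = (\<Sum>c<m. integral\<^sup>L (mu 0 t) (ZC c)) + \<kappa> * integral\<^sup>L (mu 0 t) ZT"
        using elim by (simp add: E_def)
      also have "\<dots> = integral\<^sup>L (mu 0 t) (\<lambda>s. (\<Sum>c<m. ZC c s) + \<kappa> * ZT s)" using iZ by simp
      also have "\<dots> \<le> integral\<^sup>L (mu 0 t) (\<lambda>s. Cst * N s * E s)"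
      proof (rule integral_mono_AE)
        show "integrable (mu 0 t) (\<lambda>s. (\<Sum>c<m. ZC c s) + \<kappa> * ZT s)" using iZ by simp
        show "integrable (mu 0 t) (\<lambda>s. Cst * N s * E s)" by (rule integrable_mu_subset[OF iE]) (use t in auto)
        show "AE s in mu 0 t. (\<Sum>c<m. ZC c s) + \<kappa> * ZT s \<le> Cst * N s * E s"
          by (rule AE_mu_subset[OF E_deriv_le]) (use t in auto)
      qed
      finally show ?case .
    qed
  qed simp
  then show ?thesis using C_slice Wt_slice AE_mu_in
  proof eventually_elim
    case (elim t)
    note t = elim(4)
    have nn: "0 \<le> (W c t x)\<^sup>2 * om t x" for c x using om_pos[OF t, of x] V.lam by simp
    have nn': "0 \<le> (\<integral>x. (W c t x)\<^sup>2 * om t x \<partial>mu 0 1)" for c using nn by (intro integral_nonneg_AE) simp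
    have "0 \<le> \<kappa> * (\<integral>x. (Wt t x)\<^sup>2 \<partial>mu 0 1)" using kappa0 by simp
    moreover have "0 \<le> (\<Sum>c<m. \<integral>x. (W c t x)\<^sup>2 * om t x \<partial>mu 0 1)" by (intro sum_nonneg nn')
    ultimately have "(\<Sum>c<m. \<integral>x. (W c t x)\<^sup>2 * om t x \<partial>mu 0 1) = 0" using elim(1) unfolding E_def by linarith
    then have z: "(\<integral>x. (W c t x)\<^sup>2 * om t x \<partial>mu 0 1) = 0" if "c < m" for c
      using that nn' by (subst (asm) sum_nonneg_eq_0_iff) auto
    have w0: "AE x in mu 0 1. w c t x = 0" if c: "c < m" for c
    proof -
      have "AE x in mu 0 1. (W c t x)\<^sup>2 * om t x = 0"
        using integral_nonneg_eq_0_iff_AE[of "mu 0 1" "\<lambda>x. (W c t x)\<^sup>2 * om t x"] elim(2) nn z[OF c] by simp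
      then have "AE x in mu 0 1. W c t x = 0"
      proof eventually_elim
        case (elim x)
        then show ?case using om_pos[OF t, of x] V.lam by simp
      qed
      then have W0: "AE x in lborel. W c t x = 0" by (intro AE_periodic) (auto simp: C.perW)
      obtain A where A: "prim A (w c t)" and WA: "AE x in lborel. W c t x = A x" using repW[OF t] by blast
      have "AE x in lborel. A x = 0" using W0 WA by eventually_elim simp
      then show ?thesis by (rule prim_zero[OF A])
    qed
    have "AE x in mu 0 1. \<forall>c\<in>{..<m}. w c t x = 0"
      by (rule AE_finite_allI) (auto intro: w0)
    then show ?case by eventually_elim (simp add: w_def)
  qed
qed

end

section \<open>Slicing the weak formulation\<close>

text \<open>Bridge from integrals over a rectangle in the plane, as they occur in the weak
  formulation, to products of one-dimensional measures, to which Fubini is applied.\<close>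

lemma mu_pair_eq: "mu a b \<Otimes>\<^sub>M mu c d = density lborel (indicator ({a..b} \<times> {c..d}))"
proof -
  have "mu a b \<Otimes>\<^sub>M mu c d = density (lborel \<Otimes>\<^sub>M lborel) (\<lambda>(x, y). indicator {a..b} x * indicator {c..d} y)"
    unfolding mu_def
  proof (rule pair_measure_density)
    show "sigma_finite_measure (density lborel (indicator {c..d}))"
      using mu.sigma_finite_measure_axioms[of c d] unfolding mu_def .
  qed (auto intro: sigma_finite_lborel)
  also have "(\<lambda>(x, y). indicator {a..b} x * indicator {c..d} y :: ennreal) = indicator ({a..b} \<times> {c..d})"
    by (auto simp: fun_eq_iff indicator_def)
  finally show ?thesis by (simp add: lborel_prod)
qed

lemma integral_mu_pair:
  fixes f :: "real \<times> real \<Rightarrow> real"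
  assumes "f \<in> borel_measurable borel"
  shows "(LINT p:{a..b} \<times> {c..d}|lborel. f p) = integral\<^sup>L (mu a b \<Otimes>\<^sub>M mu c d) f"
proof -
  have "mu a b \<Otimes>\<^sub>M mu c d = density lborel (\<lambda>p. ennreal (indicator ({a..b} \<times> {c..d}) p))"
    by (simp add: mu_pair_eq ennreal_indicator)
  moreover have "{a..b} \<times> {c..d} \<in> sets borel" by (intro borel_closed closed_Times) auto
  ultimately show ?thesis using assms by (simp add: integral_density set_lebesgue_integral_def)
qed

lemma integrable_mu_pair:
  fixes f :: "real \<times> real \<Rightarrow> real"
  assumes "f \<in> borel_measurable borel"
  shows "set_integrable lborel ({a..b} \<times> {c..d}) f \<longleftrightarrow> integrable (mu a b \<Otimes>\<^sub>M mu c d) f"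
proof -
  have "mu a b \<Otimes>\<^sub>M mu c d = density lborel (\<lambda>p. ennreal (indicator ({a..b} \<times> {c..d}) p))"
    by (simp add: mu_pair_eq ennreal_indicator)
  moreover have "{a..b} \<times> {c..d} \<in> sets borel" by (intro borel_closed closed_Times) auto
  ultimately show ?thesis using assms by (simp add: integrable_density set_integrable_def)
qed

lemma nn_integral_mu_pair:
  fixes f :: "real \<times> real \<Rightarrow> ennreal"
  assumes "f \<in> borel_measurable borel"
  shows "(\<integral>\<^sup>+ p\<in>{a..b} \<times> {c..d}. f p \<partial>lborel) = integral\<^sup>N (mu a b \<Otimes>\<^sub>M mu c d) f"
proof -
  have "{a..b} \<times> {c..d} \<in> sets borel" by (intro borel_closed closed_Times) auto
  then show ?thesis unfolding mu_pair_eq using assms by (subst nn_integral_density) (auto simp: mult.commute)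
qed

lemma set_integral_mu:
  fixes f :: "real \<Rightarrow> real"
  assumes "f \<in> borel_measurable borel"
  shows "(LINT x:{a..b}|lborel. f x) = integral\<^sup>L (mu a b) f"
  by (simp add: integral_mu[OF assms] set_lebesgue_integral_def)

lemma set_integrable_mu:
  fixes f :: "real \<Rightarrow> real"
  assumes "f \<in> borel_measurable borel"
  shows "set_integrable lborel {a..b} f \<longleftrightarrow> integrable (mu a b) f"
  by (simp add: integrable_mu[OF assms] set_integrable_def)

lemma AE_mu_frac: "AE x in mu 0 1. frac x = x"
  using AE_mu_in[of 0 1] AE_mu_neq[of 1 0 1] by eventually_elim (simp add: frac_eq)

lemma integrable_mult_bounded:
  fixes f g :: "'a \<Rightarrow> real"
  assumes f: "integrable M f" and g: "g \<in> borel_measurable M" "\<And>x. \<bar>g x\<bar> \<le> 1"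
  shows "integrable M (\<lambda>x. f x * g x)"
proof (rule Bochner_Integration.integrable_bound[OF f])
  show "(\<lambda>x. f x * g x) \<in> borel_measurable M" using f g(1) by simp
  show "AE x in M. norm (f x * g x) \<le> norm (f x)" using g(2) by (simp add: abs_mult mult_left_le)
qed

section \<open>Trigonometric test functions and bounds for smooth functions\<close>

lemma deriv_tmode: "deriv (tmode P b k) x = dcoef P b k * tmode P (\<not> b) k x"
  by (rule DERIV_imp_deriv[OF tmode_has_derivative])

lemma deriv_cmult_tmode: "deriv (\<lambda>x. a * tmode P b k x) x = a * (dcoef P b k * tmode P (\<not> b) k x)"
  by (intro DERIV_imp_deriv DERIV_cmult tmode_has_derivative)

text \<open>Multiples of products of modes form a class closed under both partial derivatives, so
  smoothness of every order reduces to differentiability within this class.\<close>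

lemma pdiff_tmode:
  "\<exists>a' c c'. pdiff ds (\<lambda>t x. a * (tmode P b k t * tmode Q b' k' x)) = (\<lambda>t x. a' * (tmode P c k t * tmode Q c' k' x))"
proof (induction ds)
  case Nil
  then show ?case by auto
next
  case (Cons d ds)
  then obtain a' c c' where eq: "pdiff ds (\<lambda>t x. a * (tmode P b k t * tmode Q b' k' x)) = (\<lambda>t x. a' * (tmode P c k t * tmode Q c' k' x))" by blast
  show ?case
  proof (cases d)
    case True
    have "deriv (\<lambda>s. a' * (tmode P c k s * tmode Q c' k' x)) t = (a' * dcoef P c k) * (tmode P (\<not> c) k t * tmode Q c' k' x)" for t x
      using deriv_cmult_tmode[of "a' * tmode Q c' k' x" P c k t] by (simp add: mult_ac)
    then show ?thesis using True unfolding pdiff.simps eq by auto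
  next
    case False
    have "deriv (\<lambda>y. a' * (tmode P c k t * tmode Q c' k' y)) x = (a' * dcoef Q c' k') * (tmode P c k t * tmode Q (\<not> c') k' x)" for t x
      using deriv_cmult_tmode[of "a' * tmode P c k t" Q c' k' x] by (simp add: mult_ac)
    then show ?thesis using False unfolding pdiff.simps eq by auto
  qed
qed

text \<open>The period in time is free because test functions are periodic in space only.\<close>

lemma smooth_test_tmode: "smooth_test (\<lambda>t x. tmode P b k t * tmode 1 b' k' x)"
proof -
  have d: "(tmode Q c l \<circ> f) differentiable (at p)" if "f differentiable (at p)" for Q c l and f :: "real \<times> real \<Rightarrow> real" and p
  proof (rule differentiable_chain_at[OF that])
    show "tmode Q c l differentiable (at (f p))"
      using tmode_has_derivative[of Q c l "f p"] real_differentiable_def by blast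
  qed
  have "(\<lambda>p. a * (tmode P c k (fst p) * tmode 1 c' k' (snd p))) differentiable_on UNIV" for a c c'
  proof (rule differentiable_on_subset[of _ UNIV], unfold differentiable_on_def, intro ballI)
    fix p :: "real \<times> real"
    have "(\<lambda>p::real \<times> real. tmode P c k (fst p)) differentiable (at p)" "(\<lambda>p::real \<times> real. tmode 1 c' k' (snd p)) differentiable (at p)"
      using d[of fst p P c k] d[of snd p 1 c' k'] bounded_linear_imp_differentiable[OF bounded_linear_fst]
        bounded_linear_imp_differentiable[OF bounded_linear_snd] by (auto simp: o_def)
    then show "(\<lambda>p. a * (tmode P c k (fst p) * tmode 1 c' k' (snd p))) differentiable (at p within UNIV)"
      by (intro differentiable_mult) auto
  qed simp
  then have "(\<lambda>p. pdiff ds (\<lambda>t x. tmode P b k t * tmode 1 b' k' x) (fst p) (snd p)) differentiable_on UNIV" for ds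
    using pdiff_tmode[of ds 1 P b k 1 b' k'] by auto
  then show ?thesis by (simp add: smooth_test_def smooth2_def periodic_x_def tmode_periodic[of 1, simplified])
qed

lemma dx_tmode: "dx (\<lambda>t x. tmode P b k t * tmode 1 b' k' x) t x = tmode P b k t * (dcoef 1 b' k' * tmode 1 (\<not> b') k' x)"
  unfolding dx_def by (rule deriv_cmult_tmode)

lemma smooth2_continuous: "smooth2 f \<Longrightarrow> continuous_on UNIV (\<lambda>p. pdiff ds f (fst p) (snd p))"
  unfolding smooth2_def by (blast intro: differentiable_imp_continuous_on)

lemma smooth2_measurable: "smooth2 f \<Longrightarrow> case_prod f \<in> borel_measurable (borel \<Otimes>\<^sub>M borel)"
  using smooth2_continuous[of f "[]"] unfolding borel_prod
  by (intro borel_measurable_continuous_onI) (simp add: case_prod_unfold)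

lemma smooth2_bounded:
  assumes "smooth2 f"
  obtains C where "0 \<le> C" "\<And>t x. t \<in> {a..b} \<Longrightarrow> x \<in> {0..1} \<Longrightarrow> \<bar>pdiff ds f t x\<bar> \<le> C"
proof -
  have "compact ({a..b} \<times> {0..1::real})" by (intro compact_Times compact_Icc)
  then have "bounded ((\<lambda>p. pdiff ds f (fst p) (snd p)) ` ({a..b} \<times> {0..1}))"
    by (intro compact_imp_bounded compact_continuous_image continuous_on_subset[OF smooth2_continuous[OF assms]]) auto
  then obtain C where C: "\<And>p. p \<in> {a..b} \<times> {0..1} \<Longrightarrow> \<bar>pdiff ds f (fst p) (snd p)\<bar> \<le> C"
    unfolding bounded_iff by force
  show thesis
  proof (rule that[of "\<bar>C\<bar>"])
    show "\<bar>pdiff ds f t x\<bar> \<le> \<bar>C\<bar>" if "t \<in> {a..b}" "x \<in> {0..1}" for t x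
      using C[of "(t, x)"] that by force
  qed simp
qed

lemma smooth_test_bounded:
  assumes "smooth_test f"
  obtains C where "0 \<le> C" "\<And>t x. t \<in> {a..b} \<Longrightarrow> \<bar>f t x\<bar> \<le> C"
proof -
  have sm: "smooth2 f" and per: "\<And>t x. f t (x + 1) = f t x" using assms by (auto simp: smooth_test_def periodic_x_def)
  obtain C where C: "0 \<le> C" "\<And>t x. t \<in> {a..b} \<Longrightarrow> x \<in> {0..1} \<Longrightarrow> \<bar>pdiff [] f t x\<bar> \<le> C"
    using smooth2_bounded[OF sm] by metis
  show thesis
  proof (rule that[OF C(1)])
    fix t x assume t: "t \<in> {a..b}"
    have "f t (frac x + of_int \<lfloor>x\<rfloor>) = f t (frac x)" by (rule periodic_of_int) (rule per)
    then have "f t x = f t (frac x)" by (simp add: frac_def)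
    moreover have "frac x \<in> {0..1}" using frac_lt_1[of x] frac_ge_0[of x] by (simp add: less_imp_le)
    ultimately show "\<bar>f t x\<bar> \<le> C" using C(2)[OF t, of "frac x"] by simp
  qed
qed

text \<open>The test functions are products of a time mode of period \<open>T\<close> and a space
  mode. For each space mode the time modes isolate almost every time by
  \<open>fourier_unique\<close>, and countability of the space modes gives a common null
  set.\<close>

lemma weak_dx_slices:
  assumes T: "0 < T" and rm [measurable]: "case_prod r \<in> borel_measurable (borel \<Otimes>\<^sub>M borel)"
    and ir: "integrable (mu 0 T \<Otimes>\<^sub>M mu 0 1) (\<lambda>(t, x). r t x)" and w: "weak_dx T r g"
  shows "AE t in mu 0 T. \<forall>b k. dcoef 1 b k * (\<integral>x. r t x * tmode 1 (\<not> b) k x \<partial>mu 0 1) = - (\<integral>x. g t x * tmode 1 b k x \<partial>mu 0 1)"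
proof -
  have gm': "(\<lambda>p. g (fst p) (snd p)) \<in> borel_measurable borel" using w by (simp add: weak_dx_def)
  then have gm [measurable]: "case_prod g \<in> borel_measurable (borel \<Otimes>\<^sub>M borel)"
    by (simp add: borel_prod case_prod_unfold)
  have ig: "integrable (mu 0 T \<Otimes>\<^sub>M mu 0 1) (\<lambda>(t, x). g t x)"
    using w integrable_mu_pair[OF gm'] by (simp add: weak_dx_def case_prod_unfold)
  have "AE t in mu 0 T. dcoef 1 b k * (\<integral>x. r t x * tmode 1 (\<not> b) k x \<partial>mu 0 1) + (\<integral>x. g t x * tmode 1 b k x \<partial>mu 0 1) = 0" for b k
  proof (rule fourier_unique[OF T])
    have i: "integrable (mu 0 T \<Otimes>\<^sub>M mu 0 1) (\<lambda>(t, x). f t x * tmode 1 c k x)"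
      if "integrable (mu 0 T \<Otimes>\<^sub>M mu 0 1) (\<lambda>(t, x). f t x)" for f c
    proof -
      have "integrable (mu 0 T \<Otimes>\<^sub>M mu 0 1) (\<lambda>p. (case p of (t, x) \<Rightarrow> f t x) * tmode 1 c k (snd p))"
        by (rule integrable_mult_bounded[OF that]) (auto simp: abs_tmode_le)
      then show ?thesis by (simp add: case_prod_unfold)
    qed
    show "integrable (mu 0 T) (\<lambda>t. dcoef 1 b k * (\<integral>x. r t x * tmode 1 (\<not> b) k x \<partial>mu 0 1) + (\<integral>x. g t x * tmode 1 b k x \<partial>mu 0 1))"
      using mup.integrable_fst[OF i[OF ir, of "\<not> b"]] mup.integrable_fst[OF i[OF ig, of b]] by simp
    fix b' k'
    let ?\<tau> = "tmode T b' k'"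
    have i2: "integrable (mu 0 T \<Otimes>\<^sub>M mu 0 1) (\<lambda>(t, x). f t x * tmode 1 c k x * ?\<tau> t)"
      if "integrable (mu 0 T \<Otimes>\<^sub>M mu 0 1) (\<lambda>(t, x). f t x)" for f c
    proof -
      have "integrable (mu 0 T \<Otimes>\<^sub>M mu 0 1) (\<lambda>p. (case p of (t, x) \<Rightarrow> f t x * tmode 1 c k x) * ?\<tau> (fst p))"
        by (rule integrable_mult_bounded[OF i[OF that]]) (auto simp: abs_tmode_le)
      then show ?thesis by (simp add: case_prod_unfold)
    qed
    define \<phi> where "\<phi> = (\<lambda>t x. ?\<tau> t * tmode 1 b k x)"
    have "(LINT p:{0..T} \<times> {0..1}|lborel. r (fst p) (snd p) * dx \<phi> (fst p) (snd p)) =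
        - (LINT p:{0..T} \<times> {0..1}|lborel. g (fst p) (snd p) * \<phi> (fst p) (snd p))"
      using w smooth_test_tmode[of T b' k' b k] by (simp add: weak_dx_def \<phi>_def)
    also have "(LINT p:{0..T} \<times> {0..1}|lborel. r (fst p) (snd p) * dx \<phi> (fst p) (snd p))
       = integral\<^sup>L (mu 0 T \<Otimes>\<^sub>M mu 0 1) (\<lambda>p. dcoef 1 b k * (case p of (t, x) \<Rightarrow> r t x * tmode 1 (\<not> b) k x * ?\<tau> t))"
    proof -
      have "(\<lambda>p::real \<times> real. r (fst p) (snd p) * dx \<phi> (fst p) (snd p)) \<in> borel_measurable (borel \<Otimes>\<^sub>M borel)"
        unfolding \<phi>_def dx_tmode by measurable
      then have "(\<lambda>p::real \<times> real. r (fst p) (snd p) * dx \<phi> (fst p) (snd p)) \<in> borel_measurable borel"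
        by (simp only: borel_prod)
      from integral_mu_pair[OF this] show ?thesis
        unfolding \<phi>_def dx_tmode by (simp add: case_prod_unfold mult_ac)
    qed
    also have "\<dots> = dcoef 1 b k * integral\<^sup>L (mu 0 T \<Otimes>\<^sub>M mu 0 1) (\<lambda>(t, x). r t x * tmode 1 (\<not> b) k x * ?\<tau> t)"
      by simp
    also have "\<dots> = dcoef 1 b k * (\<integral>t. (\<integral>x. r t x * tmode 1 (\<not> b) k x \<partial>mu 0 1) * ?\<tau> t \<partial>mu 0 T)"
      by (subst mup.integral_fst[OF i2[OF ir], symmetric]) simp
    also have "(LINT p:{0..T} \<times> {0..1}|lborel. g (fst p) (snd p) * \<phi> (fst p) (snd p))
       = integral\<^sup>L (mu 0 T \<Otimes>\<^sub>M mu 0 1) (\<lambda>(t, x). g t x * tmode 1 b k x * ?\<tau> t)"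
    proof -
      have "(\<lambda>p::real \<times> real. g (fst p) (snd p) * \<phi> (fst p) (snd p)) \<in> borel_measurable (borel \<Otimes>\<^sub>M borel)"
        unfolding \<phi>_def by measurable
      then have "(\<lambda>p::real \<times> real. g (fst p) (snd p) * \<phi> (fst p) (snd p)) \<in> borel_measurable borel"
        by (simp only: borel_prod)
      from integral_mu_pair[OF this] show ?thesis
        by (simp add: \<phi>_def case_prod_unfold mult_ac)
    qed
    also have "\<dots> = (\<integral>t. (\<integral>x. g t x * tmode 1 b k x \<partial>mu 0 1) * ?\<tau> t \<partial>mu 0 T)"
      by (subst mup.integral_fst[OF i2[OF ig], symmetric]) simp
    finally have eq: "dcoef 1 b k * (\<integral>t. (\<integral>x. r t x * tmode 1 (\<not> b) k x \<partial>mu 0 1) * ?\<tau> t \<partial>mu 0 T)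
       = - (\<integral>t. (\<integral>x. g t x * tmode 1 b k x \<partial>mu 0 1) * ?\<tau> t \<partial>mu 0 T)" .
    have j1: "integrable (mu 0 T) (\<lambda>t. (\<integral>x. r t x * tmode 1 (\<not> b) k x \<partial>mu 0 1) * ?\<tau> t)"
      and j2: "integrable (mu 0 T) (\<lambda>t. (\<integral>x. g t x * tmode 1 b k x \<partial>mu 0 1) * ?\<tau> t)"
      using mup.integrable_fst[OF i2[OF ir, of "\<not> b"]] mup.integrable_fst[OF i2[OF ig, of b]] by simp_all
    show "(\<integral>t. (dcoef 1 b k * (\<integral>x. r t x * tmode 1 (\<not> b) k x \<partial>mu 0 1) + (\<integral>x. g t x * tmode 1 b k x \<partial>mu 0 1)) * ?\<tau> t \<partial>mu 0 T) = 0"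
      unfolding distrib_right mult.assoc using j1 j2 eq by simp
  qed
  then have "AE t in mu 0 T. \<forall>b k. dcoef 1 b k * (\<integral>x. r t x * tmode 1 (\<not> b) k x \<partial>mu 0 1) + (\<integral>x. g t x * tmode 1 b k x \<partial>mu 0 1) = 0"
    unfolding AE_all_countable by blast
  then show ?thesis by eventually_elim (metis add_eq_0_iff2)
qed

text \<open>The rank-one part of A pairs \<open>r\<close> with \<open>G r\<close>, which is zero by
  skew-symmetry. The surviving \<open>G c k\<close> comes from the diagonal part, whose
  \<open>lam\<close> cancels the factor \<open>1/lam\<close>.\<close>

lemma flux_algebra:
  fixes r g b :: "nat \<Rightarrow> real" and G :: "nat \<Rightarrow> nat \<Rightarrow> real"
  assumes c: "c < m" and lam: "0 < lam" and skew: "\<And>i j. i < m \<Longrightarrow> j < m \<Longrightarrow> G i j = - G j i"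
  defines "S \<equiv> \<Sum>j<m. r j"
  shows "1/2 * (\<Sum>j<m. Dmat lam m r c j * g j) - (\<Sum>j<m. Amat lam m r c j * (b j - 1/lam * (\<Sum>k<m. G j k * r k)))
    = (lam * g c + r c * (\<Sum>j<m. g j)) / (lam + S) / 2 - r c * (lam * b c + (\<Sum>k<m. (b k - G c k) * r k)) / (lam + S)"
proof -
  have D: "(\<Sum>j<m. Dmat lam m r c j * g j) = (lam * g c + r c * (\<Sum>j<m. g j)) / (lam + S)"
  proof -
    have "(\<Sum>j<m. Dmat lam m r c j * g j) = (\<Sum>j<m. ((if c = j then lam * g j else 0) + r c * g j) / (lam + S))"
      by (intro sum.cong refl) (auto simp: Dmat_def S_def distrib_right)
    then show ?thesis using c by (simp add: sum_divide_distrib[symmetric] sum.distrib sum_distrib_left[symmetric])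
  qed
  define B where "B j = b j - 1/lam * (\<Sum>k<m. G j k * r k)" for j
  have S0: "(\<Sum>i<m. \<Sum>k<m. r i * (G i k * r k)) = 0" (is "?S = 0")
  proof -
    have "?S = (\<Sum>k<m. \<Sum>i<m. r i * (G i k * r k))" by (rule sum.swap)
    also have "\<dots> = (\<Sum>k<m. \<Sum>i<m. - (r k * (G k i * r i)))"
      by (intro sum.cong refl) (subst skew, auto)
    also have "\<dots> = - ?S" by (simp add: sum_negf)
    finally show ?thesis by simp
  qed
  have rB: "(\<Sum>j<m. r j * B j) = (\<Sum>j<m. r j * b j)"
  proof -
    have "(\<Sum>j<m. r j * B j) = (\<Sum>j<m. r j * b j - 1/lam * (\<Sum>k<m. r j * (G j k * r k)))"
      by (intro sum.cong refl) (simp add: B_def right_diff_distrib sum_distrib_left mult_ac)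
    also have "\<dots> = (\<Sum>j<m. r j * b j) - 1/lam * ?S" by (simp only: sum_subtractf sum_distrib_left[symmetric])
    finally show ?thesis using S0 by simp
  qed
  have A: "(\<Sum>j<m. Amat lam m r c j * B j) = (r c * (lam * B c) + r c * (\<Sum>j<m. r j * b j)) / (lam + S)"
  proof -
    have "(\<Sum>j<m. Amat lam m r c j * B j) = (\<Sum>j<m. ((if c = j then lam * r j * B j else 0) + r c * (r j * B j)) / (lam + S))"
      by (intro sum.cong refl) (auto simp: Amat_def S_def distrib_right)
    then show ?thesis using c by (simp add: sum_divide_distrib[symmetric] sum.distrib sum_distrib_left[symmetric] rB)
  qed
  have lB: "lam * B c = lam * b c - (\<Sum>k<m. G c k * r k)" using lam by (simp add: B_def right_diff_distrib)
  have "r c * (lam * B c) + r c * (\<Sum>j<m. r j * b j) = r c * (lam * b c + (\<Sum>k<m. (b k - G c k) * r k))"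
    unfolding lB by (simp add: left_diff_distrib sum_subtractf algebra_simps)
  then show ?thesis unfolding B_def[symmetric] D A by simp
qed

lemma prim_smooth:
  assumes f: "smooth2 f" and per: "\<And>x. f t (x + 1) = f t x"
  shows "prim (f t) (dx f t)"
proof -
  have d: "(\<lambda>p. f (fst p) (snd p)) differentiable_on UNIV"
    using f unfolding smooth2_def by (metis pdiff.simps(1))
  have der: "(f t has_real_derivative dx f t x) (at x)" for x
  proof -
    have "(\<lambda>p. f (fst p) (snd p)) differentiable (at (t, x))" using d by (simp add: differentiable_on_def)
    moreover have "(\<lambda>y. (t, y)) differentiable (at x)" by (rule differentiable_Pair) auto
    ultimately have "((\<lambda>p. f (fst p) (snd p)) \<circ> (\<lambda>y. (t, y))) differentiable (at x)"
      by (intro differentiable_chain_at) auto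
    then have "f t differentiable (at x)" by (simp add: o_def)
    then show ?thesis unfolding dx_def
      using DERIV_deriv_iff_real_differentiable by blast
  qed
  have cont: "continuous_on UNIV (dx f t)"
  proof -
    have "continuous_on UNIV (\<lambda>p. pdiff [False] f (fst p) (snd p))" by (rule smooth2_continuous[OF f])
    then have "continuous_on UNIV (\<lambda>x. pdiff [False] f (fst (t, x)) (snd (t, x)))"
      by (rule continuous_on_compose2[where g="\<lambda>p. pdiff [False] f (fst p) (snd p)"]) (auto intro!: continuous_intros)
    then show ?thesis by (simp add: dx_def[abs_def])
  qed
  have "integrable (mu x y) (dx f t) \<and> f t y = f t x + integral\<^sup>L (mu x y) (dx f t)" if xy: "x \<le> y" for x y
  proof -
    have "bounded (dx f t ` {x..y})"
      by (intro compact_imp_bounded compact_continuous_image continuous_on_subset[OF cont]) auto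
    then obtain C where C: "\<And>z. z \<in> {x..y} \<Longrightarrow> \<bar>dx f t z\<bar> \<le> C" unfolding bounded_iff by force
    have i: "integrable (mu x y) (dx f t)"
    proof (rule integrable_mu_bounded[where B=C])
      show "AE z in mu x y. \<bar>dx f t z\<bar> \<le> C" using AE_mu_in by eventually_elim (rule C)
    qed (rule borel_measurable_continuous_onI[OF cont])
    have "(dx f t has_integral (f t y - f t x)) {x..y}"
      by (rule fundamental_theorem_of_calculus[OF xy])
         (auto simp: has_real_derivative_iff_has_vector_derivative[symmetric] intro!: has_field_derivative_at_within der)
    then have "integral {x..y} (dx f t) = f t y - f t x" by (rule integral_unique)
    then show ?thesis using i mu_has_integral(2)[OF i] by simp
  qed
  then show ?thesis unfolding prim_def using per by blast
qed

text \<open>A nonzero value persists on a subinterval of positive length, also when \<open>t\<close>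
  is an endpoint.\<close>

lemma continuous_AE_zero_Icc:
  fixes d :: "real \<Rightarrow> real"
  assumes c: "continuous_on {0..T} d" and T: "0 < T" and z: "AE t in mu 0 T. d t = 0" and t: "t \<in> {0..T}"
  shows "d t = 0"
proof (rule ccontr)
  assume ne: "d t \<noteq> 0"
  from c t have "\<forall>e>0. \<exists>\<delta>>0. \<forall>x'\<in>{0..T}. dist x' t < \<delta> \<longrightarrow> dist (d x') (d t) < e"
    unfolding continuous_on_iff by blast
  then obtain \<delta> where \<delta>: "\<delta> > 0" "\<And>x'. x'\<in>{0..T} \<Longrightarrow> dist x' t < \<delta> \<Longrightarrow> dist (d x') (d t) < \<bar>d t\<bar>"
    using ne by (metis zero_less_abs_iff)
  define p q where "p = max 0 (t - \<delta>/2)" and "q = min T (t + \<delta>/2)"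
  have pq: "p < q" "0 \<le> p" "q \<le> T" using \<delta>(1) t T by (auto simp: p_def q_def)
  have "AE s in mu p q. False"
    using AE_mu_subset[OF z pq(2,3)] AE_mu_in
  proof eventually_elim
    case (elim s)
    then have "s \<in> {0..T}" "dist s t < \<delta>" using pq \<delta>(1) by (auto simp: p_def q_def dist_real_def)
    then have "dist (d s) (d t) < \<bar>d t\<bar>" by (rule \<delta>(2))
    then show ?case using elim by (simp add: dist_real_def)
  qed
  then have "AE s in mu p q. (1::real) = 0" by eventually_elim simp
  then have "(\<integral>s. 1 \<partial>mu p q) = (0::real)" by (rule integral_eq_zero_AE)
  then show False using pq by (simp add: measure_mu)
qed

section \<open>From finite entropy cost to periodic solutions\<close>

text \<open>Extension by zero, as \<open>energy_state\<close> makes its assumptions for every index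
  and not only for colours below \<open>m\<close>.\<close>

definition ext1 :: "nat \<Rightarrow> (nat \<Rightarrow> real \<Rightarrow> real \<Rightarrow> real) \<Rightarrow> nat \<Rightarrow> real \<Rightarrow> real \<Rightarrow> real" where
  "ext1 m f c t x = (if c < m then f c t x else 0)"

definition ext2 :: "nat \<Rightarrow> (nat \<Rightarrow> nat \<Rightarrow> real \<Rightarrow> real \<Rightarrow> real) \<Rightarrow> nat \<Rightarrow> nat \<Rightarrow> real \<Rightarrow> real \<Rightarrow> real" where
  "ext2 m f i j t x = (if i < m \<and> j < m then f i j t x else 0)"

text \<open>Densities are only controlled on \<open>[0,1]\<close>; they are replaced by their periodic extensions.\<close>

definition extp :: "nat \<Rightarrow> (nat \<Rightarrow> real \<Rightarrow> real \<Rightarrow> real) \<Rightarrow> nat \<Rightarrow> real \<Rightarrow> real \<Rightarrow> real" where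
  "extp m f c t x = (if c < m then f c t (frac x) else 0)"

lemma frac_add_1: "frac (x + 1 :: real) = frac x"
  by (simp add: frac_def)

lemma extp_per: "extp m f c t (x + 1) = extp m f c t x"
  by (simp add: extp_def frac_add_1)

lemma frac_Icc: "frac (x :: real) \<in> {0..1}"
  using frac_lt_1[of x] frac_ge_0[of x] by (simp add: less_imp_le)

lemma frac_measurable: "(frac :: real \<Rightarrow> real) \<in> borel_measurable borel"
  unfolding frac_def by measurable

text \<open>The data of a single solution. \<open>gD\<close> is the gradient of the energy
  condition; the weak formulation comes with a gradient of its own, and \<open>mode_identity\<close>
  identifies the two.\<close>

locale color_setup =
  fixes m :: nat and lam T beta eta :: real and rbar :: "nat \<Rightarrow> real"
    and b :: "nat \<Rightarrow> real \<Rightarrow> real \<Rightarrow> real" and G :: "nat \<Rightarrow> nat \<Rightarrow> real \<Rightarrow> real \<Rightarrow> real"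
    and \<gamma>0 :: "nat \<Rightarrow> real \<Rightarrow> real" and \<rho> gD :: "nat \<Rightarrow> real \<Rightarrow> real \<Rightarrow> real"
  assumes lam: "0 < lam" and T: "0 < T" and P0: "P0 m b G eta"
    and D: "Dcolor m lam T rbar \<rho> gD" and sol: "weak_solution m lam T b G \<gamma>0 \<rho>"
    and b_bd: "\<And>c t x. c < m \<Longrightarrow> t \<in> {0..T} \<Longrightarrow> \<bar>b c t x\<bar> \<le> beta"
    and G_bd: "\<And>i j t x. i < m \<Longrightarrow> j < m \<Longrightarrow> t \<in> {0..T} \<Longrightarrow> \<bar>G i j t x\<bar> \<le> beta"
    and beta: "0 \<le> beta"
begin

abbreviation "r \<equiv> extp m \<rho>"
abbreviation "g \<equiv> extp m gD"
abbreviation "M \<equiv> \<lambda>c. if c < m then rbar c else 0"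

section \<open>Regularity of one density and of its periodic extension\<close>

lemma rho_m: "c < m \<Longrightarrow> case_prod (\<rho> c) \<in> borel_measurable (borel \<Otimes>\<^sub>M borel)"
  using D by (simp add: Dcolor_def borel_prod case_prod_unfold)

lemma gD_m: "c < m \<Longrightarrow> case_prod (gD c) \<in> borel_measurable (borel \<Otimes>\<^sub>M borel)"
  using D by (simp add: Dcolor_def weak_dx_def borel_prod case_prod_unfold)

lemma extp_m:
  assumes "\<And>c. c < m \<Longrightarrow> case_prod (f c) \<in> borel_measurable (borel \<Otimes>\<^sub>M borel)"
  shows "case_prod (extp m f c) \<in> borel_measurable (borel \<Otimes>\<^sub>M borel)"
proof (cases "c < m")
  case True
  have [measurable]: "case_prod (f c) \<in> borel_measurable (borel \<Otimes>\<^sub>M borel)" by (rule assms[OF True])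
  have [measurable]: "(frac :: real \<Rightarrow> real) \<in> borel_measurable borel" by (rule frac_measurable)
  have "(\<lambda>p. f c (fst p) (frac (snd p))) \<in> borel_measurable (borel \<Otimes>\<^sub>M borel)" by measurable
  then show ?thesis using True by (simp add: extp_def case_prod_unfold)
qed (simp add: extp_def case_prod_unfold)

lemma extp_eq: "frac x = x \<Longrightarrow> c < m \<Longrightarrow> extp m f c t x = f c t x"
  by (simp add: extp_def)

lemma section_m: "case_prod f \<in> borel_measurable (borel \<Otimes>\<^sub>M borel) \<Longrightarrow> f t \<in> borel_measurable borel" for f :: "real \<Rightarrow> real \<Rightarrow> real"
  using measurable_Pair2[of "case_prod f" borel borel borel t] by simp

lemma rho_slice:
  assumes c: "c < m" and t: "t \<in> {0..T}"
  shows "integrable (mu 0 1) (\<rho> c t)" "(\<integral>x. \<rho> c t x \<partial>mu 0 1) = rbar c"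
  using D c t set_integrable_mu[OF section_m[OF rho_m[OF c]], of 0 1 t] set_integral_mu[OF section_m[OF rho_m[OF c]], of 0 1 t]
  by (auto simp: Dcolor_def)

lemma rho_nonneg: "c < m \<Longrightarrow> t \<in> {0..T} \<Longrightarrow> x \<in> {0..1} \<Longrightarrow> 0 \<le> \<rho> c t x"
  using D by (auto simp: Dcolor_def)

lemma rho_int: "c < m \<Longrightarrow> integrable (mu 0 T \<Otimes>\<^sub>M mu 0 1) (\<lambda>(t, x). \<rho> c t x)"
proof -
  assume c: "c < m"
  show ?thesis
  proof (rule integrable_mu_pairI[OF rho_m[OF c]])
    show "AE t in mu 0 T. integrable (mu 0 1) (\<rho> c t)" using AE_mu_in by eventually_elim (rule rho_slice[OF c])
    show "AE t in mu 0 T. (\<integral>x. \<bar>\<rho> c t x\<bar> \<partial>mu 0 1) \<le> rbar c"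
      using AE_mu_in
    proof eventually_elim
      case (elim t)
      have "(\<integral>x. \<bar>\<rho> c t x\<bar> \<partial>mu 0 1) = (\<integral>x. \<rho> c t x \<partial>mu 0 1)"
      proof (rule integral_cong_AE)
        show "AE x in mu 0 1. \<bar>\<rho> c t x\<bar> = \<rho> c t x"
          using AE_mu_in by eventually_elim (simp add: rho_nonneg[OF c elim])
      qed (use section_m[OF rho_m[OF c], of t] in auto)
      then show ?case using rho_slice(2)[OF c elim] by simp
    qed
  qed simp
qed

lemma gD_weak: "c < m \<Longrightarrow> weak_dx T (\<rho> c) (gD c)"
  using D by (simp add: Dcolor_def)

lemma weak_dx_int: "weak_dx T f h \<Longrightarrow> integrable (mu 0 T \<Otimes>\<^sub>M mu 0 1) (\<lambda>(t, x). h t x)"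
  using integrable_mu_pair[of "\<lambda>p. h (fst p) (snd p)" 0 T 0 1] by (simp add: weak_dx_def case_prod_unfold)

lemma AE_pair_frac:
  "AE p in mu 0 T \<Otimes>\<^sub>M mu 0 1. fst p \<in> {0..T} \<and> frac (snd p) = snd p"
proof (rule AE_mu_pairI)
  have [measurable]: "(frac :: real \<Rightarrow> real) \<in> borel_measurable borel" by (rule frac_measurable)
  show "Measurable.pred (borel \<Otimes>\<^sub>M borel) (\<lambda>p. fst p \<in> {0..T} \<and> frac (snd p) = (snd p :: real))"
    by measurable
  show "AE t in mu 0 T. AE x in mu 0 1. t \<in> {0..T} \<and> frac x = x"
    using AE_mu_in by eventually_elim (use AE_mu_frac in simp)
qed

text \<open>The energy is finite as a whole and its terms are nonnegative at times in [0, T], so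
  each term is dominated by the integrable sum.\<close>

lemma energy_pieces:
  "integrable (mu 0 T \<Otimes>\<^sub>M mu 0 1) (\<lambda>(t, x). (\<Sum>c<m. g c t x)\<^sup>2 / (lam + (\<Sum>c<m. r c t x)))"
  "integrable (mu 0 T \<Otimes>\<^sub>M mu 0 1) (\<lambda>(t, x). (g c t x)\<^sup>2 / ((lam + (\<Sum>c<m. r c t x)) * r c t x))"
proof -
  have [measurable]: "case_prod (r c) \<in> borel_measurable (borel \<Otimes>\<^sub>M borel)" for c by (rule extp_m[OF rho_m])
  have [measurable]: "case_prod (g c) \<in> borel_measurable (borel \<Otimes>\<^sub>M borel)" for c by (rule extp_m[OF gD_m])
  define e0 where "e0 p = (\<Sum>c<m. g c (fst p) (snd p))\<^sup>2 / (lam + (\<Sum>c<m. r c (fst p) (snd p)))" for p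
  define e1 where "e1 c p = (g c (fst p) (snd p))\<^sup>2 / ((lam + (\<Sum>c<m. r c (fst p) (snd p))) * r c (fst p) (snd p))" for c p
  define e where "e p = e0 p + (\<Sum>c<m. e1 c p)" for p
  have [measurable]: "e0 \<in> borel_measurable (borel \<Otimes>\<^sub>M borel)" "e1 c \<in> borel_measurable (borel \<Otimes>\<^sub>M borel)" for c
    unfolding e0_def[abs_def] e1_def[abs_def] by measurable
  have em [measurable]: "e \<in> borel_measurable (borel \<Otimes>\<^sub>M borel)" unfolding e_def[abs_def] by measurable
  define f where "f p = (\<Sum>c<m. gD c (fst p) (snd p))\<^sup>2 / (lam + (\<Sum>c<m. \<rho> c (fst p) (snd p)))
           + (\<Sum>c<m. (gD c (fst p) (snd p))\<^sup>2 /
                ((lam + (\<Sum>c'<m. \<rho> c' (fst p) (snd p))) * \<rho> c (fst p) (snd p)))" for p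
  have fm: "f \<in> borel_measurable (borel \<Otimes>\<^sub>M borel)"
  proof -
    have [measurable]: "(\<lambda>p. \<rho> c (fst p) (snd p)) \<in> borel_measurable (borel \<Otimes>\<^sub>M borel)"
      "(\<lambda>p. gD c (fst p) (snd p)) \<in> borel_measurable (borel \<Otimes>\<^sub>M borel)" if "c < m" for c
      using rho_m[OF that] gD_m[OF that] by (simp_all add: case_prod_unfold)
    show ?thesis unfolding f_def[abs_def]
      by (intro borel_measurable_add borel_measurable_divide borel_measurable_power borel_measurable_sum borel_measurable_times
          borel_measurable_const) auto
  qed
  have nn: "0 \<le> e0 p" "0 \<le> e1 c p" if "fst p \<in> {0..T}" for c p
  proof -
    have r0: "0 \<le> r c (fst p) (snd p)" for c using rho_nonneg[OF _ that frac_Icc] by (simp add: extp_def)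
    then have "0 \<le> (\<Sum>c<m. r c (fst p) (snd p))" by (intro sum_nonneg)
    then show "0 \<le> e0 p" "0 \<le> e1 c p" using r0[of c] lam by (auto simp: e0_def e1_def)
  qed
  have ef: "AE p in mu 0 T \<Otimes>\<^sub>M mu 0 1. f p = e p"
    using AE_pair_frac by eventually_elim (simp add: f_def e_def e0_def e1_def extp_eq)
  have "(\<integral>\<^sup>+ p. ennreal (e p) \<partial>(mu 0 T \<Otimes>\<^sub>M mu 0 1)) = (\<integral>\<^sup>+ p. ennreal (f p) \<partial>(mu 0 T \<Otimes>\<^sub>M mu 0 1))"
    by (rule nn_integral_cong_AE) (use ef in \<open>auto elim: eventually_mono\<close>)
  also have "\<dots> = (\<integral>\<^sup>+ p\<in>{0..T} \<times> {0..1}. ennreal (f p) \<partial>lborel)"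
    using fm by (intro nn_integral_mu_pair[symmetric]) (simp add: borel_prod)
  also have "\<dots> < \<infinity>" using D unfolding Dcolor_def f_def by simp
  finally have fin: "(\<integral>\<^sup>+ p. ennreal (e p) \<partial>(mu 0 T \<Otimes>\<^sub>M mu 0 1)) < \<infinity>" .
  have ie: "integrable (mu 0 T \<Otimes>\<^sub>M mu 0 1) e"
  proof (rule integrableI_nonneg)
    show "AE p in mu 0 T \<Otimes>\<^sub>M mu 0 1. 0 \<le> e p"
      using AE_pair_frac by eventually_elim (auto simp: e_def intro!: add_nonneg_nonneg sum_nonneg nn)
  qed (use fin in simp_all)
  have "integrable (mu 0 T \<Otimes>\<^sub>M mu 0 1) e0"
  proof (rule Bochner_Integration.integrable_bound[OF ie])
    show "AE p in mu 0 T \<Otimes>\<^sub>M mu 0 1. norm (e0 p) \<le> norm (e p)"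
      using AE_pair_frac
    proof eventually_elim
      case (elim p)
      have "0 \<le> (\<Sum>c<m. e1 c p)" using nn elim by (intro sum_nonneg) auto
      then show ?case using nn(1)[of p] elim by (simp add: e_def)
    qed
  qed simp
  then show "integrable (mu 0 T \<Otimes>\<^sub>M mu 0 1) (\<lambda>(t, x). (\<Sum>c<m. g c t x)\<^sup>2 / (lam + (\<Sum>c<m. r c t x)))"
    by (simp add: e0_def[abs_def] case_prod_unfold)
  have "integrable (mu 0 T \<Otimes>\<^sub>M mu 0 1) (e1 c)"
  proof (cases "c < m")
    case True
    show ?thesis
    proof (rule Bochner_Integration.integrable_bound[OF ie])
      show "AE p in mu 0 T \<Otimes>\<^sub>M mu 0 1. norm (e1 c p) \<le> norm (e p)"
        using AE_pair_frac
      proof eventually_elim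
        case (elim p)
        have "e1 c p \<le> (\<Sum>c<m. e1 c p)" using nn elim True by (intro member_le_sum) auto
        then show ?case using nn(1)[of p] nn(2)[of p c] elim by (simp add: e_def)
      qed
    qed simp
  next
    case False
    then have "e1 c = (\<lambda>_. 0)" by (simp add: e1_def[abs_def] extp_def)
    then show ?thesis by simp
  qed
  then show "integrable (mu 0 T \<Otimes>\<^sub>M mu 0 1) (\<lambda>(t, x). (g c t x)\<^sup>2 / ((lam + (\<Sum>c<m. r c t x)) * r c t x))"
    by (simp add: e1_def[abs_def] case_prod_unfold)
qed

lemma extp_cong_AE: "c < m \<Longrightarrow> AE x in mu 0 1. extp m f c t x = f c t x"
  using AE_mu_frac by eventually_elim (simp add: extp_eq)

lemma extp_section_m:
  assumes "case_prod (f c) \<in> borel_measurable (borel \<Otimes>\<^sub>M borel)" "c < m"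
  shows "extp m f c t \<in> borel_measurable borel"
proof -
  have [measurable]: "f c t \<in> borel_measurable borel" by (rule section_m[OF assms(1)])
  have [measurable]: "(frac :: real \<Rightarrow> real) \<in> borel_measurable borel" by (rule frac_measurable)
  have "(\<lambda>x. f c t (frac x)) \<in> borel_measurable borel" by measurable
  then show ?thesis using assms(2) by (simp add: extp_def[abs_def])
qed

text \<open>The modes determine \<open>p\<close> as a primitive of \<open>q\<close> on the unit
  interval; the periodic versions \<open>P\<close> and \<open>Q\<close> carry this to the whole
  line.\<close>

lemma modes_prim:
  fixes p q P Q :: "real \<Rightarrow> real"
  assumes p: "integrable (mu 0 1) p" and q: "integrable (mu 0 1) q"
    and modes: "\<And>b k. dcoef 1 b k * (\<integral>x. p x * tmode 1 (\<not> b) k x \<partial>mu 0 1) = - (\<integral>x. q x * tmode 1 b k x \<partial>mu 0 1)"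
    and P: "P \<in> borel_measurable borel" "\<And>x. P (x + 1) = P x" "AE x in mu 0 1. P x = p x"
    and Q: "Q \<in> borel_measurable borel" "\<And>x. Q (x + 1) = Q x" "AE x in mu 0 1. Q x = q x"
  shows "\<exists>A. prim A Q \<and> (AE x in lborel. P x = A x)"
proof -
  have q0: "(\<integral>x. q x \<partial>mu 0 1) = 0" by (rule weak_derivative_1d(1)[OF p q modes])
  obtain C where C: "AE x in mu 0 1. p x = C + integral\<^sup>L (mu 0 x) q"
    using weak_derivative_1d(2)[OF p q modes] by blast
  have qm: "q \<in> borel_measurable borel" by (rule integrable_mu_meas[OF q])
  have Qi: "integrable (mu 0 1) Q"
    by (rule integrable_cong_AE_imp[OF q]) (use Q qm in \<open>auto elim: eventually_mono\<close>)
  have eq: "integral\<^sup>L (mu 0 x) Q = integral\<^sup>L (mu 0 x) q" if "x \<le> 1" for x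
    by (rule integral_cong_AE) (use Q qm AE_mu_subset[OF Q(3), of 0 x] that in auto)
  have Q0: "(\<integral>x. Q x \<partial>mu 0 1) = 0" using eq[of 1] q0 by simp
  have W: "AE x in mu 0 1. P x = C + integral\<^sup>L (mu 0 x) Q"
    using C P(3) AE_mu_in by eventually_elim (simp add: eq)
  obtain A where "prim A Q" "AE x in lborel. P x = A x"
    by (rule prim_exists[OF Q(2) P(2) Qi Q0 W])
  then show ?thesis by blast
qed

lemma slice_modes:
  "c < m \<Longrightarrow> weak_dx T (\<rho> c) h \<Longrightarrow>
    AE t in mu 0 T. \<forall>b k. dcoef 1 b k * (\<integral>x. \<rho> c t x * tmode 1 (\<not> b) k x \<partial>mu 0 1) = - (\<integral>x. h t x * tmode 1 b k x \<partial>mu 0 1)"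
  by (rule weak_dx_slices[OF T rho_m rho_int])

lemma slice: "AE t in mu 0 T. \<exists>A. prim A (g c t) \<and> (AE x in lborel. r c t x = A x)"
proof (cases "c < m")
  case False
  then show ?thesis by (intro AE_I2 exI[of _ "\<lambda>_. 0"]) (simp add: extp_def[abs_def] prim_const)
next
  case True
  show ?thesis
    using slice_modes[OF True gD_weak[OF True]] mup.AE_integrable_fst[OF weak_dx_int[OF gD_weak[OF True]]] AE_mu_in
  proof eventually_elim
    case (elim t)
    show ?case
      by (rule modes_prim[where p="\<rho> c t" and q="gD c t"])
        (use elim True in \<open>auto simp: rho_slice extp_cong_AE extp_section_m rho_m gD_m extp_per\<close>)
  qed
qed

lemma r_slice: "t \<in> {0..T} \<Longrightarrow> integrable (mu 0 1) (r c t) \<and> (\<integral>x. r c t x \<partial>mu 0 1) = M c"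
proof -
  assume t: "t \<in> {0..T}"
  show ?thesis
  proof (cases "c < m")
    case True
    have ae: "AE x in mu 0 1. r c t x = \<rho> c t x" by (rule extp_cong_AE[OF True])
    have m1: "r c t \<in> borel_measurable borel" by (rule extp_section_m[of \<rho>, OF rho_m[OF True] True])
    have m2: "\<rho> c t \<in> borel_measurable borel" by (rule section_m[OF rho_m[OF True]])
    have "integrable (mu 0 1) (r c t)" using integrable_cong_AE[OF _ _ ae] m1 m2 rho_slice(1)[OF True t] by simp
    moreover have "(\<integral>x. r c t x \<partial>mu 0 1) = (\<integral>x. \<rho> c t x \<partial>mu 0 1)"
      by (rule integral_cong_AE[OF _ _ ae]) (use m1 m2 in auto)
    ultimately show ?thesis using rho_slice(2)[OF True t] True by simp
  qed (simp add: extp_def[abs_def])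
qed

lemma g_int: "integrable (mu 0 T \<Otimes>\<^sub>M mu 0 1) (\<lambda>(t, x). g c t x)"
proof (cases "c < m")
  case True
  have "integrable (mu 0 T \<Otimes>\<^sub>M mu 0 1) (\<lambda>p. g c (fst p) (snd p))"
  proof (rule integrable_cong_AE_imp)
    show "integrable (mu 0 T \<Otimes>\<^sub>M mu 0 1) (\<lambda>p. gD c (fst p) (snd p))"
      using weak_dx_int[OF gD_weak[OF True]] by (simp add: case_prod_unfold)
    show "AE p in mu 0 T \<Otimes>\<^sub>M mu 0 1. gD c (fst p) (snd p) = g c (fst p) (snd p)"
      using AE_pair_frac by eventually_elim (simp add: extp_eq True)
    show "(\<lambda>p. g c (fst p) (snd p)) \<in> borel_measurable (mu 0 T \<Otimes>\<^sub>M mu 0 1)"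
      using extp_m[of gD c, OF gD_m] by (simp add: case_prod_unfold)
  qed
  then show ?thesis by (simp add: case_prod_unfold)
qed (simp add: extp_def case_prod_unfold)

lemma b_smooth: "c < m \<Longrightarrow> smooth_test (b c)" using P0 by (simp add: P0_def)
lemma G_smooth: "i < m \<Longrightarrow> j < m \<Longrightarrow> smooth_test (G i j)" using P0 by (simp add: P0_def)
lemma G_skew: "i < m \<Longrightarrow> j < m \<Longrightarrow> G i j t x = - G j i t x" using P0 unfolding P0_def by blast

sublocale S: energy_state m lam T beta "ext1 m b" "ext2 m G" r g M
proof
  fix c i j :: nat and t x :: real
  show "0 < lam" by (rule lam)
  show "0 \<le> T" using T by simp
  show "case_prod (ext1 m b c) \<in> borel_measurable (borel \<Otimes>\<^sub>M borel)"
    using smooth2_measurable[of "b c"] b_smooth[of c] by (cases "c < m") (auto simp: ext1_def[abs_def] smooth_test_def case_prod_unfold)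
  show "case_prod (ext2 m G i j) \<in> borel_measurable (borel \<Otimes>\<^sub>M borel)"
    using smooth2_measurable[of "G i j"] G_smooth[of i j] by (cases "i < m \<and> j < m") (auto simp: ext2_def[abs_def] smooth_test_def case_prod_unfold)
  show "case_prod (r c) \<in> borel_measurable (borel \<Otimes>\<^sub>M borel)" by (rule extp_m[OF rho_m])
  show "case_prod (g c) \<in> borel_measurable (borel \<Otimes>\<^sub>M borel)" by (rule extp_m[OF gD_m])
  show "ext1 m b c t (x + 1) = ext1 m b c t x" using b_smooth[of c] by (simp add: ext1_def smooth_test_def periodic_x_def)
  show "ext2 m G i j t (x + 1) = ext2 m G i j t x" using G_smooth[of i j] by (simp add: ext2_def smooth_test_def periodic_x_def)
  show "r c t (x + 1) = r c t x" "g c t (x + 1) = g c t x" by (simp_all add: extp_def frac_add_1)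
  show "ext2 m G i j t x = - ext2 m G j i t x" using G_skew[of i j t x] by (simp add: ext2_def)
  show "integrable (mu 0 T \<Otimes>\<^sub>M mu 0 1) (\<lambda>(t, x). g c t x)" by (rule g_int)
  show "AE t in mu 0 T. \<exists>A. prim A (g c t) \<and> (AE x in lborel. r c t x = A x)" by (rule slice)
  show "integrable (mu 0 T \<Otimes>\<^sub>M mu 0 1) (\<lambda>(t, x). (\<Sum>c<m. g c t x)\<^sup>2 / (lam + (\<Sum>c<m. r c t x)))"
    "integrable (mu 0 T \<Otimes>\<^sub>M mu 0 1) (\<lambda>(t, x). (g c t x)\<^sup>2 / ((lam + (\<Sum>c<m. r c t x)) * r c t x))"
    by (rule energy_pieces)+
  assume t: "t \<in> {0..T}"
  have r0: "0 \<le> r c t x" for c using rho_nonneg[OF _ t frac_Icc] by (simp add: extp_def)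
  show "\<bar>ext1 m b c t x\<bar> \<le> beta" using b_bd[OF _ t] beta by (simp add: ext1_def)
  show "\<bar>ext2 m G i j t x\<bar> \<le> beta" using G_bd[OF _ _ t] beta by (simp add: ext2_def)
  show "0 \<le> r c t x" by (rule r0)
  show "integrable (mu 0 1) (r c t)" "(\<integral>x. r c t x \<partial>mu 0 1) = M c" using r_slice[OF t] by auto
  show "r c t x \<le> (\<Sum>j<m. r j t x)"
  proof (cases "c < m")
    case True
    then show ?thesis by (intro member_le_sum[of c _ "\<lambda>c. r c t x"]) (auto intro: r0)
  next
    case False
    then have "r c t x = 0" by (simp add: extp_def)
    then show ?thesis by (simp add: sum_nonneg r0)
  qed
qed

lemma modes_AE_eq:
  assumes f: "integrable (mu 0 1) f" and h: "integrable (mu 0 1) h"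
    and eq: "\<And>b k. (\<integral>x. f x * tmode 1 b k x \<partial>mu 0 1) = (\<integral>x. h x * tmode 1 b k x \<partial>mu 0 1)"
  shows "AE x in mu 0 1. f x = h x"
proof -
  have "AE x in mu 0 1. f x - h x = 0"
  proof (rule fourier_unique)
    show "integrable (mu 0 1) (\<lambda>x. f x - h x)" using f h by simp
    show "(\<integral>x. (f x - h x) * tmode 1 b k x \<partial>mu 0 1) = 0" for b k
      using integrable_tmode[OF f, of 1 b k] integrable_tmode[OF h, of 1 b k] eq[of b k]
      by (simp add: left_diff_distrib)
  qed simp
  then show ?thesis by simp
qed

text \<open>The weak formulation is tested with one colour and one space mode that is constant in
  time, so the term with the time derivative drops out. The initial datum enters only through its
  modes.\<close>

lemma mode_identity:
  assumes c: "c < m" and t: "t \<in> {0..T}"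
  shows "(\<integral>x. \<rho> c t x * tmode 1 b' k x \<partial>mu 0 1) - (LINT x:{0..1}|lborel. tmode 1 b' k x * \<gamma>0 c x)
    = - dcoef 1 b' k * (\<integral>x. integral\<^sup>L (mu 0 t) (\<lambda>s. S.flux c s x) * tmode 1 (\<not> b') k x \<partial>mu 0 1)"
proof -
  obtain gW where gW: "\<And>c. c < m \<Longrightarrow> weak_dx T (\<rho> c) (gW c)"
    and form: "\<And>\<phi>. (\<forall>c<m. smooth_test (\<phi> c)) \<Longrightarrow> (\<forall>t\<in>{0..T}.
          (\<Sum>c<m. LINT x:{0..1}|lborel. \<phi> c t x * \<rho> c t x)
        - (\<Sum>c<m. LINT x:{0..1}|lborel. \<phi> c 0 x * \<gamma>0 c x)
        - (LINT p:{0..t} \<times> {0..1}|lborel. \<Sum>c<m. dt (\<phi> c) (fst p) (snd p) * \<rho> c (fst p) (snd p))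
        = (LINT p:{0..t} \<times> {0..1}|lborel.
             (let s = fst p; x = snd p; r = (\<lambda>c. \<rho> c s x) in
               - 1/2 * (\<Sum>i<m. \<Sum>j<m. dx (\<phi> i) s x * Dmat lam m r i j * gW j s x)
               + (\<Sum>i<m. \<Sum>j<m. dx (\<phi> i) s x * Amat lam m r i j *
                    (b j s x - 1/lam * (\<Sum>k<m. G j k s x * \<rho> k s x))))))"
    using sol unfolding weak_solution_def by blast
  have gW_m: "case_prod (gW c) \<in> borel_measurable (borel \<Otimes>\<^sub>M borel)" if "c < m" for c
    using gW[OF that] by (simp add: weak_dx_def borel_prod case_prod_unfold)
  define \<phi> where "\<phi> i = (if i = c then (\<lambda>(t::real) x. tmode 1 b' k x) else (\<lambda>t x. 0))" for i
  \<comment> \<open>At time frequency 0 the cosine mode is 1 and the sine mode is 0, which covers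
    both branches of \<open>\<phi>\<close>.\<close>
  have sm: "\<forall>c<m. smooth_test (\<phi> c)"
    using smooth_test_tmode[of 1 True 0 b' k] smooth_test_tmode[of 1 False 0 b' k] by (simp add: \<phi>_def)
  have dtz: "dt (\<phi> i) = (\<lambda>t x. 0)" for i by (auto simp: dt_def[abs_def] \<phi>_def)
  have dxz: "dx (\<phi> i) = (\<lambda>t x. if i = c then dcoef 1 b' k * tmode 1 (\<not> b') k x else 0)" for i
    by (auto simp: dx_def[abs_def] \<phi>_def deriv_tmode fun_eq_iff)
  define d where "d x = dcoef 1 b' k * tmode 1 (\<not> b') k x" for x
  define fl where "fl s x = 1/2 * (\<Sum>j<m. Dmat lam m (\<lambda>c. \<rho> c s x) c j * gW j s x)
      - (\<Sum>j<m. Amat lam m (\<lambda>c. \<rho> c s x) c j * (b j s x - 1/lam * (\<Sum>k<m. G j k s x * \<rho> k s x)))" for s x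
  have one: "(\<Sum>i<m. if i = c then h i else 0) = h c" for h :: "nat \<Rightarrow> real" using c by simp
  have integrand: "(let s = fst p; x = snd p; r = (\<lambda>c. \<rho> c s x) in
               - 1/2 * (\<Sum>i<m. \<Sum>j<m. dx (\<phi> i) s x * Dmat lam m r i j * gW j s x)
               + (\<Sum>i<m. \<Sum>j<m. dx (\<phi> i) s x * Amat lam m r i j *
                    (b j s x - 1/lam * (\<Sum>k<m. G j k s x * \<rho> k s x)))) = - (d (snd p) * fl (fst p) (snd p))" for p
  proof -
    obtain s x where p: "p = (s, x)" by (cases p)
    have 1: "(\<Sum>i<m. \<Sum>j<m. dx (\<phi> i) s x * Dmat lam m (\<lambda>c. \<rho> c s x) i j * gW j s x)
        = d x * (\<Sum>j<m. Dmat lam m (\<lambda>c. \<rho> c s x) c j * gW j s x)"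
    proof -
      have "(\<Sum>i<m. \<Sum>j<m. dx (\<phi> i) s x * Dmat lam m (\<lambda>c. \<rho> c s x) i j * gW j s x)
        = (\<Sum>i<m. if i = c then d x * (\<Sum>j<m. Dmat lam m (\<lambda>c. \<rho> c s x) i j * gW j s x) else 0)"
        by (intro sum.cong refl) (simp add: dxz d_def sum_distrib_left mult.assoc)
      then show ?thesis unfolding one .
    qed
    have 2: "(\<Sum>i<m. \<Sum>j<m. dx (\<phi> i) s x * Amat lam m (\<lambda>c. \<rho> c s x) i j * (b j s x - 1/lam * (\<Sum>k<m. G j k s x * \<rho> k s x)))
        = d x * (\<Sum>j<m. Amat lam m (\<lambda>c. \<rho> c s x) c j * (b j s x - 1/lam * (\<Sum>k<m. G j k s x * \<rho> k s x)))"
    proof -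
      have "(\<Sum>i<m. \<Sum>j<m. dx (\<phi> i) s x * Amat lam m (\<lambda>c. \<rho> c s x) i j * (b j s x - 1/lam * (\<Sum>k<m. G j k s x * \<rho> k s x)))
        = (\<Sum>i<m. if i = c then d x * (\<Sum>j<m. Amat lam m (\<lambda>c. \<rho> c s x) i j * (b j s x - 1/lam * (\<Sum>k<m. G j k s x * \<rho> k s x))) else 0)"
        by (intro sum.cong refl) (simp add: dxz d_def sum_distrib_left mult.assoc)
      then show ?thesis unfolding one .
    qed
    show ?thesis unfolding p Let_def fst_conv snd_conv 1 2 fl_def by (simp add: algebra_simps)
  qed
  have lhs1: "(\<Sum>i<m. LINT x:{0..1}|lborel. \<phi> i t x * \<rho> i t x) = (\<integral>x. \<rho> c t x * tmode 1 b' k x \<partial>mu 0 1)"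
  proof -
    have "(\<Sum>i<m. LINT x:{0..1}|lborel. \<phi> i t x * \<rho> i t x) = (\<Sum>i<m. if i = c then LINT x:{0..1}|lborel. tmode 1 b' k x * \<rho> i t x else 0)"
      by (intro sum.cong refl) (simp add: \<phi>_def)
    also have "\<dots> = (LINT x:{0..1}|lborel. tmode 1 b' k x * \<rho> c t x)" by (rule one)
    also have "\<dots> = (\<integral>x. \<rho> c t x * tmode 1 b' k x \<partial>mu 0 1)"
      using section_m[OF rho_m[OF c], of t] by (subst set_integral_mu) (simp_all add: mult.commute)
    finally show ?thesis .
  qed
  have lhs2: "(\<Sum>i<m. LINT x:{0..1}|lborel. \<phi> i 0 x * \<gamma>0 i x) = (LINT x:{0..1}|lborel. tmode 1 b' k x * \<gamma>0 c x)"
  proof -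
    have "(\<Sum>i<m. LINT x:{0..1}|lborel. \<phi> i 0 x * \<gamma>0 i x) = (\<Sum>i<m. if i = c then LINT x:{0..1}|lborel. tmode 1 b' k x * \<gamma>0 i x else 0)"
      by (intro sum.cong refl) (simp add: \<phi>_def)
    then show ?thesis unfolding one .
  qed
  have fl_m: "(\<lambda>p. fl (fst p) (snd p)) \<in> borel_measurable (borel \<Otimes>\<^sub>M borel)"
  proof -
    have ms: "(\<lambda>p. \<rho> c (fst p) (snd p)) \<in> borel_measurable (borel \<Otimes>\<^sub>M borel)"
      "(\<lambda>p. gW c (fst p) (snd p)) \<in> borel_measurable (borel \<Otimes>\<^sub>M borel)"
      "(\<lambda>p. b c (fst p) (snd p)) \<in> borel_measurable (borel \<Otimes>\<^sub>M borel)"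
      "j < m \<Longrightarrow> (\<lambda>p. G c j (fst p) (snd p)) \<in> borel_measurable (borel \<Otimes>\<^sub>M borel)" if "c < m" for c j
      using rho_m[OF that] gW_m[OF that] smooth2_measurable[of "b c"] b_smooth[OF that] smooth2_measurable[of "G c j"] G_smooth[OF that, of j]
      by (simp_all add: case_prod_unfold smooth_test_def)
    show ?thesis unfolding fl_def Dmat_def Amat_def
      by (intro borel_measurable_add borel_measurable_diff borel_measurable_divide borel_measurable_sum borel_measurable_times
          borel_measurable_const) (use ms c in \<open>auto simp: if_distrib\<close>)
  qed
  have "(\<integral>x. \<rho> c t x * tmode 1 b' k x \<partial>mu 0 1) - (LINT x:{0..1}|lborel. tmode 1 b' k x * \<gamma>0 c x)
    = (LINT p:{0..t} \<times> {0..1}|lborel. - (d (snd p) * fl (fst p) (snd p)))"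
    using form[OF sm] t unfolding integrand lhs1[symmetric] lhs2[symmetric] by (simp add: dtz set_lebesgue_integral_def)
  also have "\<dots> = integral\<^sup>L (mu 0 t \<Otimes>\<^sub>M mu 0 1) (\<lambda>p. - (d (snd p) * fl (fst p) (snd p)))"
  proof (rule integral_mu_pair)
    have [measurable]: "(\<lambda>p. fl (fst p) (snd p)) \<in> borel_measurable (borel \<Otimes>\<^sub>M borel)" by (rule fl_m)
    have "(\<lambda>p. - (d (snd p) * fl (fst p) (snd p))) \<in> borel_measurable (borel \<Otimes>\<^sub>M borel)" unfolding d_def by measurable
    then show "(\<lambda>p. - (d (snd p) * fl (fst p) (snd p))) \<in> borel_measurable borel" by (simp only: borel_prod)
  qed
  also have "\<dots> = integral\<^sup>L (mu 0 t \<Otimes>\<^sub>M mu 0 1) (\<lambda>p. - dcoef 1 b' k * (case p of (s, x) \<Rightarrow> S.flux c s x * tmode 1 (\<not> b') k x))"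
  proof (rule integral_cong_AE)
    have [measurable]: "(\<lambda>p. fl (fst p) (snd p)) \<in> borel_measurable (borel \<Otimes>\<^sub>M borel)" by (rule fl_m)
    show "(\<lambda>p. - (d (snd p) * fl (fst p) (snd p))) \<in> borel_measurable (mu 0 t \<Otimes>\<^sub>M mu 0 1)" unfolding d_def by simp
    show "(\<lambda>p. - dcoef 1 b' k * (case p of (s, x) \<Rightarrow> S.flux c s x * tmode 1 (\<not> b') k x)) \<in> borel_measurable (mu 0 t \<Otimes>\<^sub>M mu 0 1)" by simp
    have "AE p in mu 0 t \<Otimes>\<^sub>M mu 0 1. fl (fst p) (snd p) = S.flux c (fst p) (snd p)"
    proof (rule AE_mu_pairI)
      show "Measurable.pred (borel \<Otimes>\<^sub>M borel) (\<lambda>p. fl (fst p) (snd p) = S.flux c (fst p) (snd p))"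
        unfolding pred_def by (intro borel_measurable_eq) measurable
      \<comment> \<open>Both gradients have the modes dictated by the density at almost every time,
        hence they coincide almost everywhere.\<close>
      have modesW: "AE s in mu 0 T. \<forall>j\<in>{..<m}. \<forall>b k. dcoef 1 b k * (\<integral>x. \<rho> j s x * tmode 1 (\<not> b) k x \<partial>mu 0 1) = - (\<integral>x. gW j s x * tmode 1 b k x \<partial>mu 0 1)"
        by (rule AE_finite_allI) (auto intro: slice_modes gW)
      have modesD: "AE s in mu 0 T. \<forall>j\<in>{..<m}. \<forall>b k. dcoef 1 b k * (\<integral>x. \<rho> j s x * tmode 1 (\<not> b) k x \<partial>mu 0 1) = - (\<integral>x. gD j s x * tmode 1 b k x \<partial>mu 0 1)"
        by (rule AE_finite_allI) (auto intro: slice_modes gD_weak)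
      have intW: "AE s in mu 0 T. \<forall>j\<in>{..<m}. integrable (mu 0 1) (gW j s)"
        by (rule AE_finite_allI) (use mup.AE_integrable_fst[OF weak_dx_int[OF gW]] in auto)
      have intD: "AE s in mu 0 T. \<forall>j\<in>{..<m}. integrable (mu 0 1) (gD j s)"
        by (rule AE_finite_allI) (use mup.AE_integrable_fst[OF weak_dx_int[OF gD_weak]] in auto)
      have "AE s in mu 0 T. AE x in mu 0 1. fl s x = S.flux c s x"
        using modesW modesD intW intD AE_mu_in
      proof eventually_elim
        case (elim s)
        have "AE x in mu 0 1. \<forall>j\<in>{..<m}. gW j s x = gD j s x"
        proof (rule AE_finite_allI)
          fix j assume j: "j \<in> {..<m}"
          show "AE x in mu 0 1. gW j s x = gD j s x"
          proof (rule modes_AE_eq)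
            show "integrable (mu 0 1) (gW j s)" "integrable (mu 0 1) (gD j s)" using elim(3,4) j by auto
            fix b k
            note elim(1)[THEN bspec, OF j, THEN spec, THEN spec, of b k]
              and elim(2)[THEN bspec, OF j, THEN spec, THEN spec, of b k]
            then have "- (\<integral>x. gW j s x * tmode 1 b k x \<partial>mu 0 1) = - (\<integral>x. gD j s x * tmode 1 b k x \<partial>mu 0 1)"
              by simp
            then show "(\<integral>x. gW j s x * tmode 1 b k x \<partial>mu 0 1) = (\<integral>x. gD j s x * tmode 1 b k x \<partial>mu 0 1)" by simp
          qed
        qed simp
        then show ?case using AE_mu_frac
        proof eventually_elim
          case (elim x)
          have eqs: "r j s x = \<rho> j s x" "g j s x = gW j s x" "ext1 m b j s x = b j s x" "ext2 m G c j s x = G c j s x" if "j < m" for j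
            using elim that c by (simp_all add: extp_def ext1_def ext2_def)
          have "fl s x = (lam * gW c s x + \<rho> c s x * (\<Sum>j<m. gW j s x)) / (lam + (\<Sum>j<m. \<rho> j s x)) / 2
              - \<rho> c s x * (lam * b c s x + (\<Sum>k<m. (b k s x - G c k s x) * \<rho> k s x)) / (lam + (\<Sum>j<m. \<rho> j s x))"
            unfolding fl_def by (rule flux_algebra[OF c lam]) (rule G_skew)
          also have "\<dots> = S.flux c s x"
            using c by (simp add: S.flux_def S.J_def S.F_def S.tot_def S.gt_def eqs)
          finally show ?case .
        qed
      qed
      then show "AE s in mu 0 t. AE x in mu 0 1. fl s x = S.flux c s x"
        by (rule AE_mu_subset) (use t in auto)
    qed
    then show "AE p in mu 0 t \<Otimes>\<^sub>M mu 0 1. - (d (snd p) * fl (fst p) (snd p))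
        = - dcoef 1 b' k * (case p of (s, x) \<Rightarrow> S.flux c s x * tmode 1 (\<not> b') k x)"
      by eventually_elim (simp add: d_def case_prod_unfold)
  qed
  also have "\<dots> = - dcoef 1 b' k * integral\<^sup>L (mu 0 t \<Otimes>\<^sub>M mu 0 1) (\<lambda>(s, x). S.flux c s x * tmode 1 (\<not> b') k x)"
    by simp
  also have "integral\<^sup>L (mu 0 t \<Otimes>\<^sub>M mu 0 1) (\<lambda>(s, x). S.flux c s x * tmode 1 (\<not> b') k x)
    = (\<integral>x. integral\<^sup>L (mu 0 t) (\<lambda>s. S.flux c s x) * tmode 1 (\<not> b') k x \<partial>mu 0 1)"
  proof -
    have i: "integrable (mu 0 t \<Otimes>\<^sub>M mu 0 1) (\<lambda>(s, x). S.flux c s x)"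
      by (rule integrable_mu_pair_subset[OF S.flux_int]) (use t in auto)
    have "integrable (mu 0 t \<Otimes>\<^sub>M mu 0 1) (\<lambda>p. (case p of (s, x) \<Rightarrow> S.flux c s x) * tmode 1 (\<not> b') k (snd p))"
      by (rule integrable_mult_bounded[OF i]) (auto simp: abs_tmode_le)
    then have "integrable (mu 0 t \<Otimes>\<^sub>M mu 0 1) (\<lambda>(s, x). S.flux c s x * tmode 1 (\<not> b') k x)" by (simp add: case_prod_unfold)
    from mup.integral_snd[OF this] show ?thesis by simp
  qed
  finally show ?thesis .
qed

text \<open>At time 0 the flux integral is empty. Two solutions with the same
  \<open>\<gamma>0\<close> therefore have the same initial modes and agree almost everywhere at time
  0.\<close>

lemma initial_modes:
  "c < m \<Longrightarrow> (\<integral>x. \<rho> c 0 x * tmode 1 b' k x \<partial>mu 0 1) = (LINT x:{0..1}|lborel. tmode 1 b' k x * \<gamma>0 c x)"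
  using mode_identity[of c 0 b' k] T by simp

text \<open>Subtracting the identity at time 0 eliminates \<open>\<gamma>0\<close>; the remaining
  relation between modes says that the time integral of the flux has the increment of the density as
  its space derivative.\<close>

lemma weak_flux:
  assumes t: "t \<in> {0..T}"
  shows "\<exists>A. prim A (\<lambda>x. r c t x - r c 0 x) \<and> (AE x in lborel. integral\<^sup>L (mu 0 t) (\<lambda>s. S.flux c s x) = A x)"
proof (cases "c < m")
  case False
  then have "S.flux c = (\<lambda>s x. 0)" "r c = (\<lambda>s x. 0)"
    by (auto simp: S.flux_def S.J_def S.F_def extp_def fun_eq_iff)
  then show ?thesis using prim_const[of 0] by (intro exI[of _ "\<lambda>_. 0"]) simp
next
  case True
  have 0: "0 \<in> {0..T}" using T by simp
  have rm: "r c s \<in> borel_measurable borel" for s by (rule extp_section_m[of \<rho>, OF rho_m[OF True] True])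
  have fm [measurable]: "case_prod (S.flux c) \<in> borel_measurable (borel \<Otimes>\<^sub>M borel)" by simp
  let ?Q = "\<lambda>x. integral\<^sup>L (mu 0 t) (\<lambda>s. S.flux c s x)"
  have iQ: "integrable (mu 0 1) ?Q"
    by (rule mup.integrable_snd, rule integrable_mu_pair_subset[OF S.flux_int]) (use t in auto)
  show ?thesis
  proof (rule modes_prim[where p="?Q" and q="\<lambda>x. \<rho> c t x - \<rho> c 0 x"])
    show "integrable (mu 0 1) ?Q" by (rule iQ)
    show "integrable (mu 0 1) (\<lambda>x. \<rho> c t x - \<rho> c 0 x)" using rho_slice(1)[OF True t] rho_slice(1)[OF True 0] by simp
    fix b' k
    have "dcoef 1 b' k * (\<integral>x. ?Q x * tmode 1 (\<not> b') k x \<partial>mu 0 1)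
      = - ((\<integral>x. \<rho> c t x * tmode 1 b' k x \<partial>mu 0 1) - (\<integral>x. \<rho> c 0 x * tmode 1 b' k x \<partial>mu 0 1))"
      using mode_identity[OF True t, of b' k] initial_modes[OF True, of b' k] by simp
    also have "(\<integral>x. \<rho> c t x * tmode 1 b' k x \<partial>mu 0 1) - (\<integral>x. \<rho> c 0 x * tmode 1 b' k x \<partial>mu 0 1)
      = (\<integral>x. (\<rho> c t x - \<rho> c 0 x) * tmode 1 b' k x \<partial>mu 0 1)"
      using integrable_tmode[OF rho_slice(1)[OF True t], of 1 b' k] integrable_tmode[OF rho_slice(1)[OF True 0], of 1 b' k]
      by (simp add: left_diff_distrib)
    finally show "dcoef 1 b' k * (\<integral>x. ?Q x * tmode 1 (\<not> b') k x \<partial>mu 0 1) = - (\<integral>x. (\<rho> c t x - \<rho> c 0 x) * tmode 1 b' k x \<partial>mu 0 1)" .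
  next
    show "AE x in mu 0 1. r c t x - r c 0 x = \<rho> c t x - \<rho> c 0 x"
      using AE_mu_frac by eventually_elim (simp add: extp_eq True)
  qed (use rm in \<open>auto simp: S.flux_per S.r_per\<close>)
qed

sublocale E: energy_solution m lam T beta "ext1 m b" "ext2 m G" r g M
  by standard (rule weak_flux)

text \<open>Weak continuity in time, needed to pass from almost every time to every time.\<close>

lemma pairing_continuous:
  assumes c: "c < m"
  shows "continuous_on {0..T} (\<lambda>t. \<integral>x. \<rho> c t x * tmode 1 b' k x \<partial>mu 0 1)"
proof -
  have cont: "continuous_on UNIV (tmode 1 b' k)" unfolding tmode_def[abs_def]
    by (cases b') (auto intro!: continuous_intros)
  have "continuous_on {0..T} (\<lambda>t. LINT x:{0..1}|lborel. tmode 1 b' k x * \<rho> c t x)"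
    using D c cont tmode_periodic[of 1 b' k] unfolding Dcolor_def by auto
  moreover have "(LINT x:{0..1}|lborel. tmode 1 b' k x * \<rho> c t x) = (\<integral>x. \<rho> c t x * tmode 1 b' k x \<partial>mu 0 1)" for t
    using section_m[OF rho_m[OF c], of t] by (subst set_integral_mu) (simp_all add: mult.commute)
  ultimately show ?thesis by simp
qed

end

section \<open>Weak-strong uniqueness\<close>

lemma in_D0_Dcolor: "in_D0 Iinit m lam T rbar \<rho> \<Longrightarrow> \<exists>g. Dcolor m lam T rbar \<rho> g"
  unfolding in_D0_def Icolor_def by (auto split: if_splits)

lemma P0_bounded:
  assumes "P0 m b G eta"
  obtains beta where "0 \<le> beta" "\<And>c t x. c < m \<Longrightarrow> t \<in> {0..T} \<Longrightarrow> \<bar>b c t x\<bar> \<le> beta"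
    "\<And>i j t x. i < m \<Longrightarrow> j < m \<Longrightarrow> t \<in> {0..T} \<Longrightarrow> \<bar>G i j t x\<bar> \<le> beta"
proof -
  have "\<exists>C\<ge>0. \<forall>t\<in>{0..T}. \<forall>x. \<bar>b c t x\<bar> \<le> C" if "c < m" for c
    using assms that smooth_test_bounded[of "b c" 0 T] unfolding P0_def by metis
  then obtain C where C: "\<And>c. c < m \<Longrightarrow> 0 \<le> C c \<and> (\<forall>t\<in>{0..T}. \<forall>x. \<bar>b c t x\<bar> \<le> C c)" by metis
  have "\<exists>C\<ge>0. \<forall>t\<in>{0..T}. \<forall>x. \<bar>G i j t x\<bar> \<le> C" if "i < m" "j < m" for i j
    using assms that smooth_test_bounded[of "G i j" 0 T] unfolding P0_def by metis
  then obtain C' where C': "\<And>i j. i < m \<Longrightarrow> j < m \<Longrightarrow> 0 \<le> C' i j \<and> (\<forall>t\<in>{0..T}. \<forall>x. \<bar>G i j t x\<bar> \<le> C' i j)" by metis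
  define beta where "beta = (\<Sum>c<m. C c) + (\<Sum>i<m. \<Sum>j<m. C' i j)"
  have p: "0 \<le> (\<Sum>c<m. C c)" "0 \<le> (\<Sum>i<m. \<Sum>j<m. C' i j)" using C C' by (auto intro!: sum_nonneg)
  show thesis
  proof (rule that[of beta])
    show "0 \<le> beta" using p by (simp add: beta_def)
    show "\<bar>b c t x\<bar> \<le> beta" if "c < m" "t \<in> {0..T}" for c t x
    proof -
      have "\<bar>b c t x\<bar> \<le> C c" using C that by blast
      also have "C c \<le> (\<Sum>c<m. C c)" using C that by (intro member_le_sum) auto
      finally show ?thesis using p by (simp add: beta_def)
    qed
    show "\<bar>G i j t x\<bar> \<le> beta" if "i < m" "j < m" "t \<in> {0..T}" for i j t x
    proof -
      have "\<bar>G i j t x\<bar> \<le> C' i j" using C' that by blast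
      also have "C' i j \<le> (\<Sum>j<m. C' i j)" using C' that by (intro member_le_sum) auto
      also have "\<dots> \<le> (\<Sum>i<m. \<Sum>j<m. C' i j)" using C' that by (intro member_le_sum[of i _ "\<lambda>i. \<Sum>j<m. C' i j"]) (auto intro!: sum_nonneg)
      finally show ?thesis using p by (simp add: beta_def)
    qed
  qed
qed

text \<open>From \<open>eta\<close> on the density agrees with a smooth function, so its weak
  gradient is the classical one and compactness gives the bound. The smooth function inherits
  periodicity at exactly those times at which it equals the density.\<close>

lemma (in color_setup) smooth_gradient_bounded:
  assumes eta: "0 < eta" and per: "\<And>c t x. c < m \<Longrightarrow> t \<in> {0<..T} \<Longrightarrow> \<rho> c t (x + 1) = \<rho> c t x"
    and smooth: "\<And>c s. c < m \<Longrightarrow> s \<in> {0<..T} \<Longrightarrow> \<exists>f. smooth2 f \<and> (\<forall>t\<in>{s..T}. \<forall>x. \<rho> c t x = f t x)"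
  shows "\<exists>R. AE t in mu 0 T. eta \<le> t \<longrightarrow> (AE x in mu 0 1. \<forall>c. \<bar>r c t x\<bar> \<le> R \<and> \<bar>g c t x\<bar> \<le> R)"
proof (cases "eta \<le> T")
  case False
  have "AE t in mu 0 T. eta \<le> t \<longrightarrow> (AE x in mu 0 1. \<forall>c. \<bar>r c t x\<bar> \<le> 0 \<and> \<bar>g c t x\<bar> \<le> 0)"
    using AE_mu_in by eventually_elim (use False in auto)
  then show ?thesis by blast
next
  case True
  define Q where "Q c f C \<longleftrightarrow> smooth2 f \<and> (\<forall>t\<in>{eta..T}. \<forall>x. \<rho> c t x = f t x) \<and> 0 \<le> C \<and>
      (\<forall>t\<in>{eta..T}. \<forall>x\<in>{0..1}. \<bar>f t x\<bar> \<le> C \<and> \<bar>dx f t x\<bar> \<le> C)" for c f C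
  have "\<forall>c\<in>{..<m}. \<exists>p. Q c (fst p) (snd p)"
  proof
    fix c assume "c \<in> {..<m}"
    then have c: "c < m" by simp
    obtain f where f: "smooth2 f" "\<forall>t\<in>{eta..T}. \<forall>x. \<rho> c t x = f t x" using smooth[OF c, of eta] eta True by auto
    obtain C1 where C1: "0 \<le> C1" "\<And>t x. t \<in> {eta..T} \<Longrightarrow> x \<in> {0..1} \<Longrightarrow> \<bar>pdiff [] f t x\<bar> \<le> C1"
      using smooth2_bounded[OF f(1)] by metis
    obtain C2 where C2: "0 \<le> C2" "\<And>t x. t \<in> {eta..T} \<Longrightarrow> x \<in> {0..1} \<Longrightarrow> \<bar>pdiff [False] f t x\<bar> \<le> C2"
      using smooth2_bounded[OF f(1)] by metis
    have "\<bar>f t x\<bar> \<le> C1 + C2 \<and> \<bar>dx f t x\<bar> \<le> C1 + C2" if "t \<in> {eta..T}" "x \<in> {0..1}" for t x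
    proof -
      have "\<bar>f t x\<bar> \<le> C1" "\<bar>dx f t x\<bar> \<le> C2" using C1(2)[OF that] C2(2)[OF that] by (simp_all add: dx_def)
      then show ?thesis using C1(1) C2(1) by simp
    qed
    then have "Q c f (C1 + C2)" unfolding Q_def using f C1(1) C2(1) by auto
    then show "\<exists>p. Q c (fst p) (snd p)" by (intro exI[of _ "(f, C1 + C2)"]) simp
  qed
  from bchoice[OF this] obtain p where "\<And>c. c < m \<Longrightarrow> Q c (fst (p c)) (snd (p c))" by auto
  then obtain f C where "\<And>c. c < m \<Longrightarrow> Q c (f c) (C c)" by (rule that[of "\<lambda>c. fst (p c)" "\<lambda>c. snd (p c)"])
  then have f: "\<And>c. c < m \<Longrightarrow> smooth2 (f c)" "\<And>c t x. c < m \<Longrightarrow> t \<in> {eta..T} \<Longrightarrow> \<rho> c t x = f c t x"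
    and C: "\<And>c. c < m \<Longrightarrow> 0 \<le> C c"
      "\<And>c t x. c < m \<Longrightarrow> t \<in> {eta..T} \<Longrightarrow> x \<in> {0..1} \<Longrightarrow> \<bar>f c t x\<bar> \<le> C c \<and> \<bar>dx (f c) t x\<bar> \<le> C c"
    unfolding Q_def by blast+
  define R where "R = (\<Sum>c<m. C c)"
  have CR: "C c \<le> R" if "c < m" for c unfolding R_def using C(1) that by (intro member_le_sum) auto
  have R0: "0 \<le> R" unfolding R_def using C(1) by (auto intro: sum_nonneg)
  have "AE t in mu 0 T. eta \<le> t \<longrightarrow> (AE x in mu 0 1. \<forall>c. \<bar>r c t x\<bar> \<le> R \<and> \<bar>g c t x\<bar> \<le> R)"
    using S.slice_all AE_mu_in
  proof eventually_elim
    case (elim t)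
    show ?case
    proof
      assume "eta \<le> t"
      then have t: "t \<in> {eta..T}" "t \<in> {0<..T}" using eta elim(2) by auto
      have ae: "AE x in mu 0 1. g c t x = dx (f c) t x" if c: "c < m" for c
      proof -
        have fper: "f c t (x + 1) = f c t x" for x
          using per[OF c t(2), of x] f(2)[OF c t(1), of x] f(2)[OF c t(1), of "x + 1"] by simp
        have pf: "prim (f c t) (dx (f c) t)" by (intro prim_smooth[of "f c" t] f(1) c fper)
        obtain A where A: "prim A (g c t)" "AE x in lborel. r c t x = A x"
          using elim(1)[THEN spec, of c] by (elim exE conjE) (rule that)
        have "AE x in lborel. A x - f c t x = 0"
          using A(2)
        proof eventually_elim
          case (elim x)
          have "r c t x = f c t (frac x)" using f(2)[OF c t(1), of "frac x"] c by (simp add: extp_def)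
          also have "\<dots> = f c t x" by (rule prim_frac[OF pf])
          finally show ?case using elim by linarith
        qed
        then have "AE x in mu 0 1. g c t x - dx (f c) t x = 0" by (rule prim_zero[OF prim_diff[OF A(1) pf]])
        then show ?thesis by simp
      qed
      have "AE x in mu 0 1. \<forall>c\<in>{..<m}. g c t x = dx (f c) t x"
        by (rule AE_finite_allI) (auto intro: ae)
      then show "AE x in mu 0 1. \<forall>c. \<bar>r c t x\<bar> \<le> R \<and> \<bar>g c t x\<bar> \<le> R"
        using AE_mu_in AE_mu_frac
      proof eventually_elim
        case (elim x)
        have "\<bar>r c t x\<bar> \<le> R \<and> \<bar>g c t x\<bar> \<le> R" for c
        proof (cases "c < m")
          case True
          then have "r c t x = f c t x" using f(2)[OF True t(1), of x] elim(3) by (simp add: extp_def)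
          moreover have "g c t x = dx (f c) t x" using elim(1) True by blast
          ultimately show ?thesis using C(2)[OF True t(1) elim(2)] CR[OF True] by auto
        qed (simp add: extp_def R0)
        then show ?case by (intro allI)
      qed
    qed
  qed
  then show ?thesis by (rule exI[of _ R])
qed

theorem theorem4p5:
  fixes m :: nat and lam T :: real and rbar :: "nat \<Rightarrow> real"
    and Iinit :: "(nat \<Rightarrow> real measure) \<Rightarrow> ennreal"
    and b :: "nat \<Rightarrow> real \<Rightarrow> real \<Rightarrow> real" and G :: "nat \<Rightarrow> nat \<Rightarrow> real \<Rightarrow> real \<Rightarrow> real"
    and eta :: real
    and u v :: "nat \<Rightarrow> real \<Rightarrow> real \<Rightarrow> real" and \<gamma>0 :: "nat \<Rightarrow> real \<Rightarrow> real"
  assumes "lam > 0" and "T > 0" and "m \<ge> 1" and "\<forall>c<m. rbar c > 0"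
    and "P0 m b G eta"
    and "in_E0 Iinit m lam T rbar u"
    and "weak_solution m lam T b G \<gamma>0 u"
    and "(\<integral>\<^sup>+ x\<in>{0..1}. ennreal ((\<Sum>c<m. \<gamma>0 c x) * ln (\<Sum>c<m. \<gamma>0 c x)) \<partial>lborel) < \<infinity>"
    and "in_D0 Iinit m lam T rbar v"
    and "weak_solution m lam T b G \<gamma>0 v"
  shows "\<forall>c<m. \<forall>t\<in>{0..T}. AE x in lborel. x \<in> {0..1} \<longrightarrow> v c t x = u c t x"
proof -
  have "in_D0 Iinit m lam T rbar u" using assms(6) by (simp add: in_E0_def)
  then obtain gu where gu: "Dcolor m lam T rbar u gu" using in_D0_Dcolor by blast
  obtain gv where gv: "Dcolor m lam T rbar v gv" using in_D0_Dcolor[OF assms(9)] by blast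
  obtain beta where beta: "0 \<le> beta" "\<And>c t x. c < m \<Longrightarrow> t \<in> {0..T} \<Longrightarrow> \<bar>b c t x\<bar> \<le> beta"
    "\<And>i j t x. i < m \<Longrightarrow> j < m \<Longrightarrow> t \<in> {0..T} \<Longrightarrow> \<bar>G i j t x\<bar> \<le> beta"
    using P0_bounded[OF assms(5)] by metis
  interpret V: color_setup m lam T beta eta rbar b G \<gamma>0 v gv
    by unfold_locales (use assms(1,2,5,10) gv beta in auto)
  interpret U: color_setup m lam T beta eta rbar b G \<gamma>0 u gu
    by unfold_locales (use assms(1,2,5,7) gu beta in auto)
  have eta: "0 < eta" using assms(5) by (simp add: P0_def)
  \<comment> \<open>Here \<open>eta\<close> belongs to the given coefficients; it is admissible
    because \<open>u\<close> is smooth from every positive time on.\<close>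
  obtain R where R: "AE t in mu 0 T. eta \<le> t \<longrightarrow> (AE x in mu 0 1. \<forall>c. \<bar>extp m u c t x\<bar> \<le> R \<and> \<bar>extp m gu c t x\<bar> \<le> R)"
    using U.smooth_gradient_bounded[OF eta] assms(6) unfolding in_E0_def by blast
  have zero: "0 \<in> {0..T}" using assms(2) by simp
  have init: "AE x in lborel. extp m v c 0 x = extp m u c 0 x" for c
  proof (rule AE_periodic)
    show "AE x in mu 0 1. extp m v c 0 x = extp m u c 0 x"
    proof (cases "c < m")
      case True
      have "AE x in mu 0 1. v c 0 x = u c 0 x"
        by (rule V.modes_AE_eq[OF V.rho_slice(1)[OF True zero] U.rho_slice(1)[OF True zero]])
           (simp add: V.initial_modes[OF True] U.initial_modes[OF True])
      then show ?thesis using AE_mu_frac by eventually_elim (simp add: extp_def)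
    qed (simp add: extp_def)
  qed (simp add: extp_per)
  interpret two_solutions m lam T beta "ext1 m b" "ext2 m G" "extp m v" "extp m gv" "extp m u" "extp m gu"
    "\<lambda>c. if c < m then rbar c else 0" eta R
  proof unfold_locales
    show "1 \<le> m" by fact
    show "AE t in mu 0 T. eta \<le> t \<longrightarrow> (AE x in mu 0 1. \<forall>c. \<bar>extp m u c t x\<bar> \<le> R \<and> \<bar>extp m gu c t x\<bar> \<le> R)" by (rule R)
    fix t x :: real and c i j :: nat
    show "AE x in lborel. extp m v c 0 x = extp m u c 0 x" by (rule init)
    assume "t \<in> {0..T}" "t \<le> eta"
    then have "t \<in> {0..eta}" by simp
    then show "ext1 m b c t x = 0" "ext2 m G i j t x = 0"
      using assms(5) unfolding P0_def ext1_def ext2_def by auto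
  qed
  show ?thesis
  proof (intro allI impI ballI)
    fix c t assume c: "c < m" and t: "t \<in> {0..T}"
    \<comment> \<open>For each mode the difference of the pairings is continuous in time and zero at
      almost every time, hence zero at \<open>t\<close>; the modes then determine the slice.\<close>
    have "(\<integral>x. v c t x * tmode 1 b' k x \<partial>mu 0 1) = (\<integral>x. u c t x * tmode 1 b' k x \<partial>mu 0 1)" for b' k
    proof -
      define d where "d s = (\<integral>x. v c s x * tmode 1 b' k x \<partial>mu 0 1) - (\<integral>x. u c s x * tmode 1 b' k x \<partial>mu 0 1)" for s
      have cont: "continuous_on {0..T} d" unfolding d_def
        by (intro continuous_intros V.pairing_continuous[OF c] U.pairing_continuous[OF c])
      have "AE s in mu 0 T. d s = 0"
        using uniqueness
      proof eventually_elim
        case (elim s)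
        have ae: "AE x in mu 0 1. v c s x * tmode 1 b' k x = u c s x * tmode 1 b' k x"
          using elim AE_mu_frac
        proof eventually_elim
          case (elim x)
          then have "extp m v c s x = extp m u c s x" using c by blast
          then show ?case using elim(2) c by (simp add: extp_def)
        qed
        have "(\<integral>x. v c s x * tmode 1 b' k x \<partial>mu 0 1) = (\<integral>x. u c s x * tmode 1 b' k x \<partial>mu 0 1)"
          by (rule integral_cong_AE[OF _ _ ae])
             (use V.section_m[OF V.rho_m[OF c], of s] U.section_m[OF U.rho_m[OF c], of s] in auto)
        then show ?case by (simp add: d_def)
      qed
      then have "d t = 0" by (rule continuous_AE_zero_Icc[OF cont assms(2) _ t])
      then show ?thesis by (simp add: d_def)
    qed
    then have "AE x in mu 0 1. v c t x = u c t x"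
      by (rule V.modes_AE_eq[OF V.rho_slice(1)[OF c t] U.rho_slice(1)[OF c t]])
    then show "AE x in lborel. x \<in> {0..1} \<longrightarrow> v c t x = u c t x" by (simp only: AE_mu)
  qed
qed

end
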